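(* For real binary forms of degree $8$, the real rank boundaries are the following hypersurfaces of $\mathbb{P}(\mathbb{C}[x,y]_8)\cong\mathbb{P}^8_{\mathbb{C}}$: \begin{align*} \partial_{\mathrm{alg}}(\mathcal{R}_{8,5}) &= (\Delta_{(3,3,2)})^\vee\cup(\Delta_{(4,2,2)})^\vee,\\ \partial_{\mathrm{alg}}(\mathcal{R}_{8,6}) &= (\Delta_{(3,3,2)})^\vee\cup(\Delta_{(4,2,2)})^\vee\cup(\Delta_{(4,4)})^\vee\cup(\Delta_{(5,3)})^\vee\cup(\Delta_{(6,2)})^\vee,\\ \partial_{\mathrm{alg}}(\mathcal{R}_{8,7}) &= (\Delta_{(4,4)})^\vee\cup(\Delta_{(5,3)})^\vee\cup(\Delta_{(6,2)})^\vee\cup(\Delta_{(8)})^\vee,\\ \partial_{\mathrm{alg}}(\mathcal{R}_{8,8}) &= (\Delta_{(8)})^\vee. \end{align*}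
   Context: Let $R=\mathbb{R}[x,y]$ and $R_d$ its space of binary forms of degree $d$. The real rank $\mathrm{rk}(f)$ of $f\in R_d$ is the least $r$ such that $f=\sum_{i=1}^r c_i l_i^d$ with $l_i\in R_1$, $c_i\in\mathbb{R}$. Let $\Omega_{d,r}=\{f\in R_d:\mathrm{rk}(f)=r\}$ and let $\mathcal{R}_{d,r}$ be the interior of $\Omega_{d,r}$ in the Euclidean topology (nonempty exactly when $\frac{d+1}{2}\le r\le d$). The topological boundary $\partial(\mathcal{R}_{d,r})$ is the closure of $\mathcal{R}_{d,r}$ minus the interior of the closure of $\mathcal{R}_{d,r}$; the real rank boundary $\partial_{\mathrm{alg}}(\mathcal{R}_{d,r})$ is the Zariski closure of $\partial(\mathcal{R}_{d,r})$, regarded as a hypersurface in the complex projective space $\mathbb{P}(\mathbb{C}[x,y]_d)$ (with coordinates $(a_0,\dots,a_d)$ for $f=\sum_i\binom{d}{i}a_ix^{d-i}y^i$). Let $\mathbb{C}[u,v]=\mathbb{C}[\partial_x,\partial_y]$ act on $\mathbb{C}[x,y]$ by differentiation, giving a perfect pairing $\mathbb{C}[x,y]_d\otimes\mathbb{C}[u,v]_d\to\mathbb{C}$. For a partition $\lambda=(\lambda_1,\dots,\lambda_n)$ of $d$, the coincident root locus $\Delta_\lambda\subset\mathbb{P}(\mathbb{C}[u,v]_d)$ is the set of forms that factor as $\prod_{i=1}^n\ell_i^{\lambda_i}$ with $\ell_i\in\mathbb{C}[u,v]_1$. Its dual variety $(\Delta_\lambda)^\vee\subset\mathbb{P}(\mathbb{C}[x,y]_d)$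 is the closure of the set of $f$ (viewed as hyperplanes via the pairing) containing the embedded tangent space $T_g\Delta_\lambda$ at some smooth point $g$ of $\Delta_\lambda$; equivalently, $(\Delta_\lambda)^\vee$ consists of the $f\in\mathbb{C}[x,y]_d$ annihilated by some differential operator $\prod_{i=1}^n\ell_i^{\lambda_i-1}(\partial_x,\partial_y)$ with $\ell_i\in\mathbb{C}[u,v]_1$. *)

theory Defs
  imports "HOL-Analysis.Analysis" "HOL-Library.Numeral_Type"
begin

text \<open>Binary forms of degree d are encoded by coordinate vectors (a_0,...,a_d) in
  K^'n (with CARD('n) = d+1), f = sum_i (d choose i) a_i x^(d-i) y^i;
  coordinate a_i is the entry at index (of_nat i).\<close>

text \<open>f has a real Waring decomposition of length r:
  f = sum_{j<r} c_j (alpha_j x + beta_j y)^d.  The coordinates of (alpha x + beta y)^d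
  are a_i = alpha^(d-i) beta^i.\<close>
definition waring_decomp :: "nat \<Rightarrow> nat \<Rightarrow> real ^ 'n::{finite,comm_ring_1} \<Rightarrow> bool" where
  "waring_decomp d r a \<longleftrightarrow>
     (\<exists>c \<alpha> \<beta> :: nat \<Rightarrow> real. \<forall>i\<le>d.
        a $ of_nat i = (\<Sum>j<r. c j * \<alpha> j ^ (d - i) * \<beta> j ^ i))"

definition real_rank :: "nat \<Rightarrow> real ^ 'n::{finite,comm_ring_1} \<Rightarrow> nat" where
  "real_rank d a = (LEAST r. waring_decomp d r a)"

definition Omega :: "nat \<Rightarrow> nat \<Rightarrow> (real ^ 'n::{finite,comm_ring_1}) set" where
  "Omega d r = {a. real_rank d a = r}"

definition rank_region :: "nat \<Rightarrow> nat \<Rightarrow> (real ^ 'n::{finite,comm_ring_1}) set" where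
  "rank_region d r = interior (Omega d r)"

definition topo_boundary :: "nat \<Rightarrow> nat \<Rightarrow> (real ^ 'n::{finite,comm_ring_1}) set" where
  "topo_boundary d r = closure (rank_region d r) - interior (closure (rank_region d r))"

inductive_set poly_fun :: "(complex ^ 'n \<Rightarrow> complex) set" where
  pf_const: "(\<lambda>z. c) \<in> poly_fun"
| pf_coord: "(\<lambda>z. z $ i) \<in> poly_fun"
| pf_add: "p \<in> poly_fun \<Longrightarrow> q \<in> poly_fun \<Longrightarrow> (\<lambda>z. p z + q z) \<in> poly_fun"
| pf_mult: "p \<in> poly_fun \<Longrightarrow> q \<in> poly_fun \<Longrightarrow> (\<lambda>z. p z * q z) \<in> poly_fun"

definition zariski_closure :: "(complex ^ 'n) set \<Rightarrow> (complex ^ 'n) set" where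
  "zariski_closure S = {z. \<forall>p\<in>poly_fun. (\<forall>s\<in>S. p s = 0) \<longrightarrow> p z = 0}"

definition complexify :: "real ^ 'n \<Rightarrow> complex ^ 'n" where
  "complexify a = (\<chi> i. complex_of_real (a $ i))"

text \<open>Affine cone over the real rank boundary.\<close>
definition alg_boundary :: "nat \<Rightarrow> nat \<Rightarrow> (complex ^ 'n::{finite,comm_ring_1}) set" where
  "alg_boundary d r = zariski_closure (complexify ` topo_boundary d r)"

text \<open>Forms in plain coefficients: b i is the coefficient of x^(m-i) y^i (resp. u^(m-i) v^i).\<close>

fun dxs :: "nat \<Rightarrow> nat \<Rightarrow> (nat \<Rightarrow> complex) \<Rightarrow> (nat \<Rightarrow> complex)" where
  "dxs m 0 b = b"
| "dxs m (Suc k) b = dxs (m - 1) k (\<lambda>i. of_nat (m - i) * b i)"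

definition dy :: "(nat \<Rightarrow> complex) \<Rightarrow> (nat \<Rightarrow> complex)" where
  "dy b = (\<lambda>i. of_nat (Suc i) * b (Suc i))"

text \<open>Apply g(partial_x, partial_y), g of degree e, to a form b of degree d.\<close>
definition apply_op :: "nat \<Rightarrow> nat \<Rightarrow> (nat \<Rightarrow> complex) \<Rightarrow> (nat \<Rightarrow> complex) \<Rightarrow> (nat \<Rightarrow> complex)" where
  "apply_op d e g b = (\<lambda>k. \<Sum>j\<le>e. g j * dxs (d - j) (e - j) ((dy ^^ j) b) k)"

definition fmult :: "(nat \<Rightarrow> complex) \<Rightarrow> (nat \<Rightarrow> complex) \<Rightarrow> (nat \<Rightarrow> complex)" where
  "fmult b c = (\<lambda>k. \<Sum>i\<le>k. b i * c (k - i))"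

definition fone :: "nat \<Rightarrow> complex" where
  "fone = (\<lambda>i. if i = 0 then 1 else 0)"

definition lin_form :: "complex \<times> complex \<Rightarrow> (nat \<Rightarrow> complex)" where
  "lin_form l = (\<lambda>i. if i = 0 then fst l else if i = 1 then snd l else 0)"

definition lin_pow :: "complex \<times> complex \<Rightarrow> nat \<Rightarrow> (nat \<Rightarrow> complex)" where
  "lin_pow l k = (fmult (lin_form l) ^^ k) fone"

definition crl_operator :: "nat list \<Rightarrow> (nat \<Rightarrow> complex \<times> complex) \<Rightarrow> (nat \<Rightarrow> complex)" where
  "crl_operator lam ls =
     foldr (\<lambda>i acc. fmult (lin_pow (ls i) (lam ! i - 1)) acc) [0..<length lam] fone"

definition form_coeffs :: "nat \<Rightarrow> complex ^ 'n::{finite,comm_ring_1} \<Rightarrow> (nat \<Rightarrow> complex)" where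
  "form_coeffs d a = (\<lambda>i. if i \<le> d then of_nat (d choose i) * a $ of_nat i else 0)"

text \<open>Dual variety of the coincident root locus Delta_lambda (lambda a partition of d),
  as an affine cone: f annihilated by prod_i l_i^(lambda_i - 1)(partial_x, partial_y) for some
  nonzero linear forms l_i (Zariski closure taken for safety; the set is already closed).\<close>
definition dual_crl :: "nat \<Rightarrow> nat list \<Rightarrow> (complex ^ 'n::{finite,comm_ring_1}) set" where
  "dual_crl d lam = zariski_closure
     {a. \<exists>ls. (\<forall>i<length lam. ls i \<noteq> (0, 0)) \<and>
            apply_op d (d - length lam) (crl_operator lam ls) (form_coeffs d a) = (\<lambda>_. 0)}"

end

theory Submission
  imports Defs "HOL-Computational_Algebra.Polynomial" "HOL-Library.Multiset"
begin

text \<open>A form of degree 8 is a linear functional on forms of degree 8 in the dual variables, and by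
Sylvester its real rank is at most r iff it is annihilated by a form of degree r with r distinct
real roots. Relaxing distinctness gives a closed set Pset r. Among the real-rooted annihilators of
degree r of a point of Pset r choose one with the most distinct roots: either the point is
interior to the forms of rank at most r, or some real-rooted annihilator of degree at most r has
at most 8 - r distinct roots. This bounds the topological boundaries by the real points of the dual
loci.

Conversely, for each partition there is an explicit real form whose only real-rooted annihilator
of degree r is \<open>u\<^sup>m(u - 1)\<^sup>n\<close>, with the remaining roots at infinity. For all forms near
it with the same annihilator, subtracting a small positive multiple of an eighth power leaves
Pset r, so these forms lie on the boundary of two consecutive rank regions. Their orbit under GL(2)
is Zariski dense in the dual locus, because a function that is polynomial in each variable and
vanishes on a product of infinite sets vanishes identically.\<close>

section \<open>Forms as functionals and apolarity\<close>

text \<open>The pattern of the four answers has two sources. At an exceptional point some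
  annihilator of degree r has its r roots on 8 - r nodes, possibly coinciding: multiplicities 2+2+1
  or 3+1+1 for r = 5, 3+3, 4+2 or 5+1 for r = 6, and 7 for r = 7. Adding 1 to each multiplicity
  gives the partitions. Moreover the region of rank r is governed by the conditions in degrees r and
  r - 1, so each locus serves two consecutive regions. At the ends of the chain, a sum of five
  eighth powers at distinct nodes with nonzero weights has no nonzero annihilator of degree 4, and
  in degree 8 only the zero form is exceptional.

  The obstacle in the converse is that lying outside \<open>Pset r\<close> concerns all real-rooted
  annihilators of nearby forms. Uniqueness at one explicit form and compactness confine their roots
  to clusters around 0, infinity and 1, where the second symmetric function of the roots decides.
  Three positions are enough, since at most three nodes occur and GL(2) moves any three points of
  the projective line to these.\<close>

lemma ex_of_nat_9: "\<exists>i\<le>8. (k::9) = of_nat i"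
proof -
  obtain z where z: "k = of_int z" "0 \<le> z" "z < int CARD(9)"
    using bit1.cases[of k] by auto
  then have "k = of_nat (nat z)" "nat z \<le> 8" by auto
  then show ?thesis by blast
qed

lemma of_nat_9_inject: "i \<le> 8 \<Longrightarrow> j \<le> 8 \<Longrightarrow> (of_nat i :: 9) = of_nat j \<longleftrightarrow> i = j"
proof -
  have "inj_on (of_nat :: nat \<Rightarrow> 9) {..8}"
  proof (rule eq_card_imp_inj_on)
    have "of_nat ` {..8} = (UNIV :: 9 set)" using ex_of_nat_9 by auto
    then show "card ((of_nat :: nat \<Rightarrow> 9) ` {..8}) = card {..8::nat}" by simp
  qed simp
  then show "i \<le> 8 \<Longrightarrow> j \<le> 8 \<Longrightarrow> (of_nat i :: 9) = of_nat j \<longleftrightarrow> i = j"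
    by (auto dest: inj_onD)
qed

lemma all_9: "(\<forall>k::9. Q k) \<longleftrightarrow> (\<forall>i\<le>8. Q (of_nat i))"
  using ex_of_nat_9 by metis

lemma vec9_eq_iff: "(a :: 'a ^ 9) = b \<longleftrightarrow> (\<forall>i\<le>8. a $ of_nat i = b $ of_nat i)"
  by (simp add: vec_eq_iff all_9)

text \<open>The index type is the ring of integers modulo 9, so a vector is read off a function on
  0, ..., 8 through the representative of each residue in that range; further values of f are
  ignored.\<close>

definition vec_of :: "(nat \<Rightarrow> 'a) \<Rightarrow> 'a ^ 9" where
  "vec_of f = (\<chi> k. f (SOME i. i \<le> 8 \<and> of_nat i = k))"

lemma vec_of_nth [simp]: "i \<le> 8 \<Longrightarrow> vec_of f $ of_nat i = f i"
proof -
  assume i: "i \<le> 8"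
  have "(SOME j. j \<le> 8 \<and> of_nat j = (of_nat i :: 9)) = i"
    by (rule some_equality) (use i of_nat_9_inject in auto)
  then show ?thesis by (simp add: vec_of_def)
qed

lemma tendsto_vec9:
  fixes f :: "'b \<Rightarrow> ('a::topological_space) ^ 9"
  assumes "\<And>i. i \<le> 8 \<Longrightarrow> ((\<lambda>t. f t $ of_nat i) \<longlongrightarrow> l $ of_nat i) F"
  shows "(f \<longlongrightarrow> l) F"
  by (rule vec_tendstoI) (metis assms ex_of_nat_9)

text \<open>A form of degree at most 8 in the dual variables is represented by its dehomogenisation in u; a
drop of the degree below the nominal one is a root at infinity, that is, at the node (0, 1).\<close>

definition pairing :: "'a::comm_ring_1 ^ 9 \<Rightarrow> 'a poly \<Rightarrow> 'a" where
  "pairing a p = (\<Sum>i\<le>8. coeff p i * a $ of_nat i)"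

lemma pairing_add: "pairing a (p + q) = pairing a p + pairing a q"
  by (simp add: pairing_def sum.distrib algebra_simps)

lemma pairing_diff: "pairing a (p - q) = pairing a p - pairing a q"
  by (simp add: pairing_def sum_subtractf algebra_simps)

lemma pairing_smult: "pairing a (smult c p) = c * pairing a p"
  by (simp add: pairing_def sum_distrib_left algebra_simps)

lemma pairing_0 [simp]: "pairing a 0 = 0"
  by (simp add: pairing_def)

lemma pairing_sum: "pairing a (sum f S) = (\<Sum>x\<in>S. pairing a (f x))"
  by (induction S rule: infinite_finite_induct) (simp_all add: pairing_add)

lemma pairing_monom: "i \<le> 8 \<Longrightarrow> pairing a (monom c i) = c * a $ of_nat i"
  by (simp add: pairing_def if_distrib[of "\<lambda>x. x * _"] sum.delta cong: if_cong)

lemma pairing_add_left: "pairing (a + b) p = pairing a p + pairing b p"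
  by (simp add: pairing_def sum.distrib algebra_simps)

lemma pairing_diff_left: "pairing (a - b) p = pairing a p - pairing b p"
  by (simp add: pairing_def sum_subtractf algebra_simps)

lemma pairing_scaleR_left: "pairing (c *\<^sub>R a) p = c * pairing a p" for a :: "real ^ 9"
  by (simp add: pairing_def sum_distrib_left algebra_simps)

lemma poly_as_sum_le: "degree p \<le> d \<Longrightarrow> p = (\<Sum>i\<le>d. monom (coeff p i) i)"
  by (rule poly_eqI) (auto simp: coeff_sum coeff_eq_0 if_distrib cong: if_cong)

text \<open>This says that g, read as a form of nominal degree e, kills the form a as a differential
  operator: the functional a vanishes on all multiples of g in degree 8, and monomial multipliers
  suffice to test it.\<close>

definition annih :: "'a::comm_ring_1 ^ 9 \<Rightarrow> nat \<Rightarrow> 'a poly \<Rightarrow> bool" where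
  "annih a e g \<longleftrightarrow> (\<forall>k\<le>8 - e. pairing a (g * monom 1 k) = 0)"

lemma annih_pairing:
  assumes "annih a e g" "degree q \<le> 8 - e"
  shows "pairing a (g * q) = 0"
proof -
  have "g * q = (\<Sum>i\<le>8 - e. smult (coeff q i) (g * monom 1 i))"
    by (subst poly_as_sum_le[OF assms(2)]) (simp add: sum_distrib_left mult_smult_right[symmetric] smult_monom)
  then show ?thesis using assms(1) by (simp add: pairing_sum pairing_smult annih_def)
qed

lemma annih_iff: "annih a e g \<longleftrightarrow> (\<forall>q. degree q \<le> 8 - e \<longrightarrow> pairing a (g * q) = 0)"
  using annih_pairing by (auto simp: annih_def intro: order_trans[OF degree_monom_le])

text \<open>The annihilators form an ideal. The factor q may contribute roots at infinity, because
  only the nominal degrees are added.\<close>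

lemma annih_mult:
  assumes "annih a e g" "degree q \<le> d" "e + d \<le> 8"
  shows "annih a (e + d) (g * q)"
  unfolding annih_iff
proof (intro allI impI)
  fix r :: "'a poly" assume r: "degree r \<le> 8 - (e + d)"
  have "degree (q * r) \<le> 8 - e"
    using degree_mult_le[of q r] r assms by linarith
  then show "pairing a (g * q * r) = 0"
    using annih_pairing[OF assms(1)] by (simp add: mult.assoc)
qed

text \<open>The form of nominal degree d with dehomogenisation p, evaluated at the pair (A, B).
  Linear A and B give the GL(2) action, constants give values at points, and the pair
  \<open>[:0, 1:]\<close>, \<open>1\<close> reverses the coefficients.\<close>

definition homp :: "nat \<Rightarrow> 'a::comm_ring_1 poly \<Rightarrow> 'a poly \<Rightarrow> 'a poly \<Rightarrow> 'a poly" where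
  "homp d p A B = (\<Sum>i\<le>d. smult (coeff p i) (A ^ (d - i) * B ^ i))"

lemma homp_add: "homp d (p + q) A B = homp d p A B + homp d q A B"
  by (simp add: homp_def smult_add_left sum.distrib)

lemma smult_sum_distrib: "smult c (sum f S) = (\<Sum>x\<in>S. smult c (f x))"
  by (induction S rule: infinite_finite_induct) (simp_all add: smult_add_right)

lemma homp_smult: "homp d (smult c p) A B = smult c (homp d p A B)"
  by (simp add: homp_def smult_sum_distrib)

lemma homp_0 [simp]: "homp d 0 A B = 0" by (simp add: homp_def)

lemma homp_sum: "homp d (sum f S) A B = (\<Sum>x\<in>S. homp d (f x) A B)"
  by (induction S rule: infinite_finite_induct) (simp_all add: homp_add)

lemma coeff_mult_monom_one: "coeff (p * monom 1 j) k = (if j \<le> k then coeff p (k - j) else 0)"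
  for p :: "'a::comm_ring_1 poly"
  by (simp add: mult.commute[of p] coeff_monom_mult)

lemma homp_mult_monom:
  assumes "degree p \<le> d" "j \<le> e"
  shows "homp (d + e) (p * monom 1 j) A B = homp d p A B * (A ^ (e - j) * B ^ j)"
proof -
  let ?g = "\<lambda>k. if j \<le> k then smult (coeff p (k - j)) (A ^ (d + e - k) * B ^ k) else 0"
  have "homp (d + e) (p * monom 1 j) A B = (\<Sum>k\<le>d + e. ?g k)"
    unfolding homp_def by (intro sum.cong) (auto simp: coeff_mult_monom_one)
  also have "\<dots> = (\<Sum>k\<in>{j..d + j}. ?g k)"
    using assms by (intro sum.mono_neutral_right) (auto simp: coeff_eq_0)
  also have "\<dots> = (\<Sum>i\<le>d. ?g (i + j))"
    by (rule sum.reindex_bij_witness[of _ "\<lambda>i. i + j" "\<lambda>k. k - j"]) auto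
  also have "\<dots> = (\<Sum>i\<le>d. smult (coeff p i) (A ^ (d - i) * B ^ i) * (A ^ (e - j) * B ^ j))"
  proof (intro sum.cong refl)
    fix i assume "i \<in> {..d}"
    then have "d + e - (i + j) = (d - i) + (e - j)" using assms by auto
    then show "?g (i + j) = smult (coeff p i) (A ^ (d - i) * B ^ i) * (A ^ (e - j) * B ^ j)"
      by (simp add: power_add algebra_simps)
  qed
  finally show ?thesis by (simp add: homp_def sum_distrib_right)
qed

lemma homp_mult:
  assumes "degree p \<le> d" "degree q \<le> e"
  shows "homp (d + e) (p * q) A B = homp d p A B * homp e q A B"
proof -
  have "p * q = (\<Sum>j\<le>e. smult (coeff q j) (p * monom 1 j))"
    by (subst poly_as_sum_le[OF assms(2)]) (simp add: sum_distrib_left mult_smult_right[symmetric] smult_monom)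
  then have "homp (d + e) (p * q) A B = (\<Sum>j\<le>e. smult (coeff q j) (homp (d + e) (p * monom 1 j) A B))"
    by (simp add: homp_sum homp_smult)
  also have "\<dots> = (\<Sum>j\<le>e. smult (coeff q j) (homp d p A B * (A ^ (e - j) * B ^ j)))"
    by (intro sum.cong refl) (simp add: homp_mult_monom[OF assms(1)])
  also have "\<dots> = homp d p A B * homp e q A B"
    by (simp add: homp_def[of e] sum_distrib_left)
  finally show ?thesis .
qed

definition heval :: "nat \<Rightarrow> 'a::comm_ring_1 poly \<Rightarrow> 'a \<times> 'a \<Rightarrow> 'a" where
  "heval d p v = (\<Sum>i\<le>d. coeff p i * (fst v ^ (d - i) * snd v ^ i))"

lemma heval_homp: "heval d p v = coeff (homp d p [:fst v:] [:snd v:]) 0"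
  by (simp add: heval_def homp_def coeff_sum coeff_0_power coeff_mult)

lemma heval_mult:
  "degree p \<le> d \<Longrightarrow> degree q \<le> e \<Longrightarrow> heval (d + e) (p * q) v = heval d p v * heval e q v"
  by (simp add: heval_homp homp_mult coeff_mult)

lemma heval_add: "heval d (p + q) v = heval d p v + heval d q v"
  by (simp add: heval_def sum.distrib algebra_simps)

lemma heval_diff: "heval d (p - q) v = heval d p v - heval d q v"
  by (simp add: heval_def sum_subtractf algebra_simps)

lemma heval_smult: "heval d (smult c p) v = c * heval d p v"
  by (simp add: heval_def sum_distrib_left algebra_simps)

lemma heval_zero [simp]: "heval d 0 v = 0" by (simp add: heval_def)

lemma heval_sum: "heval d (sum f S) v = (\<Sum>x\<in>S. heval d (f x) v)"
  by (induction S rule: infinite_finite_induct) (simp_all add: heval_add)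

lemma heval_one [simp]: "heval 0 1 v = 1" by (simp add: heval_def)

definition lin :: "'a::comm_ring_1 \<times> 'a \<Rightarrow> 'a poly" where "lin v = [:- snd v, fst v:]"

definition ndet :: "'a::comm_ring_1 \<times> 'a \<Rightarrow> 'a \<times> 'a \<Rightarrow> 'a" where
  "ndet v w = fst v * snd w - snd v * fst w"

lemma degree_lin: "degree (lin v) \<le> Suc 0" by (simp add: lin_def)

lemma heval_lin: "heval (Suc 0) (lin v) w = ndet v w"
  by (simp add: heval_def lin_def ndet_def algebra_simps)

lemma heval_power:
  assumes "degree p \<le> 1" shows "heval k (p ^ k) v = heval 1 p v ^ k \<and> degree (p ^ k) \<le> k"
proof (induction k)
  case (Suc k)
  have "degree (p ^ Suc k) \<le> Suc k"
    using degree_mult_le[of p "p ^ k"] Suc assms by simp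
  moreover have "heval (1 + k) (p * p ^ k) v = heval 1 p v * heval k (p ^ k) v"
    by (rule heval_mult) (use Suc assms in auto)
  ultimately show ?case using Suc by simp
qed simp

lemma heval_fst_0: "heval d p (0, b) = coeff p d * b ^ d"
proof -
  have "heval d p (0, b) = (\<Sum>i\<le>d. if i = d then coeff p d * b ^ d else 0)"
    unfolding heval_def by (intro sum.cong) (auto simp: power_0_left)
  then show ?thesis by simp
qed

lemma heval_fst_nz:
  fixes p :: "'a::field poly"
  assumes "degree p \<le> d" "fst v \<noteq> 0"
  shows "heval d p v = fst v ^ d * poly p (snd v / fst v)"
proof -
  have "poly p (snd v / fst v) = (\<Sum>i\<le>d. coeff p i * (snd v / fst v) ^ i)"
    by (subst poly_as_sum_le[OF assms(1)]) (simp add: poly_sum poly_monom)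
  also have "fst v ^ d * \<dots> = heval d p v"
    unfolding heval_def sum_distrib_left
    using assms(2) by (intro sum.cong) (auto simp: power_divide power_diff)
  finally show ?thesis by simp
qed

text \<open>For a node at infinity, \<open>fst v = 0\<close>, the linear form \<open>lin v\<close>
  is a constant. Splitting it off leaves the polynomial unchanged up to a scalar and lowers only the
  nominal degree, which is possible because the top coefficient vanishes.\<close>

lemma heval_zero_factor:
  fixes p :: "'a::field poly"
  assumes "v \<noteq> (0, 0)" "degree p \<le> Suc d" "heval (Suc d) p v = 0"
  shows "\<exists>q. p = lin v * q \<and> degree q \<le> d"
proof (cases "fst v = 0")
  case True
  then obtain b where b: "v = (0, b)" "b \<noteq> 0" using assms(1) by (cases v) auto
  then have "coeff p (Suc d) = 0" using assms(3) by (simp add: heval_fst_0)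
  then have "degree p \<le> d" using assms(2)
    by (metis le_SucE leading_coeff_0_iff degree_0 le0)
  moreover have "p = lin v * smult (- (1 / b)) p" using b by (simp add: lin_def)
  ultimately show ?thesis by (metis degree_smult_le order_trans)
next
  case False
  define x where "x = snd v / fst v"
  have "poly p x = 0" using assms False by (simp add: heval_fst_nz x_def)
  then obtain q where q: "p = [:- x, 1:] * q" by (auto simp: poly_eq_0_iff_dvd dvd_def)
  have "lin v = smult (fst v) [:- x, 1:]" using False by (simp add: lin_def x_def)
  then have "p = lin v * smult (1 / fst v) q"
    unfolding q using False by (simp only: mult_smult_left mult_smult_right smult_smult) simp
  moreover have "degree q \<le> d"
  proof (cases "q = 0")
    case False
    then have "degree p = 1 + degree q" unfolding q by (subst degree_mult_eq) auto
    then show ?thesis using assms(2) by simp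
  qed simp
  ultimately show ?thesis by (metis degree_smult_le order_trans)
qed

text \<open>One representative of each point of the projective line; \<open>lin v\<close> is the linear form vanishing at v.\<close>

definition cnode :: "('a::field \<times> 'a) set" where "cnode = insert (0, 1) {v. fst v = 1}"

lemma cnode_nz: "v \<in> cnode \<Longrightarrow> v \<noteq> (0, 0)" by (auto simp: cnode_def)

lemma cnode_ndet: "v \<in> cnode \<Longrightarrow> w \<in> cnode \<Longrightarrow> ndet v w = 0 \<longleftrightarrow> v = w"
  by (cases v; cases w) (auto simp: cnode_def ndet_def)

definition lprod :: "('a::comm_ring_1 \<times> 'a) multiset \<Rightarrow> 'a poly" where
  "lprod N = (\<Prod>v\<in>#N. lin v)"

lemma lprod_empty [simp]: "lprod {#} = 1" by (simp add: lprod_def)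

lemma lprod_add_mset [simp]: "lprod (add_mset v N) = lin v * lprod N" by (simp add: lprod_def)

lemma lprod_union: "lprod (M + N) = lprod M * lprod N" by (simp add: lprod_def)

lemma degree_lprod: "degree (lprod N) \<le> size N"
proof (induction N)
  case (add v N)
  then show ?case using degree_mult_le[of "lin v" "lprod N"] degree_lin[of v] by simp
qed simp

lemma heval_lprod: "heval (size N) (lprod N) w = (\<Prod>v\<in>#N. ndet v w)"
proof (induction N)
  case (add v N)
  have "heval (1 + size N) (lin v * lprod N) w = heval 1 (lin v) w * heval (size N) (lprod N) w"
    by (rule heval_mult) (auto simp: degree_lin degree_lprod)
  then show ?case using add by (simp add: heval_lin)
qed simp

lemma prod_ndet_nz:
  fixes v :: "'a::field \<times> 'a"
  assumes "finite T" "T \<subseteq> cnode" "v \<in> cnode" "v \<notin> T"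
  shows "(\<Prod>u\<in>#mset_set T. ndet u v) \<noteq> 0"
proof -
  have "ndet u v \<noteq> 0" if "u \<in> T" for u using assms that cnode_ndet[of u v] by blast
  then show ?thesis using assms(1) by (force simp: prod_mset_zero_iff)
qed

lemma lin_nz: "v \<noteq> (0, 0) \<Longrightarrow> lin v \<noteq> 0" by (cases v) (auto simp: lin_def)

lemma lprod_nz: "set_mset N \<subseteq> cnode \<Longrightarrow> lprod N \<noteq> 0" for N :: "('a::field \<times> 'a) multiset"
  by (induction N) (auto simp: lin_nz cnode_nz)

lemma heval_zeros_factor:
  fixes p :: "'a::field poly"
  assumes "finite S" "S \<subseteq> cnode" "degree p \<le> d" "\<And>v. v \<in> S \<Longrightarrow> heval d p v = 0" "card S \<le> d"
  shows "\<exists>q. p = lprod (mset_set S) * q \<and> degree q \<le> d - card S"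
  using assms
proof (induction S arbitrary: p d rule: finite_induct)
  case empty then show ?case by auto
next
  case (insert v S)
  then obtain d' where d: "d = Suc d'" by (cases d) auto
  obtain q where q: "p = lin v * q" "degree q \<le> d'"
    using heval_zero_factor[of v p d'] insert.prems d cnode_nz[of v] by auto
  have "heval d' q w = 0" if "w \<in> S" for w
  proof -
    have "heval (1 + d') (lin v * q) w = heval 1 (lin v) w * heval d' q w"
      by (rule heval_mult) (use q in \<open>auto simp: degree_lin\<close>)
    moreover have "ndet v w \<noteq> 0" using cnode_ndet[of v w] insert that by auto
    ultimately show ?thesis using insert.prems(3)[of w] that d q by (simp add: heval_lin)
  qed
  then obtain q' where "q = lprod (mset_set S) * q'" "degree q' \<le> d' - card S"
    using insert.IH[of q d'] insert.prems insert.hyps q d by auto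
  then show ?case using q d insert.hyps by (auto simp: mult.assoc)
qed

lemma heval_zeros_eq_0:
  fixes p :: "'a::field poly"
  assumes "finite S" "S \<subseteq> cnode" "degree p \<le> d" "\<And>v. v \<in> S \<Longrightarrow> heval d p v = 0" "d < card S"
  shows "p = 0"
proof -
  obtain T where T: "T \<subseteq> S" "card T = d" using assms(5) by (meson less_imp_le obtain_subset_with_card_n)
  then have fT: "finite T" using assms(1) finite_subset by blast
  obtain q where q: "p = lprod (mset_set T) * q" "degree q \<le> 0"
    using heval_zeros_factor[OF fT _ assms(3)] assms(2,4) T by (metis diff_self_eq_0 le_refl subset_eq)
  obtain v where v: "v \<in> S - T" using assms(5) T
    by (metis DiffI less_irrefl subsetI subset_antisym)
  have "heval (size (mset_set T) + 0) (lprod (mset_set T) * q) v =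
      heval (size (mset_set T)) (lprod (mset_set T)) v * heval 0 q v"
    by (rule heval_mult) (use q fT degree_lprod[of "mset_set T"] in auto)
  moreover have "heval (size (mset_set T)) (lprod (mset_set T)) v \<noteq> 0"
    unfolding heval_lprod by (rule prod_ndet_nz) (use v T assms(2) fT in auto)
  moreover have "heval d p v = 0" using v assms by auto
  ultimately have "heval 0 q v = 0" using T q fT by simp
  then have "coeff q 0 = 0" by (simp add: heval_def)
  then have "q = 0" using q(2) by (metis le_0_eq leading_coeff_0_iff)
  then show ?thesis using q by simp
qed

lemma lagrange_basis:
  fixes S :: "(real \<times> real) set"
  assumes "finite S" "S \<subseteq> cnode" "v \<in> S" "card S \<le> Suc e"
  shows "\<exists>l. degree l \<le> e \<and> heval e l v = 1 \<and> (\<forall>w\<in>S - {v}. heval e l w = 0)"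
proof -
  \<comment> \<open>The linear form \<open>[:fst v, snd v:]\<close> takes the value |v|^2 at v. Its
    powers raise the product over the other nodes to degree e without introducing a zero at
    v.\<close>
  define z where "z = [:fst v, snd v:] ^ (e - (card S - 1))"
  define l where "l = lprod (mset_set (S - {v})) * z"
  have z: "degree z \<le> e - (card S - 1)" "heval (e - (card S - 1)) z v \<noteq> 0"
  proof -
    have "heval 1 [:fst v, snd v:] v = fst v * fst v + snd v * snd v" by (simp add: heval_def)
    moreover have "\<dots> \<noteq> 0" using assms cnode_nz[of v]
      by (metis prod.exhaust_sel subsetD sum_squares_eq_zero_iff)
    ultimately show "degree z \<le> e - (card S - 1)" "heval (e - (card S - 1)) z v \<noteq> 0"
      using heval_power[of "[:fst v, snd v:]" "e - (card S - 1)" v] by (auto simp: z_def)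
  qed
  have e: "e = card (S - {v}) + (e - (card S - 1))"
    using assms by (simp add: card_Diff_singleton)
  have ev: "heval e l w = (\<Prod>u\<in>#mset_set (S - {v}). ndet u w) * heval (e - (card S - 1)) z w" for w
    by (subst e, unfold l_def, subst heval_mult)
       (use assms z degree_lprod[of "mset_set (S - {v})"] heval_lprod[of "mset_set (S - {v})"] in auto)
  have nz: "heval e l v \<noteq> 0"
    unfolding ev using z prod_ndet_nz[of "S - {v}" v] assms by auto
  have dl: "degree l \<le> e"
    using degree_mult_le[of "lprod (mset_set (S - {v}))" z] z(1) degree_lprod[of "mset_set (S - {v})"] e
    by (simp add: l_def)
  show ?thesis
  proof (intro exI conjI ballI)
    show "degree (smult (1 / heval e l v) l) \<le> e" using dl degree_smult_le order_trans by blast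
    show "heval e (smult (1 / heval e l v) l) v = 1" using nz by (simp add: heval_smult)
    fix w assume "w \<in> S - {v}"
    then have "heval e l w = 0" unfolding ev using assms
      by (auto simp: prod_mset_zero_iff ndet_def mult.commute intro!: image_eqI[of _ _ w])
    then show "heval e (smult (1 / heval e l v) l) w = 0" by (simp add: heval_smult)
  qed
qed

text \<open>A polynomial vanishing on S is a multiple of \<open>lprod (mset_set S)\<close>, so the
  functional that sends p to the pairing of a with B p depends only on the values of p on S. The
  factor B is there to absorb the repeated roots of an annihilator.\<close>

lemma quadrature:
  fixes S :: "(real \<times> real) set"
  assumes "finite S" "S \<subseteq> cnode" "card S \<le> e"
    and ann: "\<And>q. degree q \<le> e - card S \<Longrightarrow> pairing a (B * (lprod (mset_set S) * q)) = 0"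
  shows "\<exists>c. \<forall>p. degree p \<le> e \<longrightarrow> pairing a (B * p) = (\<Sum>v\<in>S. c v * heval e p v)"
proof -
  have "\<forall>v\<in>S. \<exists>l. degree l \<le> e \<and> heval e l v = 1 \<and> (\<forall>w\<in>S - {v}. heval e l w = 0)"
    using lagrange_basis[OF assms(1,2)] assms(3) by auto
  then obtain l where l: "\<And>v. v \<in> S \<Longrightarrow> degree (l v) \<le> e" "\<And>v. v \<in> S \<Longrightarrow> heval e (l v) v = 1"
    "\<And>v w. v \<in> S \<Longrightarrow> w \<in> S \<Longrightarrow> w \<noteq> v \<Longrightarrow> heval e (l v) w = 0"
    by (metis DiffI singletonD)
  have "pairing a (B * p) = (\<Sum>v\<in>S. pairing a (B * l v) * heval e p v)" if p: "degree p \<le> e" for p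
  proof -
    define s where "s = (\<Sum>v\<in>S. smult (heval e p v) (l v))"
    have "degree s \<le> e" unfolding s_def
      by (intro degree_sum_le assms) (use l(1) degree_smult_le order_trans in blast)
    then have "degree (p - s) \<le> e" using p by (meson degree_diff_le)
    moreover have "heval e (p - s) w = 0" if "w \<in> S" for w
    proof -
      have "heval e s w = (\<Sum>v\<in>S. if v = w then heval e p w else 0)"
        unfolding s_def heval_sum heval_smult by (intro sum.cong) (use l that in auto)
      then show ?thesis using assms(1) that by (simp add: heval_diff)
    qed
    ultimately obtain q where "p - s = lprod (mset_set S) * q" "degree q \<le> e - card S"
      using heval_zeros_factor[OF assms(1,2), of "p - s" e] assms(3) by auto
    then have "pairing a (B * (p - s)) = 0" using ann by simp
    then have "pairing a (B * p) = pairing a (B * s)" by (simp add: right_diff_distrib pairing_diff)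
    also have "B * s = (\<Sum>v\<in>S. smult (heval e p v) (B * l v))"
      by (simp add: s_def sum_distrib_left)
    finally show ?thesis by (simp add: pairing_sum pairing_smult mult.commute)
  qed
  then show ?thesis by (intro exI[of _ "\<lambda>v. pairing a (B * l v)"]) blast
qed

section \<open>Waring decompositions and Sylvester's criterion\<close>

abbreviation Wset :: "nat \<Rightarrow> (real ^ 9) set" where "Wset r \<equiv> {a. waring_decomp 8 r a}"

text \<open>The rational normal curve: \<open>evv v\<close> is the eighth power of the linear form
  with coefficients v. The binomial factors are part of the coordinates a_i, so pairing with
  \<open>evv v\<close> is evaluation at v.\<close>

definition evv :: "real \<times> real \<Rightarrow> real ^ 9" where "evv v = vec_of (\<lambda>i. fst v ^ (8 - i) * snd v ^ i)"

lemma pairing_evv: "pairing (evv v) p = heval 8 p v"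
  by (simp add: pairing_def heval_def evv_def)

lemma waring_iff: "waring_decomp 8 r a \<longleftrightarrow> (\<exists>c v. a = (\<Sum>j<r. c j *\<^sub>R evv (v j)))"
proof
  assume "waring_decomp 8 r a"
  then obtain c \<alpha> \<beta> where *: "\<And>i. i \<le> 8 \<Longrightarrow> a $ of_nat i = (\<Sum>j<r. c j * \<alpha> j ^ (8 - i) * \<beta> j ^ i)"
    unfolding waring_decomp_def by blast
  have "a = (\<Sum>j<r. c j *\<^sub>R evv (\<alpha> j, \<beta> j))"
    by (simp add: vec9_eq_iff sum_component evv_def * mult.assoc)
  then show "\<exists>c v. a = (\<Sum>j<r. c j *\<^sub>R evv (v j))"
    by (intro exI[of _ c] exI[of _ "\<lambda>j. (\<alpha> j, \<beta> j)"])
next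
  assume "\<exists>c v. a = (\<Sum>j<r. c j *\<^sub>R evv (v j))"
  then obtain c v where "a = (\<Sum>j<r. c j *\<^sub>R evv (v j))" by blast
  then show "waring_decomp 8 r a" unfolding waring_decomp_def
    by (intro exI[of _ c] exI[of _ "fst \<circ> v"] exI[of _ "snd \<circ> v"])
       (simp add: sum_component evv_def mult.assoc)
qed

lemma waring_mono: "waring_decomp 8 r (a :: real ^ 9) \<Longrightarrow> r \<le> s \<Longrightarrow> waring_decomp 8 s a"
proof -
  assume "waring_decomp 8 r a" and rs: "r \<le> s"
  then obtain c v where a: "a = (\<Sum>j<r. c j *\<^sub>R evv (v j))" by (auto simp: waring_iff)
  have "(\<Sum>j<s. (if j < r then c j else 0) *\<^sub>R evv (v j)) = (\<Sum>j<r. (if j < r then c j else 0) *\<^sub>R evv (v j))"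
    using rs by (intro sum.mono_neutral_right) auto
  also have "\<dots> = a" by (simp add: a)
  finally show "waring_decomp 8 s a" unfolding waring_iff by (metis (no_types))
qed

lemma waring_card:
  assumes "finite S" "a = (\<Sum>v\<in>S. c v *\<^sub>R evv v)"
  shows "waring_decomp 8 (card S) a"
proof -
  obtain f where f: "bij_betw f {..<card S} S"
    using assms(1) by (metis bij_betw_from_nat_into_finite)
  have "a = (\<Sum>j<card S. c (f j) *\<^sub>R evv (f j))"
    unfolding assms(2) by (rule sum.reindex_bij_betw[OF f, symmetric])
  then show ?thesis unfolding waring_iff by (intro exI[of _ "c \<circ> f"] exI[of _ f]) simp
qed

lemma pairing_eqI:
  fixes a b :: "'a::comm_ring_1 ^ 9"
  assumes "\<And>p. degree p \<le> 8 \<Longrightarrow> pairing a p = pairing b p" shows "a = b"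
  unfolding vec9_eq_iff
proof (intro allI impI)
  fix i :: nat assume "i \<le> 8"
  moreover have "degree (monom (1::'a) i) \<le> 8" using \<open>i \<le> 8\<close> degree_monom_le order_trans by blast
  ultimately show "a $ of_nat i = b $ of_nat i"
    using assms[of "monom 1 i"] by (simp add: pairing_monom)
qed

lemma pairing_sum_left: "pairing (sum f S) p = (\<Sum>x\<in>S. pairing (f x) p)" for f :: "_ \<Rightarrow> real ^ 9"
proof (induction S rule: infinite_finite_induct)
  case (insert x F) then show ?case by (simp add: pairing_add_left)
qed (simp_all add: pairing_def)

text \<open>Sylvester's criterion: for B = 1 the quadrature formula at the roots of the annihilator
  writes the functional as a combination of point evaluations, and these are eighth powers.\<close>

lemma annih_distinct_decomp:
  fixes S :: "(real \<times> real) set"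
  assumes "finite S" "S \<subseteq> cnode" "card S \<le> 8" "annih a (card S) (lprod (mset_set S))"
  shows "\<exists>c. a = (\<Sum>v\<in>S. c v *\<^sub>R evv v)"
proof -
  obtain c where c: "\<forall>p. degree p \<le> 8 \<longrightarrow> pairing a (1 * p) = (\<Sum>v\<in>S. c v * heval 8 p v)"
    using quadrature[OF assms(1,2,3), of a 1] annih_pairing[OF assms(4)] by auto
  have "a = (\<Sum>v\<in>S. c v *\<^sub>R evv v)"
    by (rule pairing_eqI) (simp add: c pairing_sum_left pairing_scaleR_left pairing_evv c[rule_format, simplified])
  then show ?thesis by blast
qed

definition Pset :: "nat \<Rightarrow> (real ^ 9) set" where
  "Pset r = {a. \<exists>N. size N = r \<and> set_mset N \<subseteq> cnode \<and> annih a r (lprod N)}"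

definition canon :: "real \<times> real \<Rightarrow> real \<times> real" where
  "canon v = (if fst v = 0 then (0, 1) else (1, snd v / fst v))"

lemma canon_in [simp]: "canon v \<in> cnode" by (simp add: canon_def cnode_def)

lemma ndet_canon: "v \<noteq> (0,0) \<Longrightarrow> w \<noteq> (0,0) \<Longrightarrow> canon v = canon w \<longleftrightarrow> ndet v w = 0"
  by (cases v; cases w) (auto simp: canon_def ndet_def field_simps)

lemma lin_canon: "v \<noteq> (0,0) \<Longrightarrow> \<exists>c. c \<noteq> 0 \<and> lin v = smult c (lin (canon v))"
  by (cases "fst v = 0"; cases v) (auto simp: canon_def lin_def)

lemma canon_scale: "v \<noteq> (0,0) \<Longrightarrow> \<exists>c. c \<noteq> 0 \<and> v = (c * fst (canon v), c * snd (canon v))"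
  by (cases "fst v = 0"; cases v) (auto simp: canon_def)

lemma lprod_canon:
  assumes "\<forall>v\<in>#N. v \<noteq> (0,0)"
  shows "\<exists>c. c \<noteq> 0 \<and> lprod N = smult c (lprod (image_mset canon N))"
  using assms
proof (induction N)
  case empty show ?case by (intro exI[of _ 1]) simp
next
  case (add v N)
  then obtain c where "c \<noteq> 0" "lprod N = smult c (lprod (image_mset canon N))" by auto
  moreover obtain c' where "c' \<noteq> 0" "lin v = smult c' (lin (canon v))" using lin_canon[of v] add.prems by auto
  ultimately show ?case by (intro exI[of _ "c' * c"]) (auto simp: mult.commute)
qed

lemma annih_smult: "annih a e (smult c g) \<longleftrightarrow> c = 0 \<or> annih a e g"
  for a :: "'a::field ^ 9"
  by (auto simp: annih_def pairing_smult)

lemma PsetI: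
  assumes "size N = r" "\<forall>v\<in>#N. v \<noteq> (0,0)" "annih a r (lprod N)" shows "a \<in> Pset r"
proof -
  obtain c where "c \<noteq> 0" "lprod N = smult c (lprod (image_mset canon N))" using lprod_canon assms by blast
  then have "annih a r (lprod (image_mset canon N))" using assms by (simp add: annih_smult)
  then show ?thesis unfolding Pset_def using assms by (auto intro!: exI[of _ "image_mset canon N"])
qed

lemma waring_Pset:
  assumes "r \<le> 8" "waring_decomp 8 r a" shows "a \<in> Pset r"
proof -
  obtain c v where a: "a = (\<Sum>j<r. c j *\<^sub>R evv (v j))" using assms by (auto simp: waring_iff)
  \<comment> \<open>A zero linear form is no root of anything, so an arbitrary node replaces it; the
    determinant of any node with (0, 0) is 0, hence the argument at \<open>v j\<close> is the same
    in both cases.\<close>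
  define w where "w = (\<lambda>j. if v j = (0,0) then (0,1) else v j)"
  define N where "N = image_mset w (mset_set {..<r})"
  have N: "size N = r" "\<forall>v\<in>#N. v \<noteq> (0,0)" by (auto simp: N_def w_def)
  have "annih a r (lprod N)" unfolding annih_iff
  proof (intro allI impI)
    fix q :: "real poly" assume q: "degree q \<le> 8 - r"
    have "heval 8 (lprod N * q) (v j) = 0" if j: "j < r" for j
    proof -
      have "heval (r + (8 - r)) (lprod N * q) (v j) = heval r (lprod N) (v j) * heval (8 - r) q (v j)"
        by (rule heval_mult) (use q degree_lprod[of N] N in auto)
      moreover have "ndet (w j) (v j) = 0" by (auto simp: ndet_def w_def)
      then have "heval r (lprod N) (v j) = 0"
        using heval_lprod[of N "v j"] N j by (auto simp: N_def prod_mset_zero_iff)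
      ultimately show ?thesis using assms by simp
    qed
    then show "pairing a (lprod N * q) = 0"
      unfolding a by (simp add: pairing_sum_left pairing_scaleR_left pairing_evv)
  qed
  then show ?thesis using PsetI N by blast
qed

section \<open>Perturbation of linear systems\<close>

text \<open>Gaussian elimination of the last unknown: the pivot is close to 1, and the Schur
  complement \<open>M'\<close> is again close to the identity, with right hand side
  \<open>b'\<close> again small. The bound d depends on N and e only, uniformly in the
  matrix.\<close>

lemma linear_system_near_identity:
  fixes e :: real
  assumes "e > 0"
  shows "\<exists>d>0. \<forall>(M :: nat \<Rightarrow> nat \<Rightarrow> 'a::real_normed_field) b.
    (\<forall>i<N. \<forall>j<N. norm (M i j - (if i = j then 1 else 0)) < d) \<longrightarrow> (\<forall>i<N. norm (b i) < d) \<longrightarrow>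
    (\<exists>y. (\<forall>j<N. norm (y j) < e) \<and> (\<forall>i<N. (\<Sum>j<N. M i j * y j) = b i))"
  using assms
proof (induction N arbitrary: e)
  case 0 show ?case by (intro exI[of _ 1]) auto
next
  case (Suc N)
  define e' where "e' = min e 1 / 2"
  have e': "0 < e'" "e' < e" "e' < 1" using Suc.prems by (auto simp: e'_def)
  obtain d' where d': "d' > 0" and sol: "\<And>(M :: nat \<Rightarrow> nat \<Rightarrow> 'a) b.
    (\<forall>i<N. \<forall>j<N. norm (M i j - (if i = j then 1 else 0)) < d') \<Longrightarrow> (\<forall>i<N. norm (b i) < d') \<Longrightarrow>
    (\<exists>y. (\<forall>j<N. norm (y j) < e') \<and> (\<forall>i<N. (\<Sum>j<N. M i j * y j) = b i))"
    using Suc.IH[OF e'(1)] by blast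
  \<comment> \<open>The bound 1/2 keeps the pivot away from 0, d'/3 leaves room for an entry and its
    elimination correction of size at most d, and the last bound makes the unknown computed by back
    substitution smaller than e.\<close>
  define d where "d = min (min (1/2) (d' / 3)) (e / (4 * (real N + 1)))"
  have d: "d > 0" "d \<le> 1/2" "3 * d \<le> d'" "4 * (real N + 1) * d \<le> e"
  proof -
    show "d > 0" using d' Suc.prems by (simp add: d_def)
    have "d \<le> min (1/2) (d' / 3)" by (simp only: d_def min.cobounded1)
    then show "d \<le> 1/2" "3 * d \<le> d'" by simp_all
    have "d \<le> e / (4 * (real N + 1))" by (simp only: d_def min.cobounded2)
    then have "d * (4 * (real N + 1)) \<le> e" by (subst (asm) pos_le_divide_eq) auto
    then show "4 * (real N + 1) * d \<le> e" by (simp only: mult.commute)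
  qed
  show ?case
  proof (intro exI[of _ d] conjI allI impI)
    fix M :: "nat \<Rightarrow> nat \<Rightarrow> 'a" and b :: "nat \<Rightarrow> 'a"
    assume M: "\<forall>i<Suc N. \<forall>j<Suc N. norm (M i j - (if i = j then 1 else 0)) < d"
      and b: "\<forall>i<Suc N. norm (b i) < d"
    define m where "m = M N N"
    have m1: "norm (m - 1) < d" using M[rule_format, of N N] by (simp add: m_def)
    have "1 \<le> norm m + norm (m - 1)" using norm_triangle_ineq4[of m "m - 1"] by simp
    then have m2: "norm m \<ge> 1/2" using m1 d by linarith
    then have m0: "m \<noteq> 0" by auto
    have im: "norm (inverse m) \<le> 2" using le_imp_inverse_le[OF m2] by (simp add: norm_inverse)
    have col: "norm (M i N) < d" if "i < N" for i using M[rule_format, of i N] that by auto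
    have row: "norm (M N i) < d" if "i < N" for i using M[rule_format, of N i] that by auto
    have prod_small: "norm (x * inverse m * y) \<le> d" if "norm x < d" "norm y < d" for x y
    proof -
      have "norm (x * inverse m * y) = norm x * norm (inverse m) * norm y" by (simp add: norm_mult)
      also have "\<dots> \<le> (1/2) * 2 * d"
        using that d im by (intro mult_mono) auto
      finally show ?thesis by simp
    qed
    define M' where "M' = (\<lambda>i j. M i j - M i N * inverse m * M N j)"
    define b' where "b' = (\<lambda>i. b i - M i N * inverse m * b N)"
    have "\<forall>i<N. \<forall>j<N. norm (M' i j - (if i = j then 1 else 0)) < d'"
    proof (intro allI impI)
      fix i j assume ij: "i < N" "j < N"
      have "norm (M' i j - (if i = j then 1 else 0)) \<le> norm (M i j - (if i =
          j then 1 else 0)) + norm (M i N * inverse m * M N j)"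
      proof -
        have "M' i j - (if i = j then 1 else 0) = (M i j - (if i =
            j then 1 else 0)) - M i N * inverse m * M N j"
          by (simp only: M'_def algebra_simps)
        then show ?thesis by (simp only: norm_triangle_ineq4)
      qed
      moreover have "norm (M i j - (if i = j then 1 else 0)) < d" using M ij by auto
      moreover have "norm (M i N * inverse m * M N j) \<le> d"
        by (rule prod_small[OF col[OF ij(1)] row[OF ij(2)]])
      ultimately show "norm (M' i j - (if i = j then 1 else 0)) < d'" using d by linarith
    qed
    moreover have "\<forall>i<N. norm (b' i) < d'"
    proof (intro allI impI)
      fix i assume i: "i < N"
      have "norm (b' i) \<le> norm (b i) + norm (M i N * inverse m * b N)"
        unfolding b'_def by (rule norm_triangle_ineq4)
      moreover have "norm (b i) < d" using b i by auto
      moreover have "norm (M i N * inverse m * b N) \<le> d" by (rule prod_small[OF col[OF i]]) (use b in auto)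
      ultimately show "norm (b' i) < d'" using d by linarith
    qed
    ultimately obtain y where y: "\<forall>j<N. norm (y j) < e'" "\<forall>i<N. (\<Sum>j<N. M' i j * y j) = b' i"
      using sol by blast
    define t where "t = inverse m * (b N - (\<Sum>j<N. M N j * y j))"
    define z where "z = (\<lambda>j. if j = N then t else y j)"
    have zs: "(\<Sum>j<N. M i j * z j) = (\<Sum>j<N. M i j * y j)" for i by (intro sum.cong) (auto simp: z_def)
    have "norm (\<Sum>j<N. M N j * y j) \<le> (\<Sum>j<N. d)"
    proof (rule sum_norm_le)
      fix j assume j: "j \<in> {..<N}"
      have "norm (M N j) * norm (y j) \<le> d * 1" using row[of j] y(1) j e' d
        by (intro mult_mono) (auto intro: less_imp_le less_trans)
      then show "norm (M N j * y j) \<le> d" by (simp add: norm_mult)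
    qed
    moreover have "norm (b N) < d" using b by simp
    ultimately have "norm (b N - (\<Sum>j<N. M N j * y j)) < (real N + 1) * d"
      using norm_triangle_ineq4[of "b N" "\<Sum>j<N. M N j * y j"] by (simp add: algebra_simps)
    then have "norm (inverse m) * norm (b N - (\<Sum>j<N. M N j * y j)) \<le> 2 * ((real N + 1) * d)"
      using im by (intro mult_mono) auto
    then have "norm t \<le> 2 * ((real N + 1) * d)" by (simp add: t_def norm_mult)
    then have tn: "norm t < e" using d Suc.prems by (simp add: algebra_simps)
    have "\<forall>j<Suc N. norm (z j) < e" using y(1) tn e' by (auto simp: z_def less_Suc_eq intro: less_trans)
    moreover have "\<forall>i<Suc N. (\<Sum>j<Suc N. M i j * z j) = b i"
    proof (intro allI impI)
      fix i assume "i < Suc N"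
      show "(\<Sum>j<Suc N. M i j * z j) = b i"
      proof (cases "i = N")
        case True
        have "m * t = b N - (\<Sum>j<N. M N j * y j)" using m0 by (simp add: t_def)
        then show ?thesis using True by (simp add: zs) (simp add: z_def m_def)
      next
        case False
        then have i: "i < N" using \<open>i < Suc N\<close> by simp
        have "(\<Sum>j<N. M' i j * y j) = (\<Sum>j<N. M i j * y j) - M i N * inverse m * (\<Sum>j<N. M N j * y j)"
          by (simp add: M'_def algebra_simps sum_subtractf sum_distrib_left)
        then have "(\<Sum>j<N. M i j * y j) - M i N * inverse m * (\<Sum>j<N. M N j * y j) =
            b i - M i N * inverse m * b N"
          using y(2) i by (simp add: b'_def)
        then show ?thesis by (simp add: zs) (simp add: z_def t_def algebra_simps)
      qed
    qed
    ultimately show "\<exists>y. (\<forall>j<Suc N. norm (y j) < e) \<and> (\<forall>i<Suc N. (\<Sum>j<Suc N. M i j * y j) = b i)" by blast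
  qed (use d in auto)
qed

lemma right_inverse_if_rows_independent:
  fixes A :: "nat \<Rightarrow> nat \<Rightarrow> 'a::field"
  assumes "\<And>c. (\<forall>i<m. (\<Sum>j<N. c j * A j i) = 0) \<Longrightarrow> \<forall>j<N. c j = 0"
  shows "\<exists>K. \<forall>j<N. \<forall>l<N. (\<Sum>i<m. A j i * K i l) = (if j = l then 1 else 0)"
  using assms
proof (induction N)
  case 0 then show ?case by simp
next
  case (Suc N)
  have "\<forall>j<N. c j = 0" if "\<forall>i<m. (\<Sum>j<N. c j * A j i) = 0" for c
  proof -
    have "\<forall>i<m. (\<Sum>j<Suc N. (if j = N then 0 else c j) * A j i) = 0"
    proof (intro allI impI)
      fix i assume "i < m"
      have "(\<Sum>j<N. (if j = N then 0 else c j) * A j i) = (\<Sum>j<N. c j * A j i)" by (intro sum.cong) auto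
      then show "(\<Sum>j<Suc N. (if j = N then 0 else c j) * A j i) = 0" using that \<open>i < m\<close> by simp
    qed
    from Suc.prems[OF this] show ?thesis by (metis less_SucI less_irrefl)
  qed
  then obtain K where K: "\<And>j l. j < N \<Longrightarrow> l < N \<Longrightarrow> (\<Sum>i<m. A j i * K i l) = (if j = l then 1 else 0)"
    using Suc.IH by blast
  define \<phi> where "\<phi> = (\<lambda>l. \<Sum>i<m. A N i * K i l)"
  have "\<exists>i0<m. A N i0 - (\<Sum>j<N. \<phi> j * A j i0) \<noteq> 0"
  proof (rule ccontr)
    assume "\<not> ?thesis"
    then have "\<forall>i<m. (\<Sum>j<Suc N. (if j = N then 1 else - \<phi> j) * A j i) = 0"
      by (auto simp: sum_negf)
    from Suc.prems[OF this] show False by force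
  qed
  then obtain i0 where i0: "i0 < m" "A N i0 - (\<Sum>j<N. \<phi> j * A j i0) \<noteq> 0" by blast
  \<comment> \<open>The unit vector at \<open>i0\<close> minus its image under K A. All earlier rows
    kill it, whereas the new row takes the value \<open>\<sigma>\<close>, which is nonzero by the
    choice of \<open>i0\<close>. A multiple of s is the new column of the right inverse and corrects
    the old ones.\<close>
  define s where "s = (\<lambda>i. (if i = i0 then 1 else 0) - (\<Sum>l<N. A l i0 * K i l))"
  have As: "(\<Sum>i<m. A j i * s i) = A j i0 - (\<Sum>l<N. A l i0 * (\<Sum>i<m. A j i * K i l))" for j
  proof -
    have "(\<Sum>i<m. A j i * s i) = (\<Sum>i<m. if i = i0 then A j i else 0) - (\<Sum>i<m. \<Sum>l<N. A l i0 * (A j i * K i l))"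
      unfolding sum_subtractf[symmetric] s_def
      by (intro sum.cong) (auto simp: right_diff_distrib sum_distrib_left mult_ac)
    also have "(\<Sum>i<m. \<Sum>l<N. A l i0 * (A j i * K i l)) = (\<Sum>l<N. \<Sum>i<m. A l i0 * (A j i * K i l))"
      by (rule sum.swap)
    finally show ?thesis using i0 by (simp add: sum_distrib_left)
  qed
  have As0: "(\<Sum>i<m. A j i * s i) = 0" if "j < N" for j
  proof -
    have "(\<Sum>l<N. A l i0 * (\<Sum>i<m. A j i * K i l)) = (\<Sum>l<N. if l = j then A l i0 else 0)"
      by (intro sum.cong) (auto simp: K that)
    then show ?thesis using that by (simp add: As)
  qed
  define \<sigma> where "\<sigma> = (\<Sum>i<m. A N i * s i)"
  have \<sigma>: "\<sigma> \<noteq> 0" using i0(2) unfolding \<sigma>_def As by (simp only: \<phi>_def mult.commute not_False_eq_True)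
  define K' where "K' = (\<lambda>i l. if l = N then s i / \<sigma> else K i l - \<phi> l * (s i / \<sigma>))"
  have S: "(\<Sum>i<m. A j i * (s i / \<sigma>)) = (if j = N then 1 else 0)" if "j < Suc N" for j
    using As0[of j] \<sigma> that by (auto simp: \<sigma>_def less_Suc_eq sum_divide_distrib[symmetric])
  have "(\<Sum>i<m. A j i * K' i l) = (if j = l then 1 else 0)" if "j < Suc N" "l < Suc N" for j l
  proof (cases "l = N")
    case True then show ?thesis using S[OF that(1)] by (simp add: K'_def)
  next
    case False
    have "(\<Sum>i<m. A j i * K' i l) = (\<Sum>i<m. A j i * K i l) - \<phi> l * (\<Sum>i<m. A j i * (s i / \<sigma>))"
      using False by (simp add: K'_def right_diff_distrib sum_subtractf sum_distrib_left mult_ac)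
    also have "\<dots> = (if j = l then 1 else 0)"
      unfolding S[OF that(1)] using K[of j l] that False by (auto simp: less_Suc_eq \<phi>_def)
    finally show ?thesis .
  qed
  then show ?case by blast
qed

text \<open>With a right inverse K of A, the ansatz x' = x + K y turns the perturbed equations into
  a system for y whose matrix A' K is close to the identity and whose right hand side - A' x is
  close to 0. It is applied in both directions: an annihilator follows a moving form, and a form
  follows a moving annihilator.\<close>

lemma kernel_perturbation:
  fixes A :: "nat \<Rightarrow> nat \<Rightarrow> 'a::real_normed_field"
  assumes indep: "\<And>c. (\<forall>i<m. (\<Sum>j<N. c j * A j i) = 0) \<Longrightarrow> \<forall>j<N. c j = 0"
    and lim: "\<And>i j. j < N \<Longrightarrow> i < m \<Longrightarrow> ((\<lambda>t. A' t j i) \<longlongrightarrow> A j i) F"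
    and x: "\<And>j. j < N \<Longrightarrow> (\<Sum>i<m. A j i * x i) = 0"
    and e: "e > 0"
  shows "\<forall>\<^sub>F t in F. \<exists>x'. (\<forall>i<m. norm (x' i - x i) < e) \<and> (\<forall>j<N. (\<Sum>i<m. A' t j i * x' i) = 0)"
proof -
  obtain K where K: "\<And>j l. j < N \<Longrightarrow> l < N \<Longrightarrow> (\<Sum>i<m. A j i * K i l) = (if j = l then 1 else 0)"
  proof -
    have "\<exists>K. \<forall>j<N. \<forall>l<N. (\<Sum>i<m. A j i * K i l) = (if j = l then 1 else 0)"
      by (rule right_inverse_if_rows_independent) (rule indep)
    then show thesis using that by blast
  qed
  \<comment> \<open>The sum of the norms in any row of K is at most B - 1, so entries of y below e /
    B move x by less than e.\<close>
  define B where "B = 1 + (\<Sum>i<m. \<Sum>l<N. norm (K i l))"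
  have B: "B \<ge> 1" by (simp add: B_def sum_nonneg)
  obtain d where d: "d > 0" and sol: "\<And>(M :: nat \<Rightarrow> nat \<Rightarrow> 'a) b.
    (\<forall>i<N. \<forall>j<N. norm (M i j - (if i = j then 1 else 0)) < d) \<Longrightarrow> (\<forall>i<N. norm (b i) < d) \<Longrightarrow>
    (\<exists>y. (\<forall>j<N. norm (y j) < e / B) \<and> (\<forall>i<N. (\<Sum>j<N. M i j * y j) = b i))"
  proof -
    have "e / B > 0" using e B by simp
    from linear_system_near_identity[OF this, of N, where 'a='a] show thesis using that by blast
  qed
  have "((\<lambda>t. \<Sum>i<m. A' t j i * K i l) \<longlongrightarrow> (if j = l then 1 else 0)) F" if "j < N" "l < N" for j l
    unfolding K[OF that, symmetric] using lim that by (intro tendsto_intros) auto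
  note tendstoD[OF this d]
  then have 1: "\<forall>\<^sub>F t in F. \<forall>j\<in>{..<N}. \<forall>l\<in>{..<N}. dist (\<Sum>i<m. A' t j i * K i l) (if j = l then 1 else 0) < d"
    by (intro eventually_ball_finite ballI) auto
  have "((\<lambda>t. - (\<Sum>i<m. A' t j i * x i)) \<longlongrightarrow> - (\<Sum>i<m. A j i * x i)) F" if "j < N" for j
    using lim that by (intro tendsto_intros) auto
  then have "((\<lambda>t. - (\<Sum>i<m. A' t j i * x i)) \<longlongrightarrow> 0) F" if "j < N" for j
    using x[OF that] that by fastforce
  note tendstoD[OF this d]
  then have 2: "\<forall>\<^sub>F t in F. \<forall>j\<in>{..<N}. dist (- (\<Sum>i<m. A' t j i * x i)) 0 < d"
    by (intro eventually_ball_finite ballI) auto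
  show ?thesis using 1 2
  proof eventually_elim
    case (elim t)
    obtain y where y: "\<forall>j<N. norm (y j) < e / B"
      "\<forall>i<N. (\<Sum>j<N. (\<Sum>k<m. A' t i k * K k j) * y j) = - (\<Sum>i'<m. A' t i i' * x i')"
      using sol[of "\<lambda>j l. \<Sum>i<m. A' t j i * K i l" "\<lambda>j. - (\<Sum>i<m. A' t j i * x i)"] elim
      by (auto simp: dist_norm)
    define x' where "x' = (\<lambda>i. x i + (\<Sum>l<N. K i l * y l))"
    have "norm (x' i - x i) < e" if "i < m" for i
    proof -
      have "norm (x' i - x i) \<le> (\<Sum>l<N. norm (K i l) * (e / B))"
      proof -
        have "norm (\<Sum>l<N. K i l * y l) \<le> (\<Sum>l<N. norm (K i l) * (e / B))"
        proof (rule sum_norm_le)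
          fix l assume "l \<in> {..<N}"
          then have "norm (y l) \<le> e / B" using y(1) by (auto intro: less_imp_le)
          then have "norm (K i l) * norm (y l) \<le> norm (K i l) * (e / B)" by (rule mult_left_mono) simp
          then show "norm (K i l * y l) \<le> norm (K i l) * (e / B)" by (simp only: norm_mult)
        qed
        then show ?thesis by (simp add: x'_def)
      qed
      also have "\<dots> = (\<Sum>l<N. norm (K i l)) * (e / B)" by (simp only: sum_distrib_right)
      also have "\<dots> \<le> (B - 1) * (e / B)"
        using that e B unfolding B_def
        by (intro mult_right_mono) (auto intro!: member_le_sum[of i "{..<m}"
          "\<lambda>i. \<Sum>l<N. norm (K i l)"] sum_nonneg)
      also have "\<dots> < e" using e B by (simp add: field_simps)
      finally show ?thesis .
    qed
    moreover have "(\<Sum>i<m. A' t j i * x' i) = 0" if "j < N" for j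
    proof -
      have "(\<Sum>i<m. A' t j i * x' i) = (\<Sum>i<m. A' t j i * x i) + (\<Sum>i<m. \<Sum>l<N. A' t j i * K i l * y l)"
        by (simp add: x'_def distrib_left sum.distrib sum_distrib_left mult.assoc)
      also have "(\<Sum>i<m. \<Sum>l<N. A' t j i * K i l * y l) = (\<Sum>l<N. (\<Sum>i<m. A' t j i * K i l) * y l)"
        by (subst sum.swap) (simp add: sum_distrib_right)
      finally show ?thesis using y(2) that by simp
    qed
    ultimately show ?case by blast
  qed
qed

section \<open>Coefficientwise convergence of polynomials\<close>

definition ptends :: "('t \<Rightarrow> 'a::real_normed_field poly) \<Rightarrow> 'a poly \<Rightarrow> 't filter \<Rightarrow> bool" where
  "ptends f p F \<longleftrightarrow> (\<forall>i. ((\<lambda>t. coeff (f t) i) \<longlongrightarrow> coeff p i) F)"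

lemma ptends_const: "ptends (\<lambda>t. p) p F" by (simp add: ptends_def)

lemma ptends_mult: "ptends f p F \<Longrightarrow> ptends g q F \<Longrightarrow> ptends (\<lambda>t. f t * g t) (p * q) F"
  unfolding ptends_def coeff_mult by (intro allI tendsto_intros) auto

lemma ptends_linear:
  assumes "(a \<longlongrightarrow> a0) F" "(b \<longlongrightarrow> b0) F" shows "ptends (\<lambda>t. [:a t, b t:]) [:a0, b0:] F"
  unfolding ptends_def
proof
  fix i show "((\<lambda>t. coeff [:a t, b t:] i) \<longlongrightarrow> coeff [:a0, b0:] i) F"
    using assms by (cases i) (auto simp: coeff_pCons split: nat.split)
qed

lemma ptends_prod: "(\<And>i. i \<in> I \<Longrightarrow> ptends (f i) (p i) F) \<Longrightarrow> ptends (\<lambda>t. \<Prod>i\<in>I. f i t) (\<Prod>i\<in>I. p i) F"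
  by (induction I rule: infinite_finite_induct) (auto intro: ptends_mult ptends_const)

lemma ptends_power: "ptends f p F \<Longrightarrow> ptends (\<lambda>t. f t ^ k) (p ^ k) F"
  by (induction k) (auto intro: ptends_mult ptends_const)

lemma tendsto_pairing:
  assumes "(a \<longlongrightarrow> b) F" "ptends f p F" shows "((\<lambda>t. pairing (a t) (f t)) \<longlongrightarrow> pairing b p) F"
  unfolding pairing_def using assms unfolding ptends_def by (intro tendsto_intros) auto

lemma tendsto_heval:
  assumes "ptends f p F" shows "((\<lambda>t. heval d (f t) v) \<longlongrightarrow> heval d p v) F"
  unfolding heval_def using assms unfolding ptends_def by (intro tendsto_intros) auto

section \<open>Stability of real roots\<close>

text \<open>Rotating v gives a chart of the projective line around v that treats infinity like any other point.\<close>

definition pt :: "real \<times> real \<Rightarrow> real \<Rightarrow> real \<times> real" where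
  "pt v t = (fst v - t * snd v, snd v + t * fst v)"

definition nsq :: "real \<times> real \<Rightarrow> real" where "nsq v = fst v * fst v + snd v * snd v"

lemma nsq_pos: "v \<noteq> (0,0) \<Longrightarrow> nsq v > 0"
  by (cases v) (auto simp: nsq_def sum_squares_gt_zero_iff)

lemma ndet_pt_same: "ndet (pt v s) (pt v t) = (t - s) * nsq v"
  by (simp add: ndet_def pt_def nsq_def algebra_simps)

lemma ndet_pt: "ndet v (pt v t) = t * nsq v"
  by (simp add: ndet_def pt_def nsq_def algebra_simps)

lemma pt_nz: "v \<noteq> (0,0) \<Longrightarrow> pt v t \<noteq> (0,0)"
proof
  assume v: "v \<noteq> (0,0)" and "pt v t = (0,0)"
  then have "fst v - t * snd v = 0" "snd v + t * fst v = 0" by (simp_all only: pt_def prod.inject)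
  moreover have "nsq v = (fst v - t * snd v) * fst v + (snd v + t * fst v) * snd v"
    by (simp add: nsq_def algebra_simps)
  ultimately have "nsq v = 0" by (simp only: mult_zero_left add_0)
  then show False using nsq_pos[OF v] by simp
qed

lemma cont_heval_pt: "continuous_on A (\<lambda>t. heval d p (pt v t))"
  unfolding heval_def pt_def fst_conv snd_conv by (intro continuous_intros)

lemma sign_change_root:
  fixes f :: "real \<Rightarrow> real"
  assumes "continuous_on {a..b} f" "a < b" "f a * f b < 0"
  shows "\<exists>t. a < t \<and> t < b \<and> f t = 0"
proof -
  have "f a \<noteq> 0" "f b \<noteq> 0" using assms(3) by auto
  have "\<exists>t\<ge>a. t \<le> b \<and> f t = 0"
  proof (cases "f a < 0")
    case True
    then have "f b > 0" using assms(3) by (simp add: mult_less_0_iff)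
    then show ?thesis using IVT'[of f a 0 b] True assms by auto
  next
    case False
    then have "f b < 0" "f a > 0" using assms(3) by (auto simp: mult_less_0_iff)
    then show ?thesis using IVT2'[of f b 0 a] assms by auto
  qed
  then show ?thesis using \<open>f a \<noteq> 0\<close> \<open>f b \<noteq> 0\<close> by (metis order_le_less)
qed

text \<open>The arcs of radius \<delta> around different nodes remain disjoint in the projective
  line: the determinant of two moved points is that of the nodes plus terms that are small with s
  and t, and there are only finitely many pairs.\<close>

lemma separating_radius:
  fixes S :: "(real \<times> real) set"
  assumes "finite S" "S \<subseteq> cnode"
  shows "\<exists>\<delta>>0. \<forall>v\<in>S. \<forall>w\<in>S. v \<noteq> w \<longrightarrow> (\<forall>s t. \<bar>s\<bar> \<le> \<delta> \<longrightarrow> \<bar>t\<bar> \<le> \<delta> \<longrightarrow> ndet (pt v s) (pt w t) \<noteq> 0)"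
proof -
  have 1: "\<exists>\<delta>0>0. \<forall>s t. \<bar>s\<bar> \<le> \<delta>0 \<longrightarrow> \<bar>t\<bar> \<le> \<delta>0 \<longrightarrow> ndet (pt v s) (pt w t) \<noteq> 0" if "ndet v w \<noteq> 0"
    for v w :: "real \<times> real"
  proof -
    define D where "D = \<bar>ndet v w\<bar>"
    define K where "K = \<bar>fst v * fst w + snd v * snd w\<bar>"
    have D: "D > 0" "K \<ge> 0" using that by (auto simp: D_def K_def)
    \<comment> \<open>The error consists of D |s t|, at most D / 4, and |t - s| K, at most 2
      \<delta>0 K and thus less than D / 2; the determinant cannot be cancelled.\<close>
    define \<delta>0 where "\<delta>0 = min (1/2) (D / (4 * (K + 1)))"
    have \<delta>0: "\<delta>0 > 0" "\<delta>0 \<le> 1/2" "\<delta>0 * (4 * (K + 1)) \<le> D"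
    proof -
      show "\<delta>0 > 0" using D by (simp add: \<delta>0_def)
      show "\<delta>0 \<le> 1/2" by (simp only: \<delta>0_def min.cobounded1)
      have "\<delta>0 \<le> D / (4 * (K + 1))" by (simp only: \<delta>0_def min.cobounded2)
      then show "\<delta>0 * (4 * (K + 1)) \<le> D" using D by (subst (asm) pos_le_divide_eq) auto
    qed
    have "ndet (pt v s) (pt w t) \<noteq> 0" if st: "\<bar>s\<bar> \<le> \<delta>0" "\<bar>t\<bar> \<le> \<delta>0" for s t
    proof
      assume "ndet (pt v s) (pt w t) = 0"
      then have "ndet v w = - (ndet v w * (s * t) + (t - s) * (fst v * fst w + snd v * snd w))"
        by (simp add: ndet_def pt_def algebra_simps)
      then have "D \<le> D * (\<bar>s\<bar> * \<bar>t\<bar>) + \<bar>t - s\<bar> * K"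
        unfolding D_def K_def by (metis abs_minus_cancel abs_mult abs_triangle_ineq)
      moreover have "\<bar>s\<bar> * \<bar>t\<bar> \<le> (1/2) * (1/2)" using st \<delta>0 by (intro mult_mono) auto
      then have "D * (\<bar>s\<bar> * \<bar>t\<bar>) \<le> D * (1/4)" using D by (intro mult_left_mono) auto
      moreover have "\<bar>t - s\<bar> * K \<le> (2 * \<delta>0) * K" using st D by (intro mult_right_mono) auto
      moreover have "4 * (\<delta>0 * K) + 4 * \<delta>0 \<le> D" using \<delta>0(3) by (simp add: algebra_simps)
      ultimately show False using \<delta>0(1) D(1) by linarith
    qed
    then show ?thesis using \<delta>0 by blast
  qed
  have ev: "\<forall>\<^sub>F \<delta> in at_right 0. v \<noteq> w \<longrightarrow> (\<forall>s t. \<bar>s\<bar> \<le> \<delta> \<longrightarrow> \<bar>t\<bar> \<le> \<delta> \<longrightarrow> ndet (pt v s) (pt w t) \<noteq> 0)"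
    if "v \<in> S" "w \<in> S" for v w
  proof (cases "v = w")
    case False
    then have "ndet v w \<noteq> 0" using cnode_ndet that assms by blast
    from 1[OF this] obtain \<delta>0 where "\<delta>0 > 0" "\<And>s t. \<bar>s\<bar> \<le> \<delta>0 \<Longrightarrow> \<bar>t\<bar> \<le> \<delta>0 \<Longrightarrow> ndet (pt v s) (pt w t) \<noteq> 0" by blast
    then show ?thesis unfolding eventually_at_right_field
      by (intro exI[of _ \<delta>0]) (auto intro: order_trans less_imp_le)
  qed simp
  have "\<forall>\<^sub>F \<delta> in at_right (0::real). \<forall>v\<in>S. \<forall>w\<in>S. v \<noteq> w \<longrightarrow> (\<forall>s t. \<bar>s\<bar> \<le> \<delta> \<longrightarrow> \<bar>t\<bar> \<le> \<delta> \<longrightarrow>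
      ndet (pt v s) (pt w t) \<noteq> 0)"
    using ev assms(1) by (intro eventually_ball_finite ballI) auto
  then have "\<forall>\<^sub>F \<delta> in at_right (0::real). \<delta> > 0 \<and> (\<forall>v\<in>S. \<forall>w\<in>S. v \<noteq> w \<longrightarrow> (\<forall>s t. \<bar>s\<bar> \<le> \<delta> \<longrightarrow> \<bar>t\<bar> \<le> \<delta> \<longrightarrow>
      ndet (pt v s) (pt w t) \<noteq> 0))"
    using eventually_at_right_less by (rule eventually_conj[rotated])
  from eventually_happens[OF this] show ?thesis by auto
qed

lemma heval_scale:
  assumes "c \<noteq> 0" shows "heval d p (c * fst v, c * snd v) = c ^ d * heval d p v"
  unfolding heval_def sum_distrib_left
proof (intro sum.cong refl)
  fix i assume "i \<in> {..d}"
  then have cd: "c ^ (d - i) * c ^ i = c ^ d" by (simp add: power_add[symmetric])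
  have "coeff p i * ((c * fst v) ^ (d - i) * (c * snd v) ^ i) =
      (c ^ (d - i) * c ^ i) * (coeff p i * (fst v ^ (d - i) * snd v ^ i))"
    by (simp only: power_mult_distrib mult_ac)
  then show "coeff p i * (fst (c * fst v, c * snd v) ^ (d - i) * snd (c * fst v, c * snd v) ^ i) =
      c ^ d * (coeff p i * (fst v ^ (d - i) * snd v ^ i))"
    unfolding cd by simp
qed

text \<open>Pairwise independent zeros, as many as the nominal degree, leave only a constant as
  cofactor. The case c = 0 is still included and is excluded separately where it matters.\<close>

lemma distinct_roots_product:
  fixes r :: "'i \<Rightarrow> real \<times> real"
  assumes "finite I" "card I = d" "degree Q \<le> d"
    "\<And>i. i \<in> I \<Longrightarrow> r i \<noteq> (0,0) \<and> heval d Q (r i) = 0"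
    "\<And>i j. i \<in> I \<Longrightarrow> j \<in> I \<Longrightarrow> i \<noteq> j \<Longrightarrow> ndet (r i) (r j) \<noteq> 0"
  shows "\<exists>X c. finite X \<and> X \<subseteq> cnode \<and> card X = d \<and> Q = smult c (lprod (mset_set X))"
proof -
  define X where "X = (\<lambda>i. canon (r i)) ` I"
  have "inj_on (\<lambda>i. canon (r i)) I"
  proof (rule inj_onI, rule ccontr)
    fix i j assume ij: "i \<in> I" "j \<in> I" "canon (r i) = canon (r j)" "i \<noteq> j"
    then show False using assms(5)[of i j] ndet_canon[of "r i" "r j"] assms(4)[of i] assms(4)[of j] by simp
  qed
  then have X: "finite X" "X \<subseteq> cnode" "card X = d"
    using assms(1,2) by (auto simp: X_def card_image)
  have "heval d Q x = 0" if x: "x \<in> X" for x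
  proof -
    obtain i where i: "i \<in> I" "x = canon (r i)" using x by (auto simp: X_def)
    then obtain c where "c \<noteq> 0" "r i = (c * fst x, c * snd x)" using canon_scale assms(4) by metis
    then show ?thesis using assms(4)[OF i(1)] heval_scale[of c d Q x] by auto
  qed
  then obtain q where q: "Q = lprod (mset_set X) * q" "degree q \<le> d - card X"
    using heval_zeros_factor[OF X(1,2) assms(3)] X(3) by auto
  then obtain c where "q = [:c:]" using X(3) degree_0_id[of q]
    by (metis cancel_comm_monoid_add_class.diff_cancel le_0_eq)
  then show ?thesis using X q by (intro exI[of _ X] exI[of _ c]) simp
qed

lemma heval_lprod_set:
  assumes "finite S" shows "heval (card S) (lprod (mset_set S)) w = (\<Prod>v\<in>S. ndet v w)"
  using heval_lprod[of "mset_set S" w] by (simp add: prod_unfold_prod_mset)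

text \<open>The factors belong to other nodes and have no zero on the arc of v, so by the
  intermediate value theorem their product keeps its sign there.\<close>

lemma prod_same_sign:
  fixes v :: "real \<times> real"
  assumes S: "finite S" "v \<notin> S"
    and \<delta>: "\<And>w s t. w \<in> S \<Longrightarrow> \<bar>s\<bar> \<le> \<delta> \<Longrightarrow> \<bar>t\<bar> \<le> \<delta> \<Longrightarrow> ndet (pt w s) (pt v t) \<noteq> 0"
    and st: "\<bar>s\<bar> \<le> \<delta>" "\<bar>t\<bar> \<le> \<delta>"
  shows "(\<Prod>u\<in>S. ndet u (pt v s)) * (\<Prod>u\<in>S. ndet u (pt v t)) > 0"
proof -
  define R where "R = (\<lambda>t. \<Prod>u\<in>S. ndet u (pt v t))"
  have nz: "R t \<noteq> 0" if "\<bar>t\<bar> \<le> \<delta>" for t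
  proof -
    have "ndet u (pt v t) \<noteq> 0" if u: "u \<in> S" for u
      using \<delta>[OF u, of 0 t] \<open>\<bar>t\<bar> \<le> \<delta>\<close> by (simp add: pt_def)
    then show ?thesis using S by (simp add: R_def)
  qed
  have ct: "continuous_on A R" for A unfolding R_def ndet_def pt_def fst_conv snd_conv
    by (intro continuous_intros)
  have *: "R a * R b > 0" if ab: "a < b" "\<bar>a\<bar> \<le> \<delta>" "\<bar>b\<bar> \<le> \<delta>" for a b
  proof (rule ccontr)
    assume "\<not> ?thesis"
    then have "R a * R b < 0" using nz ab by (simp add: not_less order_le_less)
    from sign_change_root[OF ct ab(1) this] obtain t where "a < t" "t < b" "R t = 0" by blast
    then show False using nz[of t] ab by auto
  qed
  have "R s * R s > 0" using nz[OF st(1)] not_real_square_gt_zero by blast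
  then have "R s * R t > 0"
    using *[of s t] *[of t s] st by (cases s t rule: linorder_cases) (auto simp: mult.commute)
  then show ?thesis by (simp only: R_def)
qed

text \<open>At each node of S the limit has a simple zero and therefore opposite signs at the two
  ends of the arc. The strict inequality survives small perturbations, which yields one root in each
  of the disjoint arcs, and these roots exhaust the degree.\<close>

lemma distinct_roots_stable:
  fixes Q :: "'t \<Rightarrow> real poly" and S :: "(real \<times> real) set"
  assumes S: "finite S" "S \<subseteq> cnode" and Q: "\<And>t. degree (Q t) \<le> card S"
    and lim: "ptends Q (lprod (mset_set S)) F"
  shows "\<forall>\<^sub>F t in F. \<exists>X c. finite X \<and> X \<subseteq> cnode \<and> card X = card S \<and> Q t = smult c (lprod (mset_set X))"
proof -
  obtain \<delta> where \<delta>: "\<delta> > 0" "\<And>v w s t. v \<in> S \<Longrightarrow> w \<in> S \<Longrightarrow> v \<noteq> w \<Longrightarrow> \<bar>s\<bar> \<le> \<delta> \<Longrightarrow> \<bar>t\<bar> \<le> \<delta> \<Longrightarrow> ndet (pt v s) (pt w t) \<noteq> 0"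
    using separating_radius[OF S] by blast
  define f where "f = (\<lambda>t v x. heval (card S) (Q t) (pt v x))"
  have "\<forall>\<^sub>F t in F. f t v (-\<delta>) * f t v \<delta> < 0" if v: "v \<in> S" for v
  proof -
    have ev: "heval (card S) (lprod (mset_set S)) (pt v x) = x * nsq v * (\<Prod>u\<in>S - {v}. ndet u (pt v x))" for x
      using S v by (simp add: heval_lprod_set prod.remove[OF S(1) v] ndet_pt)
    have "(\<Prod>u\<in>S - {v}. ndet u (pt v (-\<delta>))) * (\<Prod>u\<in>S - {v}. ndet u (pt v \<delta>)) > 0"
      by (rule prod_same_sign[where \<delta> = \<delta>]) (use S \<delta> v in auto)
    then have "0 < (\<delta> * nsq v) * (\<delta> * nsq v) * ((\<Prod>u\<in>S - {v}. ndet u (pt v (-\<delta>))) * (\<Prod>u\<in>S - {v}. ndet u (pt v \<delta>)))"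
    proof (rule mult_pos_pos[rotated])
      have dn: "0 < \<delta> * nsq v" using \<delta>(1) nsq_pos[of v] cnode_nz[of v] S v by auto
      show "0 < (\<delta> * nsq v) * (\<delta> * nsq v)" by (rule mult_pos_pos[OF dn dn])
    qed
    then have "heval (card S) (lprod (mset_set S)) (pt v (-\<delta>)) * heval (card S) (lprod (mset_set S)) (pt v \<delta>) < 0"
      unfolding ev by (simp add: algebra_simps)
    moreover have "((\<lambda>t. f t v (-\<delta>) * f t v \<delta>) \<longlongrightarrow> heval (card S) (lprod (mset_set S)) (pt v (-\<delta>)) * heval (card S) (lprod (mset_set S)) (pt v \<delta>)) F"
      unfolding f_def by (intro tendsto_mult tendsto_heval lim)
    ultimately show ?thesis using order_tendstoD(2) by blast
  qed
  then have "\<forall>\<^sub>F t in F. \<forall>v\<in>S. f t v (-\<delta>) * f t v \<delta> < 0" using S by (intro eventually_ball_finite ballI) auto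
  then show ?thesis
  proof eventually_elim
    case (elim t)
    have "\<forall>v\<in>S. \<exists>x. -\<delta> < x \<and> x < \<delta> \<and> f t v x = 0"
    proof
      fix v assume "v \<in> S"
      then show "\<exists>x. -\<delta> < x \<and> x < \<delta> \<and> f t v x = 0"
        using elim \<delta> by (intro sign_change_root) (auto simp: f_def intro: cont_heval_pt)
    qed
    then obtain x where x: "\<And>v. v \<in> S \<Longrightarrow> -\<delta> < x v \<and> x v < \<delta> \<and> f t v (x v) = 0" by metis
    show ?case
    proof (rule distinct_roots_product[OF S(1) refl Q])
      fix v assume "v \<in> S"
      then show "pt v (x v) \<noteq> (0, 0) \<and> heval (card S) (Q t) (pt v (x v)) = 0"
        using pt_nz[of v "x v"] cnode_nz[of v] x[of v] S by (auto simp: f_def)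
    next
      fix v w assume "v \<in> S" "w \<in> S" "v \<noteq> w"
      then show "ndet (pt v (x v)) (pt w (x w)) \<noteq> 0" using x[of v] x[of w] by (intro \<delta>(2)) auto
    qed
  qed
qed

text \<open>The sign of \<open>u\<^sup>2 - \<epsilon>\<close> is negative at the double root and positive nearby, which produces two real roots.\<close>

lemma double_root_splits:
  fixes S :: "(real \<times> real) set"
  assumes S: "finite S" "S \<subseteq> cnode" and l: "l \<in> S" and M: "degree M \<le> card S"
  defines "Q \<equiv> \<lambda>\<epsilon>. lprod (mset_set (S - {l})) * (lin l * lin l - smult \<epsilon> [:1, 0, 1:]) + smult \<epsilon> (lin l * M)"
  shows "\<forall>\<^sub>F \<epsilon> in at_right 0. \<exists>X c. finite X \<and> X \<subseteq> cnode \<and> card X = Suc (card S) \<and> c \<noteq> 0 \<and> Q \<epsilon> =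
      smult c (lprod (mset_set X))"
proof -
  let ?L = "lprod (mset_set (S - {l}))"
  have cS: "card S = Suc (card (S - {l}))" using S l by (metis card.remove)
  obtain \<delta> where \<delta>: "\<delta> > 0" "\<And>v w s t. v \<in> S \<Longrightarrow> w \<in> S \<Longrightarrow> v \<noteq> w \<Longrightarrow> \<bar>s\<bar> \<le> \<delta> \<Longrightarrow> \<bar>t\<bar> \<le> \<delta> \<Longrightarrow> ndet (pt v s) (pt w t) \<noteq> 0"
    using separating_radius[OF S] by blast
  have dL: "degree ?L \<le> card (S - {l})" using degree_lprod[of "mset_set (S - {l})"] by simp
  have d2: "degree (lin l * lin l - smult \<epsilon> [:1, 0, 1:]) \<le> 2" for \<epsilon> :: real
    by (intro degree_diff_le) (use degree_mult_le[of "lin l"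
      "lin l"] degree_lin[of l] in \<open>auto intro: order_trans[OF degree_smult_le]\<close>)
  have dlM: "degree (lin l * M) \<le> Suc (card S)"
    using degree_mult_le[of "lin l" M] degree_lin[of l] M by linarith
  have dQ: "degree (Q \<epsilon>) \<le> Suc (card S)" for \<epsilon>
    unfolding Q_def
  proof (intro degree_add_le)
    show "degree (?L * (lin l * lin l - smult \<epsilon> [:1, 0, 1:])) \<le> Suc (card S)"
      using degree_mult_le[of ?L "lin l * lin l - smult \<epsilon> [:1, 0, 1:]"] dL d2[of \<epsilon>] cS by linarith
    show "degree (smult \<epsilon> (lin l * M)) \<le> Suc (card S)" using dlM degree_smult_le order_trans by blast
  qed
  have hQ: "heval (Suc (card S)) (Q \<epsilon>) w =
      (\<Prod>u\<in>S - {l}. ndet u w) * (ndet l w * ndet l w - \<epsilon> * nsq w) + \<epsilon> * (ndet l w * heval (card S) M w)" for \<epsilon> w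
  proof -
    have "heval (card (S - {l}) + 2) (?L * (lin l * lin l - smult \<epsilon> [:1, 0, 1:])) w =
        heval (card (S - {l})) ?L w * heval 2 (lin l * lin l - smult \<epsilon> [:1, 0, 1:]) w"
      by (rule heval_mult[OF dL d2])
    moreover have "heval (1 + 1) (lin l * lin l) w = ndet l w * ndet l w"
      by (subst heval_mult) (auto simp: heval_lin degree_lin)
    moreover have "heval 2 [:1, 0, 1:] w = nsq w" by (simp add: heval_def nsq_def numeral_2_eq_2)
    moreover have "heval (1 + card S) (lin l * M) w = ndet l w * heval (card S) M w"
      by (subst heval_mult) (auto simp: heval_lin degree_lin M)
    ultimately show ?thesis
      using heval_lprod_set[of "S - {l}" w] S(1) cS
      by (simp add: Q_def heval_add heval_diff heval_smult numeral_2_eq_2 del: smult_pCons)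
  qed
  define f where "f = (\<lambda>\<epsilon> v x. heval (Suc (card S)) (Q \<epsilon>) (pt v x))"
  have flim: "((\<lambda>\<epsilon>. f \<epsilon> v x) \<longlongrightarrow> (\<Prod>u\<in>S - {l}. ndet u (pt v x)) * (ndet l (pt v x) * ndet l (pt v x))) (at_right 0)" for v x
  proof -
    have "((\<lambda>\<epsilon>. f \<epsilon> v x) \<longlongrightarrow> (\<Prod>u\<in>S - {l}. ndet u (pt v x)) * (ndet l (pt v x) * ndet l (pt v x) - 0 * nsq (pt v x)) + 0 * (ndet l (pt v x) * heval (card S) M (pt v x))) (at_right 0)"
      unfolding f_def hQ by (intro tendsto_intros)
    then show ?thesis by simp
  qed
  define P where "P = (\<lambda>v x. \<Prod>u\<in>S - {v}. ndet u (pt v x))"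
  have Ppos: "P v s * P v t > 0" if "v \<in> S" "\<bar>s\<bar> \<le> \<delta>" "\<bar>t\<bar> \<le> \<delta>" for v s t
    unfolding P_def by (rule prod_same_sign[where \<delta> = \<delta>]) (use S \<delta> that in auto)
  have 1: "\<forall>\<^sub>F \<epsilon> in at_right 0. f \<epsilon> v (-\<delta>) * f \<epsilon> v \<delta> < 0" if v: "v \<in> S - {l}" for v
  proof -
    have ev: "(\<Prod>u\<in>S - {l}. ndet u (pt v x)) * (ndet l (pt v x) * ndet l (pt v x)) =
        x * nsq v * (ndet l (pt v x) * P v x)" for x
    proof -
      have "(\<Prod>u\<in>S - {l}. ndet u (pt v x)) = x * nsq v * (\<Prod>u\<in>S - {l} - {v}. ndet u (pt v x))"
        using prod.remove[of "S - {l}" v "\<lambda>u. ndet u (pt v x)"] S v by (simp add: ndet_pt)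
      moreover have "P v x = ndet l (pt v x) * (\<Prod>u\<in>S - {l} - {v}. ndet u (pt v x))"
        unfolding P_def using prod.remove[of "S - {v}" l "\<lambda>u. ndet u (pt v x)"] S v l
        by (auto simp: Diff_insert2[symmetric] insert_commute)
      ultimately show ?thesis by (simp add: algebra_simps)
    qed
    have "(\<Prod>u\<in>{l}. ndet u (pt v (-\<delta>))) * (\<Prod>u\<in>{l}. ndet u (pt v \<delta>)) > 0"
    proof (rule prod_same_sign[where \<delta> = \<delta>])
      fix w s t assume "w \<in> {l}" "\<bar>s\<bar> \<le> \<delta>" "\<bar>t\<bar> \<le> \<delta>"
      then show "ndet (pt w s) (pt v t) \<noteq> 0" using \<delta>(2)[of l v s t] v l by auto
    qed (use \<delta>(1) v in auto)
    then have "ndet l (pt v (-\<delta>)) * ndet l (pt v \<delta>) > 0" by simp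
    then have "0 < (\<delta> * nsq v) * (\<delta> * nsq v) * ((ndet l (pt v (-\<delta>)) * ndet l (pt v \<delta>)) * (P v (-\<delta>) * P v \<delta>))"
      using \<delta> nsq_pos[of v] cnode_nz[of v] S v Ppos[of v "-\<delta>" \<delta>]
      by (intro mult_pos_pos[of "(\<delta> * nsq v) * (\<delta> * nsq v)"] mult_pos_pos[of "ndet _ _ * ndet _ _"] mult_pos_pos[of "\<delta> * nsq v"] mult_pos_pos[of \<delta> "nsq v"]) auto
    then have "(-\<delta>) * nsq v * (ndet l (pt v (-\<delta>)) * P v (-\<delta>)) * (\<delta> * nsq v * (ndet l (pt v \<delta>) * P v \<delta>)) < 0"
      by (simp add: algebra_simps)
    from order_tendstoD(2)[OF tendsto_mult[OF flim[of v "-\<delta>"] flim[of v \<delta>]], unfolded ev, OF this]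
    show ?thesis .
  qed
  \<comment> \<open>At l itself only the term of order \<epsilon> survives; its sign is opposite to
    that of \<open>P l 0\<close>, while at both ends of the arc the sign agrees with it. Hence there
    is one root on either side of l.\<close>
  have f0: "f \<epsilon> l 0 = - (\<epsilon> * nsq l * P l 0)" for \<epsilon>
    by (simp add: f_def hQ pt_def P_def ndet_def)
  have 2: "\<forall>\<^sub>F \<epsilon> in at_right 0. f \<epsilon> l x * P l 0 > 0" if x: "x = \<delta> \<or> x = -\<delta>" for x
  proof -
    have "(\<Prod>u\<in>S - {l}. ndet u (pt l x)) * (ndet l (pt l x) * ndet l (pt l x)) * P l 0 =
        (x * nsq l) * (x * nsq l) * (P l x * P l 0)"
      by (simp add: P_def ndet_pt algebra_simps)
    also have "\<dots> > 0" using Ppos[of l x 0] l x \<delta> nsq_pos[of l] cnode_nz[of l] S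
      by (intro mult_pos_pos[of "(x * nsq l) * (x * nsq l)"]) (auto simp: zero_less_mult_iff)
    finally show ?thesis using order_tendstoD(1)[OF tendsto_mult[OF flim tendsto_const]] by blast
  qed
  have "\<forall>\<^sub>F \<epsilon> in at_right 0. \<epsilon> > 0 \<and> (\<forall>v\<in>S - {l}. f \<epsilon> v (-\<delta>) * f \<epsilon> v \<delta> < 0) \<and> f \<epsilon> l \<delta> * P l 0 > 0 \<and>
      f \<epsilon> l (-\<delta>) * P l 0 > 0"
    using 1 2 S by (intro eventually_conj eventually_ball_finite ballI) (auto simp: eventually_at_right_less)
  then show ?thesis
  proof eventually_elim
    case (elim \<epsilon>)
    have ct: "continuous_on A (f \<epsilon> v)" for A v unfolding f_def by (rule cont_heval_pt)
    have neg: "y * f \<epsilon> l 0 < 0" if y: "y * P l 0 > 0" for y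
    proof -
      have "0 < \<epsilon> * nsq l * (y * P l 0)" using y elim nsq_pos[of l] cnode_nz[of l] S l
        by (intro mult_pos_pos[of "\<epsilon> * nsq l"] mult_pos_pos[of \<epsilon>]) auto
      then show ?thesis by (simp add: f0 algebra_simps)
    qed
    have "\<forall>v\<in>S - {l}. \<exists>x. -\<delta> < x \<and> x < \<delta> \<and> f \<epsilon> v x = 0"
    proof
      fix v assume "v \<in> S - {l}"
      then show "\<exists>x. -\<delta> < x \<and> x < \<delta> \<and> f \<epsilon> v x = 0"
        using elim \<delta> by (intro sign_change_root ct) auto
    qed
    then obtain x where x: "\<And>v. v \<in> S - {l} \<Longrightarrow> -\<delta> < x v \<and> x v < \<delta> \<and> f \<epsilon> v (x v) = 0" by metis
    obtain p where p: "0 < p" "p < \<delta>" "f \<epsilon> l p = 0"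
      using sign_change_root[of 0 \<delta> "f \<epsilon> l", OF ct \<delta>(1)] neg[of "f \<epsilon> l \<delta>"] elim by (auto simp: mult.commute)
    obtain m where m: "-\<delta> < m" "m < 0" "f \<epsilon> l m = 0"
      using sign_change_root[of "-\<delta>" 0 "f \<epsilon> l", OF ct] \<delta>(1) neg[of "f \<epsilon> l (-\<delta>)"] elim by auto
    \<comment> \<open>Index \<open>None\<close> stands for the additional root m on the arc of l,
      and \<open>Some v\<close> for the root on the arc of v, which is p for v = l; \<open>b\<close>
      gives the centre of the arc and \<open>y\<close> the position on it.\<close>
    define b where "b = (\<lambda>i. case i of None \<Rightarrow> l | Some v \<Rightarrow> v)"
    define y where "y = (\<lambda>i. case i of None \<Rightarrow> m | Some v \<Rightarrow> if v = l then p else x v)"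
    define I where "I = insert None (Some ` S)"
    have y: "b i \<in> S \<and> -\<delta> < y i \<and> y i < \<delta> \<and> f \<epsilon> (b i) (y i) = 0" if "i \<in> I" for i
      using that x p m l by (auto simp: I_def b_def y_def)
    have "card I = Suc (card S)" unfolding I_def using S(1)
      by (subst card_insert_disjoint) (auto simp: card_image)
    then have "\<exists>X c. finite X \<and> X \<subseteq> cnode \<and> card X = Suc (card S) \<and> Q \<epsilon> = smult c (lprod (mset_set X))"
    proof (intro distinct_roots_product[of I _ _ "\<lambda>i. pt (b i) (y i)"])
      fix i assume "i \<in> I"
      then show "pt (b i) (y i) \<noteq> (0, 0) \<and> heval (Suc (card S)) (Q \<epsilon>) (pt (b i) (y i)) = 0"
        using y[of i] pt_nz[of "b i" "y i"] cnode_nz[of "b i"] S by (auto simp: f_def)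
    next
      fix i j assume ij: "i \<in> I" "j \<in> I" "i \<noteq> j"
      show "ndet (pt (b i) (y i)) (pt (b j) (y j)) \<noteq> 0"
      proof (cases "b i = b j")
        case True
        then have "y i \<noteq> y j" using ij p m by (auto simp: I_def b_def y_def split: if_splits)
        then show ?thesis using True ndet_pt_same[of "b i" "y i"
          "y j"] nsq_pos[of "b i"] cnode_nz[of "b i"] y[OF ij(1)] S by auto
      next
        case False
        then show ?thesis using y[OF ij(1)] y[OF ij(2)] by (intro \<delta>(2)) auto
      qed
    qed (use S dQ in \<open>auto simp: I_def\<close>)
    moreover have "Q \<epsilon> \<noteq> 0"
    proof
      assume "Q \<epsilon> = 0"
      then have "f \<epsilon> l 0 = 0" by (simp add: f_def)
      then show False using neg[of "f \<epsilon> l \<delta>"] elim by simp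
    qed
    ultimately show ?case by fastforce
  qed
qed

text \<open>The same stability with an explicit neighbourhood of coefficients, obtained from the
  sequential version by contradiction. The scalar c is nonzero because some coefficient of the limit
  is nonzero and stays so nearby.\<close>

lemma distinct_roots_stable_eps:
  fixes S :: "(real \<times> real) set"
  assumes S: "finite S" "S \<subseteq> cnode"
  shows "\<exists>e>0. \<forall>Q. degree Q \<le> card S \<longrightarrow>
    (\<forall>i\<le>card S. \<bar>coeff Q i - coeff (lprod (mset_set S)) i\<bar> < e) \<longrightarrow>
    (\<exists>X c. finite X \<and> X \<subseteq> cnode \<and> card X = card S \<and> c \<noteq> 0 \<and> Q = smult c (lprod (mset_set X)))"
proof (rule ccontr)
  let ?p = "lprod (mset_set S)"
  assume "\<not> ?thesis"
  then have neg: "\<exists>Q. degree Q \<le> card S \<and> (\<forall>i\<le>card S. \<bar>coeff Q i - coeff ?p i\<bar> < e) \<and>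
     \<not> (\<exists>X c. finite X \<and> X \<subseteq> cnode \<and> card X = card S \<and> c \<noteq> 0 \<and> Q =
         smult c (lprod (mset_set X)))" if "e > 0" for e :: real
    using that by blast
  have "\<forall>n. \<exists>Q. degree Q \<le> card S \<and> (\<forall>i\<le>card S. \<bar>coeff Q i - coeff ?p i\<bar> < inverse (real (Suc n))) \<and>
     \<not> (\<exists>X c. finite X \<and> X \<subseteq> cnode \<and> card X = card S \<and> c \<noteq> 0 \<and> Q = smult c (lprod (mset_set X)))"
    by (intro allI neg) simp
  then obtain Q where Q: "\<And>n. degree (Q n) \<le> card S"
    "\<And>n i. i \<le> card S \<Longrightarrow> \<bar>coeff (Q n) i - coeff ?p i\<bar> < inverse (real (Suc n))"
    "\<And>n X c. finite X \<Longrightarrow> X \<subseteq> cnode \<Longrightarrow> card X = card S \<Longrightarrow> c \<noteq> 0 \<Longrightarrow> Q n \<noteq> smult c (lprod (mset_set X))"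
    by metis
  have lim: "ptends Q ?p sequentially"
    unfolding ptends_def
  proof
    fix i
    show "(\<lambda>n. coeff (Q n) i) \<longlonglongrightarrow> coeff ?p i"
    proof (cases "i \<le> card S")
      case True
      have "(\<lambda>n. coeff (Q n) i - coeff ?p i) \<longlonglongrightarrow> 0"
        by (rule tendsto_0_le[OF LIMSEQ_inverse_real_of_nat, of _ 1])
           (use Q(2)[OF True] in \<open>auto intro!: always_eventually less_imp_le simp del: of_nat_Suc\<close>)
      then show ?thesis by (simp add: LIM_zero_iff)
    next
      case False
      then have "coeff (Q n) i = 0" for n using Q(1)[of n] by (intro coeff_eq_0) auto
      moreover have "coeff ?p i = 0" using degree_lprod[of "mset_set S"] False by (intro coeff_eq_0) auto
      ultimately show ?thesis by simp
    qed
  qed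
  obtain i0 where i0: "coeff ?p i0 \<noteq> 0" using lprod_nz[of "mset_set S"] S by (auto simp: poly_eq_iff)
  have "\<forall>\<^sub>F n in sequentially. coeff (Q n) i0 \<noteq> 0"
    by (rule tendsto_imp_eventually_ne[OF lim[unfolded ptends_def, rule_format, of i0] i0])
  moreover have "\<forall>\<^sub>F n in sequentially. \<exists>X c. finite X \<and> X \<subseteq> cnode \<and> card X = card S \<and> Q n =
      smult c (lprod (mset_set X))"
    by (rule distinct_roots_stable[OF S Q(1) lim])
  ultimately have "\<forall>\<^sub>F n::nat in sequentially. False"
  proof eventually_elim
    case (elim n)
    then obtain X c where X: "finite X" "X \<subseteq> cnode" "card X = card S" "Q n = smult c (lprod (mset_set X))"
      by blast
    then have "c \<noteq> 0" using elim by auto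
    then show False using Q(3)[OF X(1-3)] X(4) by blast
  qed
  then show False by simp
qed

section \<open>Catalecticant matrices and stable decompositions\<close>

lemma pairing_mult_expand:
  assumes "degree M \<le> n"
  shows "pairing a (p * M) = (\<Sum>i\<le>n. coeff M i * pairing a (p * monom 1 i))"
proof -
  have "p * M = (\<Sum>i\<le>n. smult (coeff M i) (p * monom 1 i))"
    by (subst poly_as_sum_le[OF assms]) (simp add: sum_distrib_left mult_smult_right[symmetric] smult_monom)
  then show ?thesis by (simp only: pairing_sum pairing_smult)
qed

text \<open>The entries depend on i + j only: this is the catalecticant of the functional that sends
  p to the pairing of a with B p. The coefficients c of a linear relation between rows are the
  coefficients of a polynomial q with pairing 0 against all B q M.\<close>

lemma hankel_rows_independent:
  assumes ns: "\<And>q. degree q \<le> d \<Longrightarrow> (\<And>M. degree M \<le> n \<Longrightarrow> pairing a (B * q * M) = 0) \<Longrightarrow> q = 0"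
    and c: "\<forall>i<Suc n. (\<Sum>j<Suc d. c j * pairing a (B * monom 1 (i + j))) = 0"
  shows "\<forall>j<Suc d. c j = 0"
proof -
  define q where "q = (\<Sum>j\<le>d. monom (c j) j)"
  have dq: "degree q \<le> d" unfolding q_def
    by (intro degree_sum_le) (auto intro: order_trans[OF degree_monom_le])
  have cq: "coeff q j = c j" if "j \<le> d" for j using that by (simp add: q_def coeff_sum)
  have "pairing a (B * q * monom 1 i) = 0" if "i \<le> n" for i
  proof -
    have "B * q * monom 1 i = (\<Sum>j<Suc d. smult (c j) (B * monom 1 (i + j)))"
      unfolding q_def lessThan_Suc_atMost
      by (simp add: sum_distrib_left sum_distrib_right mult_monom mult.assoc mult_smult_right[symmetric] smult_monom add.commute)
    then have "pairing a (B * q * monom 1 i) = (\<Sum>j<Suc d. c j * pairing a (B * monom 1 (i + j)))"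
      by (simp only: pairing_sum pairing_smult)
    then show ?thesis using c that by simp
  qed
  then have "pairing a (B * q * M) = 0" if "degree M \<le> n" for M
    using pairing_mult_expand[OF that, of a "B * q"] by simp
  then have "q = 0" using ns[OF dq] by blast
  then show ?thesis using cq by (metis coeff_0 less_Suc_eq_le)
qed

text \<open>The hypothesis \<open>ns\<close> says that the catalecticant has full row rank, so its
  kernel moves continuously with the form. A nearby form thus has an annihilator close to the given
  one, which still has r distinct real roots, and Sylvester's criterion applies to it.\<close>

lemma stable_decomposition:
  fixes S :: "(real \<times> real) set"
  assumes S: "finite S" "S \<subseteq> cnode" "card S = r" and r: "r \<le> 8"
    and ann: "annih a r (lprod (mset_set S))"
    and ns: "\<And>q. degree q \<le> 8 - r \<Longrightarrow> (\<And>M. degree M \<le> r \<Longrightarrow> pairing a (q * M) = 0) \<Longrightarrow> q = 0"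
  shows "a \<in> interior (Wset r)"
proof -
  let ?p = "lprod (mset_set S)"
  have dp: "degree ?p \<le> r" using degree_lprod[of "mset_set S"] S by simp
  obtain e where e: "e > 0" and stab: "\<And>Q. degree Q \<le> r \<Longrightarrow> (\<And>i. i \<le> r \<Longrightarrow> \<bar>coeff Q i - coeff ?p i\<bar> < e) \<Longrightarrow>
    \<exists>X c. finite X \<and> X \<subseteq> cnode \<and> card X = r \<and> c \<noteq> 0 \<and> Q = smult c (lprod (mset_set X))"
    using distinct_roots_stable_eps[OF S(1,2)] S(3) by metis
  have nth: "pairing b (monom 1 (i + j)) = b $ of_nat (i + j)" if "i < Suc r" "j < Suc (8 - r)"
    for b :: "real ^ 9" and i j
    using that r by (subst pairing_monom) auto
  have "\<forall>\<^sub>F b in nhds a. \<exists>x. (\<forall>i<Suc r. norm (x i - coeff ?p i) < e) \<and>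
      (\<forall>j<Suc (8 - r). (\<Sum>i<Suc r. pairing b (1 * monom 1 (i + j)) * x i) = 0)"
  proof (rule kernel_perturbation)
    fix c :: "nat \<Rightarrow> real" assume "\<forall>i<Suc r. (\<Sum>j<Suc (8 - r). c j * pairing a (1 * monom 1 (i + j))) = 0"
    then show "\<forall>j<Suc (8 - r). c j = 0"
      by (rule hankel_rows_independent[rotated]) (use ns in auto)
  next
    fix i j assume "j < Suc (8 - r)" "i < Suc r"
    then show "((\<lambda>b. pairing b (1 * monom 1 (i + j))) \<longlongrightarrow> pairing a (1 * monom 1 (i + j))) (nhds a)"
      unfolding mult_1 by (simp only: nth) (intro tendsto_vec_nth tendsto_ident_at filterlim_ident)
  next
    fix j assume j: "j < Suc (8 - r)"
    have "?p * monom 1 j = (\<Sum>i<Suc r. smult (coeff ?p i) (1 * monom 1 (i + j)))"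
      by (subst poly_as_sum_le[OF dp]) (simp add: sum_distrib_right mult_monom smult_monom lessThan_Suc_atMost)
    then have "pairing a (?p * monom 1 j) = (\<Sum>i<Suc r. pairing a (1 * monom 1 (i + j)) * coeff ?p i)"
      by (simp only: pairing_sum pairing_smult mult.commute)
    then show "(\<Sum>i<Suc r. pairing a (1 * monom 1 (i + j)) * coeff ?p i) = 0"
      using ann j by (simp add: annih_def)
  qed (rule e)
  then have "\<forall>\<^sub>F b in nhds a. b \<in> Wset r"
  proof eventually_elim
    case (elim b)
    then obtain x where x: "\<And>i. i < Suc r \<Longrightarrow> norm (x i - coeff ?p i) < e"
      "\<And>j. j < Suc (8 - r) \<Longrightarrow> (\<Sum>i<Suc r. pairing b (1 * monom 1 (i + j)) * x i) = 0" by blast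
    define Q where "Q = (\<Sum>i\<le>r. monom (x i) i)"
    have dQ: "degree Q \<le> r" unfolding Q_def
      by (intro degree_sum_le) (auto intro: order_trans[OF degree_monom_le])
    have cQ: "coeff Q i = x i" if "i \<le> r" for i using that by (simp add: Q_def coeff_sum)
    obtain X c where X: "finite X" "X \<subseteq> cnode" "card X = r" "c \<noteq> 0" "Q = smult c (lprod (mset_set X))"
      using stab[OF dQ] x(1) cQ by (metis less_Suc_eq_le real_norm_def)
    have "annih b r Q" unfolding annih_def
    proof (intro allI impI)
      fix k assume "k \<le> 8 - r"
      have "Q * monom 1 k = (\<Sum>i<Suc r. smult (x i) (1 * monom 1 (i + k)))"
        by (simp add: Q_def sum_distrib_right mult_monom smult_monom lessThan_Suc_atMost)
      then have "pairing b (Q * monom 1 k) = (\<Sum>i<Suc r. pairing b (1 * monom 1 (i + k)) * x i)"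
        by (simp only: pairing_sum pairing_smult mult.commute)
      then show "pairing b (Q * monom 1 k) = 0" using x(2)[of k] \<open>k \<le> 8 - r\<close> by simp
    qed
    then have "annih b r (lprod (mset_set X))" using X by (simp add: annih_smult)
    then obtain c where "b = (\<Sum>v\<in>X. c v *\<^sub>R evv v)" using annih_distinct_decomp[of X b] X r by auto
    then show "b \<in> Wset r" using waring_card[OF X(1)] X(3) by auto
  qed
  then show ?thesis unfolding eventually_nhds by (meson interiorI subsetI)
qed

definition Dset :: "nat \<Rightarrow> (real ^ 9) set" where
  "Dset r = {a. \<exists>N. size N \<le> r \<and> set_mset N \<subseteq> cnode \<and> card (set_mset N) \<le> 8 - r \<and> annih a (size N) (lprod N)}"

lemma infinite_cnode: "infinite (cnode :: (real \<times> real) set)"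
proof
  assume "finite (cnode :: (real \<times> real) set)"
  then have "finite ((\<lambda>x::real. (1::real, x)) ` UNIV)" by (rule finite_subset[rotated]) (auto simp: cnode_def)
  then show False by (subst (asm) finite_image_iff) (auto simp: inj_on_def infinite_UNIV_char_0)
qed

text \<open>Let \<open>B \<cdot> S\<close> be a real-rooted annihilator with the most distinct roots, S being its squarefree
part. If the functionals \<open>M \<mapsto> B M u\<^sup>j\<close> are independent, a double root could be split into two
by a correction of first order, so B is trivial and the annihilator moves with the form.
Otherwise some \<open>q \<noteq> 0\<close> of degree at most 8 - r satisfies \<open>B q M = 0\<close> for all M; then the
weights of the quadrature formula for \<open>p \<mapsto> B p\<close> vanish outside the at most 8 - r zeros of q.\<close>

lemma Pset_interior_or_Dset:
  assumes r: "r \<le> 8" and a: "a \<in> Pset r"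
  shows "a \<in> interior (Wset r) \<or> a \<in> Dset r"
proof -
  define G where "G = (\<lambda>N. size N = r \<and> set_mset N \<subseteq> cnode \<and> annih a r (lprod N))"
  obtain N0 where N0: "G N0" using a by (auto simp: Pset_def G_def)
  have bd: "card (set_mset M) \<le> r" if "G M" for M
    using that size_mset_mono[OF mset_set_set_mset_msubset[of M]] by (simp add: G_def)
  obtain N where N: "G N" and max: "\<And>M. G M \<Longrightarrow> card (set_mset M) \<le> card (set_mset N)"
    using ex_has_greatest_nat[of G N0 "\<lambda>M. card (set_mset M)" "Suc r"] N0 bd by (metis less_Suc_eq_le)
  define S where "S = set_mset N"
  define n where "n = card S"
  have S: "finite S" "S \<subseteq> cnode" using N by (auto simp: S_def G_def)
  define B where "B = N - mset_set S"
  have NB: "N = B + mset_set S" unfolding B_def S_def by (simp add: mset_set_set_mset_msubset)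
  have sz: "size B + n = r" using N NB S by (simp add: G_def n_def)
  have setB: "set_mset B \<subseteq> S" unfolding B_def S_def by (meson in_diffD subsetI)
  have annN: "annih a r (lprod B * lprod (mset_set S))" using N NB by (simp add: G_def lprod_union)
  show ?thesis
  proof (cases "\<exists>q. degree q \<le> 8 - r \<and> (\<forall>M. degree M \<le> n \<longrightarrow> pairing a (lprod B * q * M) = 0) \<and> q \<noteq> 0")
    case False
    then have ns: "q = 0" if "degree q \<le> 8 - r" "\<And>M. degree M \<le> n \<Longrightarrow> pairing a (lprod B * q * M) = 0" for q
      using that by blast
    show ?thesis
    proof (cases "B = {#}")
      case True
      then have "a \<in> interior (Wset r)"
        using stable_decomposition[OF S, of r a] annN ns sz r by (simp add: n_def)
      then show ?thesis by simp
    next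
      case False
      then obtain l B' where B: "B = add_mset l B'" by (metis multiset_cases)
      have l: "l \<in> S" using setB B by auto
      let ?L = "lprod (mset_set (S - {l}))"
      have Sl: "lprod (mset_set S) = lin l * ?L" using S l by (metis lprod_add_mset mset_set.remove)
      \<comment> \<open>The first-order effect on the annihilator of replacing the square of
        \<open>lin l\<close> by that square minus \<epsilon> (1 + u^2). The polynomial M below is
        chosen, through the right inverse K, so that \<open>k0 + lprod B * M\<close> annihilates a;
        then the modified product does so exactly, for every \<epsilon>.\<close>
      define k0 where "k0 = - (lprod B' * ?L * [:1, 0, 1:])"
      have "\<exists>K. \<forall>j<Suc (8 - r). \<forall>t<Suc (8 - r). (\<Sum>i<Suc n. pairing a (lprod B * monom 1 (i + j)) * K i t) = (if j = t then 1 else 0)"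
        by (rule right_inverse_if_rows_independent, rule hankel_rows_independent) (use ns in auto)
      then obtain K where K: "\<And>j t. j < Suc (8 - r) \<Longrightarrow> t < Suc (8 - r) \<Longrightarrow>
          (\<Sum>i<Suc n. pairing a (lprod B * monom 1 (i + j)) * K i t) = (if j = t then 1 else 0)"
        by blast
      define m where "m = (\<lambda>i. \<Sum>t<Suc (8 - r). K i t * - pairing a (k0 * monom 1 t))"
      define M where "M = (\<Sum>i\<le>n. monom (m i) i)"
      have dM: "degree M \<le> n" unfolding M_def
        by (intro degree_sum_le) (auto intro: order_trans[OF degree_monom_le])
      have annM: "annih a r (k0 + lprod B * M)" unfolding annih_def
      proof (intro allI impI)
        fix j assume j: "j \<le> 8 - r"
        have "lprod B * M * monom 1 j = (\<Sum>i<Suc n. smult (m i) (lprod B * monom 1 (i + j)))"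
          by (simp add: M_def lessThan_Suc_atMost sum_distrib_left sum_distrib_right mult.assoc mult_monom mult_smult_right[symmetric] smult_monom)
        then have "pairing a (lprod B * M * monom 1 j) =
            (\<Sum>i<Suc n. \<Sum>t<Suc (8 - r). (pairing a (lprod B * monom 1 (i + j)) * K i t) * - pairing a (k0 * monom 1 t))"
          by (simp only: pairing_sum pairing_smult m_def sum_distrib_left sum_distrib_right mult_ac)
        also have "\<dots> = (\<Sum>t<Suc (8 - r). (\<Sum>i<Suc n. pairing a (lprod B * monom 1 (i + j)) * K i t) * - pairing a (k0 * monom 1 t))"
          by (subst sum.swap) (simp only: sum_distrib_right)
        also have "\<dots> = (\<Sum>t<Suc (8 - r). (if t = j then - pairing a (k0 * monom 1 t) else 0))"
          by (intro sum.cong refl) (use K[of j] j in \<open>auto simp del: sum.lessThan_Suc\<close>)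
        also have "\<dots> = - pairing a (k0 * monom 1 j)" using j by (subst sum.delta) auto
        finally show "pairing a ((k0 + lprod B * M) * monom 1 j) = 0" by (simp add: distrib_right pairing_add)
      qed
      define Q where "Q = (\<lambda>\<epsilon>. ?L * (lin l * lin l - smult \<epsilon> [:1, 0, 1:]) + smult \<epsilon> (lin l * M))"
      have "\<forall>\<^sub>F \<epsilon> in at_right 0. \<exists>X c. finite X \<and> X \<subseteq> cnode \<and> card X = Suc (card S) \<and> c \<noteq> 0 \<and>
          Q \<epsilon> = smult c (lprod (mset_set X))"
        unfolding Q_def by (rule double_root_splits[OF S l]) (use dM in \<open>simp add: n_def\<close>)
      from eventually_happens[OF this] obtain \<epsilon> X c where X: "finite X" "X \<subseteq> cnode" "card X = Suc n" "c \<noteq> 0"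
        "Q \<epsilon> = smult c (lprod (mset_set X))"
        by (auto simp: n_def)
      have id: "b * (k * (f * f - smult \<epsilon> E) + smult \<epsilon> (f * m)) =
          (f * b) * (f * k) + smult \<epsilon> (- (b * k * E) + (f * b) * m)"
        for b k f E m :: "real poly" by (simp add: algebra_simps smult_add_right smult_diff_right)
      have "lprod B' * Q \<epsilon> = lprod B * lprod (mset_set S) + smult \<epsilon> (k0 + lprod B * M)"
        by (simp only: Q_def B Sl k0_def lprod_add_mset id)
      moreover have "annih a r (lprod B * lprod (mset_set S) + smult \<epsilon> (k0 + lprod B * M))"
        using annN annM by (simp add: annih_def distrib_right pairing_add pairing_smult)
      ultimately have "annih a r (lprod B' * Q \<epsilon>)" by (simp only:)
      then have "annih a r (smult c (lprod B' * lprod (mset_set X)))" by (simp only: X(5) mult_smult_right)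
      then have "annih a r (lprod (B' + mset_set X))"
        using X(4) by (simp add: lprod_union annih_smult)
      \<comment> \<open>One copy of l has been traded for one more distinct root, against the
        maximality of N.\<close>
      then have "G (B' + mset_set X)" using X sz B setB S by (auto simp: G_def)
      then have "card (set_mset (B' + mset_set X)) \<le> n" unfolding n_def S_def by (rule max)
      moreover have "card X \<le> card (set_mset (B' + mset_set X))" using X by (intro card_mono) auto
      ultimately show ?thesis using X by simp
    qed
  next
    case True
    then obtain q where q: "degree q \<le> 8 - r" "q \<noteq> 0"
      and q0: "\<And>M. degree M \<le> n \<Longrightarrow> pairing a (lprod B * q * M) = 0" by blast
    \<comment> \<open>Since \<open>size B + n = r\<close>, this is 8 minus the degree of B, the
      largest degree in which B p can be paired with a.\<close>
    define e where "e = (8 - r) + n"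
    obtain c where c: "\<And>p. degree p \<le> e \<Longrightarrow> pairing a (lprod B * p) = (\<Sum>v\<in>S. c v * heval e p v)"
    proof -
      have "\<exists>c. \<forall>p. degree p \<le> e \<longrightarrow> pairing a (lprod B * p) = (\<Sum>v\<in>S. c v * heval e p v)"
      proof (rule quadrature[OF S])
        fix k :: "real poly" assume "degree k \<le> e - card S"
        then have "pairing a ((lprod B * lprod (mset_set S)) * k) = 0"
          by (intro annih_pairing[OF annN]) (simp add: e_def n_def)
        then show "pairing a (lprod B * (lprod (mset_set S) * k)) = 0" by (simp add: mult.assoc)
      qed (simp add: e_def n_def)
      then show thesis using that by blast
    qed
    have cq: "c v * heval (8 - r) q v = 0" if v: "v \<in> S" for v
    proof -
      obtain p where p: "degree p \<le> n" "heval n p v = 1" "\<forall>w\<in>S - {v}. heval n p w = 0"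
        using lagrange_basis[OF S v, of n] by (auto simp: n_def)
      have "0 = pairing a (lprod B * (q * p))" using q0[OF p(1)] by (simp add: mult.assoc)
      also have "\<dots> = (\<Sum>w\<in>S. c w * heval e (q * p) w)"
        using degree_mult_le[of q p] q p by (intro c) (simp add: e_def)
      also have "\<dots> = (\<Sum>w\<in>S. if w = v then c v * heval (8 - r) q v else 0)"
        unfolding e_def by (intro sum.cong refl) (subst heval_mult, use q p in auto)
      finally show ?thesis using S v by simp
    qed
    define I where "I = {v \<in> S. c v \<noteq> 0}"
    have I: "finite I" "I \<subseteq> S" using S by (auto simp: I_def)
    have cI: "card I \<le> 8 - r"
    proof (rule ccontr)
      assume "\<not> ?thesis"
      then have "q = 0" using heval_zeros_eq_0[of I q "8 - r"] I S q cq by (auto simp: I_def)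
      then show False using q by simp
    qed
    have In: "card I \<le> n" using I S by (simp add: n_def card_mono)
    define H where "H = B + mset_set I"
    have sH: "size H = size B + card I" by (simp add: H_def)
    have Hc: "set_mset H \<subseteq> cnode" using setB I S by (auto simp: H_def)
    have annH: "annih a (size H) (lprod H)" unfolding annih_iff
    proof (intro allI impI)
      fix k :: "real poly" assume k: "degree k \<le> 8 - size H"
      have e2: "e = card I + (8 - size H)" using sz sH In r by (simp add: e_def)
      have dI: "degree (lprod (mset_set I)) \<le> card I" using degree_lprod[of "mset_set I"] by simp
      have "pairing a (lprod B * (lprod (mset_set I) * k)) = (\<Sum>v\<in>S. c v * heval e (lprod (mset_set I) * k) v)"
        using degree_mult_le[of "lprod (mset_set I)" k] dI k e2 by (intro c) simp
      also have "\<dots> = 0"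
      proof (intro sum.neutral ballI)
        fix v assume v: "v \<in> S"
        have "heval e (lprod (mset_set I) * k) v = (\<Prod>u\<in>I. ndet u v) * heval (8 - size H) k v"
          unfolding e2 by (subst heval_mult[OF dI k]) (simp add: heval_lprod_set I)
        moreover have "(\<Prod>u\<in>I. ndet u v) = 0" if "v \<in> I" using that I
          by (auto simp: ndet_def intro!: bexI[of _ v])
        ultimately show "c v * heval e (lprod (mset_set I) * k) v = 0" using v
          by (cases "v \<in> I") (auto simp: I_def)
      qed
      finally show "pairing a (lprod H * k) = 0" by (simp add: H_def lprod_union mult.assoc)
    qed
    \<comment> \<open>Fresh simple roots bring H back to degree r. As the total number of distinct
      roots cannot exceed n by maximality, H has at most \<open>card I\<close> of them.\<close>
    obtain T where T: "finite T" "card T = n - card I" "T \<subseteq> cnode - set_mset H"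
      using infinite_arbitrarily_large[of "cnode - set_mset H" "n - card I"] infinite_cnode by auto
    have "annih a (size H + card T) (lprod H * lprod (mset_set T))"
      using degree_lprod[of "mset_set T"] sz sH In r T by (intro annih_mult[OF annH]) auto
    then have "G (H + mset_set T)"
      using sz sH In T Hc by (auto simp: G_def lprod_union)
    then have "card (set_mset H \<union> T) \<le> n" using max[of "H + mset_set T"] T by (simp add: n_def S_def)
    moreover have "card (set_mset H \<union> T) = card (set_mset H) + card T" using T
      by (intro card_Un_disjoint) auto
    ultimately have "card (set_mset H) \<le> 8 - r" using T cI In by simp
    moreover have "size H \<le> r" using sz sH In by simp
    ultimately show ?thesis using annH Hc by (auto simp: Dset_def)
  qed
qed

section \<open>Closedness and density\<close>

lemma nodes_convergent_subsequence:
  fixes v :: "nat \<Rightarrow> nat \<Rightarrow> real \<times> real"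
  assumes "\<And>n j. j < r \<Longrightarrow> norm (v n j) = 1"
  shows "\<exists>\<sigma> l. strict_mono \<sigma> \<and> (\<forall>j<r. norm (l j) = 1 \<and> (\<lambda>n. v (\<sigma> n) j) \<longlonglongrightarrow> l j)"
  using assms
proof (induction r)
  case 0 show ?case by (intro exI[of _ id]) (simp add: strict_mono_def)
next
  case (Suc r)
  then obtain \<sigma> l where \<sigma>: "strict_mono \<sigma>" and l: "\<And>j. j < r \<Longrightarrow> norm (l j) = 1 \<and> (\<lambda>n. v (\<sigma> n) j) \<longlonglongrightarrow> l j"
    by (meson less_SucI)
  have "compact (sphere (0 :: real \<times> real) 1)" by simp
  moreover have "\<forall>n. v (\<sigma> n) r \<in> sphere 0 1" using Suc.prems by simp
  ultimately obtain w \<tau> where w: "w \<in> sphere 0 1" "strict_mono \<tau>" "((\<lambda>n. v (\<sigma> n) r) \<circ> \<tau>) \<longlonglongrightarrow> w"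
    unfolding compact_def by meson
  have "norm ((l(r := w)) j) = 1 \<and> (\<lambda>n. v ((\<sigma> \<circ> \<tau>) n) j) \<longlonglongrightarrow> (l(r := w)) j" if "j < Suc r" for j
  proof (cases "j = r")
    case True then show ?thesis using w by (simp add: o_def)
  next
    case False
    then have "j < r" using that by simp
    then have "(\<lambda>n. v (\<sigma> (\<tau> n)) j) \<longlonglongrightarrow> l j"
      using LIMSEQ_subseq_LIMSEQ[of "\<lambda>n. v (\<sigma> n) j" "l j" \<tau>] l w(2) by (simp add: o_def)
    then show ?thesis using False l \<open>j < r\<close> by simp
  qed
  moreover have "strict_mono (\<sigma> \<circ> \<tau>)" using \<sigma> w(2) by (rule strict_mono_o)
  ultimately show ?case by blast
qed

lemma unit_nz: "norm v = 1 \<Longrightarrow> v \<noteq> (0, 0)" for v :: "real \<times> real"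
  by (auto simp: norm_Pair)

lemma lprod_family: "lprod (image_mset v (mset_set {..<r})) = (\<Prod>j<r. lin (v j))"
  by (simp add: lprod_def prod_unfold_prod_mset multiset.map_comp o_def)

text \<open>Canonical nodes can run off to infinity, whereas unit vectors form a compact set; limits
  of annihilators are therefore taken in this normalisation.\<close>

lemma Pset_unit_nodes:
  "a \<in> Pset r \<longleftrightarrow> (\<exists>v. (\<forall>j<r. norm (v j) = 1) \<and> annih a r (\<Prod>j<r. lin (v j)))"
proof
  assume "a \<in> Pset r"
  then obtain N where N: "size N = r" "set_mset N \<subseteq> cnode" "annih a r (lprod N)" by (auto simp: Pset_def)
  obtain xs where xs: "mset xs = N" using ex_mset by blast
  then have len: "length xs = r" using N by auto
  define v where "v = (\<lambda>j. (1 / norm (xs ! j)) *\<^sub>R (xs ! j))"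
  have nz: "xs ! j \<noteq> (0, 0)" if "j < r" for j
    using that N(2) xs len cnode_nz by (metis nth_mem set_mset_mset subsetD)
  then have vn: "norm (v j) = 1" if "j < r" for j using that by (simp add: v_def zero_prod_def)
  have "lprod N = (\<Prod>j<r. lin (xs ! j))"
  proof -
    have "N = image_mset (\<lambda>j. xs ! j) (mset_set {..<r})"
      using xs len by (metis atLeast0LessThan map_nth mset_map mset_upt)
    then show ?thesis by (simp add: lprod_family)
  qed
  moreover have "lin (xs ! j) = smult (norm (xs ! j)) (lin (v j))" if "j < r" for j
    using nz[OF that] by (simp add: lin_def v_def zero_prod_def)
  ultimately have eq: "lprod N = smult (\<Prod>j<r. norm (xs ! j)) (\<Prod>j<r. lin (v j))"
    by (simp add: prod_smult)
  have "(\<Prod>j<r. norm (xs ! j)) \<noteq> 0" using nz by (simp add: zero_prod_def)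
  then have "annih a r (\<Prod>j<r. lin (v j))" using N(3) by (simp add: eq annih_smult)
  then show "\<exists>v. (\<forall>j<r. norm (v j) = 1) \<and> annih a r (\<Prod>j<r. lin (v j))" using vn by blast
next
  assume "\<exists>v. (\<forall>j<r. norm (v j) = 1) \<and> annih a r (\<Prod>j<r. lin (v j))"
  then obtain v where v: "\<And>j. j < r \<Longrightarrow> norm (v j) = 1" "annih a r (\<Prod>j<r. lin (v j))" by blast
  show "a \<in> Pset r"
    by (rule PsetI[of "image_mset v (mset_set {..<r})"]) (use v unit_nz in \<open>auto simp: lprod_family\<close>)
qed

lemma ptends_lin: "(f \<longlongrightarrow> l) F \<Longrightarrow> ptends (\<lambda>t. lin (f t)) (lin l) F"
  unfolding lin_def by (intro ptends_linear tendsto_intros)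

text \<open>This gives more than closedness: the convergent nodes themselves are returned, because
  the local obstruction later depends on how the roots cluster.\<close>

lemma Pset_limit:
  assumes "a \<longlonglongrightarrow> b" "\<And>n. a n \<in> Pset r"
  shows "\<exists>\<sigma> v l. strict_mono \<sigma> \<and> (\<forall>n. annih (a (\<sigma> n)) r (\<Prod>j<r. lin (v n j))) \<and>
    (\<forall>j<r. (\<lambda>n. v n j) \<longlonglongrightarrow> l j \<and> norm (l j) = 1) \<and> annih b r (\<Prod>j<r. lin (l j))"
proof -
  obtain w where w: "\<And>n j. j < r \<Longrightarrow> norm (w n j) = 1" "\<And>n. annih (a n) r (\<Prod>j<r. lin (w n j))"
    using assms(2) unfolding Pset_unit_nodes by metis
  obtain \<sigma> l where \<sigma>: "strict_mono \<sigma>" and l: "\<And>j. j < r \<Longrightarrow> norm (l j) = 1 \<and> (\<lambda>n. w (\<sigma> n) j) \<longlonglongrightarrow> l j"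
    using nodes_convergent_subsequence[of r w] w(1) by metis
  have "annih b r (\<Prod>j<r. lin (l j))" unfolding annih_def
  proof (intro allI impI)
    fix k assume k: "k \<le> 8 - r"
    have "(\<lambda>n. pairing (a (\<sigma> n)) ((\<Prod>j<r. lin (w (\<sigma> n) j)) * monom 1 k)) \<longlonglongrightarrow> pairing b ((\<Prod>j<r. lin (l j)) * monom 1 k)"
      by (intro tendsto_pairing ptends_mult ptends_prod ptends_lin ptends_const)
         (use l LIMSEQ_subseq_LIMSEQ[OF assms(1) \<sigma>] in \<open>auto simp: o_def\<close>)
    moreover have "pairing (a (\<sigma> n)) ((\<Prod>j<r. lin (w (\<sigma> n) j)) * monom 1 k) = 0" for n
      using w(2)[of "\<sigma> n"] k by (simp add: annih_def)
    ultimately show "pairing b ((\<Prod>j<r. lin (l j)) * monom 1 k) = 0"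
      by (simp add: LIMSEQ_const_iff)
  qed
  then show ?thesis using \<sigma> l w(2) by (intro exI[of _ \<sigma>] exI[of _ "\<lambda>n. w (\<sigma> n)"] exI[of _ l]) auto
qed

lemma closed_Pset: "closed (Pset r)"
  unfolding closed_sequential_limits
proof (intro allI impI, elim conjE)
  fix a b assume "\<forall>n. a n \<in> Pset r" "a \<longlonglongrightarrow> b"
  then obtain l where "\<And>j. j < r \<Longrightarrow> norm (l j) = 1" "annih b r (\<Prod>j<r. lin (l j))"
    using Pset_limit[of a b r] by metis
  then show "b \<in> Pset r" unfolding Pset_unit_nodes by blast
qed

text \<open>Each new vector is pushed along a direction w independent of all earlier vectors, by a
  step that avoids finitely many values. The scalars are general because the lemma serves real nodes
  as well as complex linear forms.\<close>

lemma independent_nodes_dense: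
  fixes l :: "nat \<Rightarrow> 'a::real_normed_field \<times> 'a"
  assumes "e > 0"
  shows "\<exists>l'. (\<forall>i<n. norm (l' i - l i) < e \<and> l' i \<noteq> (0, 0)) \<and> (\<forall>i<n. \<forall>j<n. i \<noteq> j \<longrightarrow> ndet (l' i) (l' j) \<noteq> 0)"
proof (induction n)
  case 0 show ?case by simp
next
  case (Suc n)
  then obtain l' where l': "\<And>i. i < n \<Longrightarrow> norm (l' i - l i) < e \<and> l' i \<noteq> (0, 0)"
    "\<And>i j. i < n \<Longrightarrow> j < n \<Longrightarrow> i \<noteq> j \<Longrightarrow> ndet (l' i) (l' j) \<noteq> 0" by blast
  have inf1: "infinite (range (of_nat :: nat \<Rightarrow> 'a))"
    by (simp add: infinite_UNIV_nat inj_of_nat finite_image_iff)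
  define bad1 where "bad1 = (\<lambda>i. snd (l' i) / fst (l' i)) ` {..<n}"
  obtain y :: 'a where y: "y \<notin> bad1" using inf1
    by (metis bad1_def ex_new_if_finite finite_imageI finite_lessThan finite_subset subset_UNIV)
  define w where "w = (1 :: 'a, y)"
  have w: "ndet (l' i) w \<noteq> 0" if i: "i < n" for i
  proof
    assume *: "ndet (l' i) w = 0"
    then have s: "snd (l' i) = fst (l' i) * y" by (simp add: ndet_def w_def)
    then have "fst (l' i) \<noteq> 0" using l'(1)[OF i] by (cases "l' i") auto
    then have "y = snd (l' i) / fst (l' i)" using s by simp
    then show False using y i by (auto simp: bad1_def)
  qed
  \<comment> \<open>For these steps the moved vector becomes proportional to an earlier one, or its
    first coordinate vanishes; avoiding the latter keeps the vector nonzero.\<close>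
  define bad where "bad = (\<lambda>i. - ndet (l' i) (l n) / ndet (l' i) w) ` {..<n} \<union> {- fst (l n)}"
  have fb: "finite bad" by (simp add: bad_def)
  \<comment> \<open>Infinitely many admissible steps; the denominator
    \<open>2 * (norm w + 1)\<close> keeps the displacement below e.\<close>
  define T where "T = (\<lambda>k::nat. of_real (e / (real k + 1) / (2 * (norm w + 1))) :: 'a) ` UNIV"
  have "infinite T"
    unfolding T_def
  proof (subst finite_image_iff)
    show "inj (\<lambda>k::nat. of_real (e / (real k + 1) / (2 * (norm w + 1))) :: 'a)"
    proof (rule injI)
      fix a b :: nat assume "(of_real (e / (real a + 1) / (2 * (norm w + 1))) :: 'a) =
          of_real (e / (real b + 1) / (2 * (norm w + 1)))"
      then have eq: "e / (real a + 1) / (2 * (norm w + 1)) = e / (real b + 1) / (2 * (norm w + 1))"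
        by (simp only: of_real_eq_iff)
      have "2 * (norm w + 1) \<noteq> 0" using add_nonneg_pos[OF norm_ge_zero[of w] zero_less_one] by auto
      then have "e / (real a + 1) = e / (real b + 1)" using eq by (simp only: divide_cancel_right simp_thms)
      then show "a = b" using assms by (simp add: field_simps)
    qed
  qed (simp add: infinite_UNIV_nat)
  then obtain t where t: "t \<in> T" "t \<notin> bad" using fb by (meson finite_subset subsetI)
  then obtain k :: nat where k: "t = of_real (e / (real k + 1) / (2 * (norm w + 1)))" by (auto simp: T_def)
  define u where "u = (fst (l n) + t * fst w, snd (l n) + t * snd w)"
  have "norm (u - l n) < e"
  proof -
    have "u - l n = (t * fst w, t * snd w)" by (simp add: u_def prod_eq_iff)
    then have "norm (u - l n) = norm t * norm w"
      by (simp add: norm_prod_def norm_mult power_mult_distrib distrib_left[symmetric] real_sqrt_mult)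
    also have "norm t = e / (real k + 1) / (2 * (norm w + 1))"
      unfolding k norm_of_real using assms norm_ge_zero[of w] by (simp add: abs_of_pos)
    also have "\<dots> * norm w \<le> e * (norm w / (2 * (norm w + 1)))"
    proof -
      have "e / (real k + 1) \<le> e" using assms by (simp add: field_simps)
      then have "e / (real k + 1) * (norm w / (2 * (norm w + 1))) \<le> e * (norm w / (2 * (norm w + 1)))"
        by (rule mult_right_mono) simp
      then show ?thesis by (simp only: times_divide_eq_left times_divide_eq_right)
    qed
    also have "\<dots> < e * 1"
    proof (rule mult_strict_left_mono[OF _ assms])
      have less: "x / (2 * (x + 1)) < 1" if "x \<ge> 0" for x :: real using that by (simp add: field_simps)
      show "norm w / (2 * (norm w + 1)) < 1" by (rule less) simp
    qed
    finally show ?thesis by simp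
  qed
  moreover have "u \<noteq> (0,0)" using t(2) by (auto simp: u_def w_def bad_def add_eq_0_iff)
  moreover have "ndet (l' i) u \<noteq> 0" if i: "i < n" for i
  proof
    assume "ndet (l' i) u = 0"
    then have "ndet (l' i) (l n) + t * ndet (l' i) w = 0" by (simp add: ndet_def u_def algebra_simps)
    then have "t = - ndet (l' i) (l n) / ndet (l' i) w" using w[OF i] by (simp add: field_simps add_eq_0_iff)
    then show False using t(2) i by (auto simp: bad_def)
  qed
  moreover have "ndet u (l' i) \<noteq> 0 \<longleftrightarrow> ndet (l' i) u \<noteq> 0" for i by (auto simp: ndet_def mult.commute)
  ultimately show ?case using l'
    by (intro exI[of _ "l'(n := u)"]) (auto simp: less_Suc_eq)
qed

text \<open>Testing q against the Lagrange polynomials of the complementary degree 8 - e isolates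
  one node at a time. As all weights are nonzero, q vanishes at every node, that is, more often than
  its degree allows.\<close>

lemma quadrature_nonsingular:
  fixes S :: "(real \<times> real) set"
  assumes S: "finite S" "S \<subseteq> cnode" and c: "\<And>v. v \<in> S \<Longrightarrow> c v \<noteq> 0" and e: "e < card S" "e + card S \<le> 9"
    and q: "degree q \<le> e" "\<And>M. degree M \<le> 8 - e \<Longrightarrow> pairing (\<Sum>v\<in>S. c v *\<^sub>R evv v) (q * M) = 0"
  shows "q = 0"
proof (rule heval_zeros_eq_0[OF S q(1) _ e(1)])
  fix v assume v: "v \<in> S"
  obtain p where p: "degree p \<le> 8 - e" "heval (8 - e) p v = 1" "\<forall>w\<in>S - {v}. heval (8 - e) p w = 0"
  proof -
    have "card S \<le> Suc (8 - e)" using e by arith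
    from lagrange_basis[OF S v this] show thesis using that by blast
  qed
  have e8: "8 = e + (8 - e)" using e by simp
  have "0 = (\<Sum>w\<in>S. c w * heval 8 (q * p) w)"
    using q(2)[OF p(1)] by (simp add: pairing_sum_left pairing_scaleR_left pairing_evv)
  also have "\<dots> = (\<Sum>w\<in>S. if w = v then c v * heval e q v else 0)"
    by (intro sum.cong refl, subst e8, subst heval_mult) (use q p in auto)
  finally show "heval e q v = 0" using S v c by simp
qed

lemma evv_scale: "c \<noteq> 0 \<Longrightarrow> evv (c * fst v, c * snd v) = c ^ 8 *\<^sub>R evv v"
proof -
  assume c: "c \<noteq> 0"
  show ?thesis by (rule pairing_eqI) (simp add: pairing_scaleR_left pairing_evv heval_scale[OF c])
qed

lemma tendsto_evv: "(v \<longlongrightarrow> l) F \<Longrightarrow> ((\<lambda>t. evv (v t)) \<longlongrightarrow> evv l) F"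
  by (rule tendsto_vec9) (auto simp: evv_def intro!: tendsto_intros)

text \<open>The linear forms are moved to pairwise independent ones and vanishing weights are
  replaced by 1 / (n + 1). Passing to canonical nodes multiplies each weight by the eighth power of
  the scaling factor.\<close>

lemma generic_decomposition_dense:
  assumes "waring_decomp 8 r a"
  shows "\<exists>b. b \<longlonglongrightarrow> a \<and> (\<forall>n. \<exists>S c. finite S \<and> S \<subseteq> cnode \<and> card S = r \<and> (\<forall>v\<in>S. c v \<noteq> 0) \<and> b n =
      (\<Sum>v\<in>S. c v *\<^sub>R evv v))"
proof -
  obtain c v where a: "a = (\<Sum>j<r. c j *\<^sub>R evv (v j))" using assms by (auto simp: waring_iff)
  have "\<forall>n. \<exists>w. (\<forall>i<r. norm (w i - v i) < inverse (real (Suc n)) \<and> w i \<noteq> (0, 0)) \<and>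
      (\<forall>i<r. \<forall>j<r. i \<noteq> j \<longrightarrow> ndet (w i) (w j) \<noteq> 0)"
    by (intro allI independent_nodes_dense) simp
  then obtain w where w: "\<And>n i. i < r \<Longrightarrow> norm (w n i - v i) < inverse (real (Suc n))"
    "\<And>n i. i < r \<Longrightarrow> w n i \<noteq> (0, 0)"
    "\<And>n i j. i < r \<Longrightarrow> j < r \<Longrightarrow> i \<noteq> j \<Longrightarrow> ndet (w n i) (w n j) \<noteq> 0" by metis
  have wl: "(\<lambda>n. w n i) \<longlonglongrightarrow> v i" if "i < r" for i
  proof -
    have "(\<lambda>n. w n i - v i) \<longlonglongrightarrow> 0"
      by (rule tendsto_0_le[OF LIMSEQ_inverse_real_of_nat, of _ 1])
         (use w(1)[OF that] in \<open>auto intro!: always_eventually less_imp_le simp del: of_nat_Suc\<close>)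
    then show ?thesis by (simp add: LIM_zero_iff)
  qed
  define d where "d = (\<lambda>n i. if c i = 0 then inverse (real (Suc n)) else c i)"
  have dl: "(\<lambda>n. d n i) \<longlonglongrightarrow> c i" for i
    using LIMSEQ_inverse_real_of_nat by (cases "c i = 0") (auto simp: d_def simp del: of_nat_Suc)
  define b where "b = (\<lambda>n. \<Sum>j<r. d n j *\<^sub>R evv (w n j))"
  have "b \<longlonglongrightarrow> a" unfolding a b_def by (intro tendsto_intros tendsto_evv dl wl) auto
  moreover have "\<exists>S c. finite S \<and> S \<subseteq> cnode \<and> card S = r \<and> (\<forall>v\<in>S. c v \<noteq> 0) \<and> b n = (\<Sum>v\<in>S. c v *\<^sub>R evv v)"
    for n
  proof -
    have "\<forall>j. \<exists>\<gamma>. j < r \<longrightarrow> \<gamma> \<noteq> 0 \<and> w n j = (\<gamma> * fst (canon (w n j)), \<gamma> * snd (canon (w n j)))"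
      using canon_scale w(2) by blast
    then obtain \<gamma> where \<gamma>: "\<And>j. j < r \<Longrightarrow> \<gamma> j \<noteq> 0 \<and> w n j =
        (\<gamma> j * fst (canon (w n j)), \<gamma> j * snd (canon (w n j)))" by metis
    define f where "f = (\<lambda>j. canon (w n j))"
    have inj: "inj_on f {..<r}"
    proof (rule inj_onI, rule ccontr)
      fix i j assume "i \<in> {..<r}" "j \<in> {..<r}" "f i = f j" "i \<noteq> j"
      then show False using ndet_canon[of "w n i" "w n j"] w(2,3) by (auto simp: f_def)
    qed
    define g where "g = (\<lambda>u. d n (the_inv_into {..<r} f u) * \<gamma> (the_inv_into {..<r} f u) ^ 8)"
    have gf: "g (f j) = d n j * \<gamma> j ^ 8" if "j < r" for j using the_inv_into_f_f[OF inj] that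
      by (simp add: g_def)
    have "evv (w n j) = \<gamma> j ^ 8 *\<^sub>R evv (f j)" if "j < r" for j
      using \<gamma>[OF that] evv_scale[of "\<gamma> j" "f j"] by (metis f_def)
    then have "b n = (\<Sum>j<r. g (f j) *\<^sub>R evv (f j))"
      unfolding b_def by (intro sum.cong refl) (simp add: gf)
    also have "\<dots> = (\<Sum>u\<in>f ` {..<r}. g u *\<^sub>R evv u)" by (simp add: sum.reindex[OF inj])
    finally have "b n = (\<Sum>u\<in>f ` {..<r}. g u *\<^sub>R evv u)" .
    moreover have "\<forall>u\<in>f ` {..<r}. g u \<noteq> 0" using gf \<gamma> by (auto simp: d_def)
    ultimately show ?thesis using inj
      by (intro exI[of _ "f ` {..<r}"] exI[of _ g]) (auto simp: card_image f_def)
  qed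
  ultimately show ?thesis by blast
qed

text \<open>From five nodes on, 8 - r is smaller than r, and the nonsingularity of the quadrature
  form yields the full rank that stability requires.\<close>

lemma generic_in_interior:
  fixes S :: "(real \<times> real) set"
  assumes S: "finite S" "S \<subseteq> cnode" "\<And>v. v \<in> S \<Longrightarrow> c v \<noteq> 0" "5 \<le> card S" "card S \<le> 8"
  shows "(\<Sum>v\<in>S. c v *\<^sub>R evv v) \<in> interior (Wset (card S))"
proof (rule stable_decomposition[OF S(1,2) refl S(5)])
  show "annih (\<Sum>v\<in>S. c v *\<^sub>R evv v) (card S) (lprod (mset_set S))" unfolding annih_iff
  proof (intro allI impI)
    fix q :: "real poly" assume q: "degree q \<le> 8 - card S"
    have "heval (card S + (8 - card S)) (lprod (mset_set S) * q) v = 0" if "v \<in> S" for v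
    proof -
      have "(\<Prod>u\<in>S. ndet u v) = 0"
        by (rule prod_zero) (use that S(1) in \<open>auto simp: ndet_def mult.commute intro!: bexI[of _ v]\<close>)
      then show ?thesis
        by (subst heval_mult) (use degree_lprod[of "mset_set S"] q S(1) in \<open>auto simp: heval_lprod_set\<close>)
    qed
    then show "pairing (\<Sum>v\<in>S. c v *\<^sub>R evv v) (lprod (mset_set S) * q) = 0"
      using S by (simp add: pairing_sum_left pairing_scaleR_left pairing_evv)
  qed
next
  fix q :: "real poly" assume "degree q \<le> 8 - card S"
    "\<And>M. degree M \<le> card S \<Longrightarrow> pairing (\<Sum>v\<in>S. c v *\<^sub>R evv v) (q * M) = 0"
  then show "q = 0" using S by (intro quadrature_nonsingular[where e = "8 - card S", OF S(1,2,3)]) auto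
qed

text \<open>Here the annihilator moves and the form follows. The equations on the form are
  independent because a linear relation between them is a polynomial q with h q = 0.\<close>

lemma annih_perturb:
  fixes g :: "'t \<Rightarrow> 'a::real_normed_field poly"
  assumes lim: "ptends g h F" and h: "h \<noteq> 0" and ann: "annih a r h" and e: "e > 0"
    and deg: "\<And>t. degree (g t) \<le> r" "degree h \<le> r" and r: "r \<le> 8"
  shows "\<forall>\<^sub>F t in F. \<exists>x. (\<forall>i\<le>8. norm (x i - a $ of_nat i) < e) \<and> annih (vec_of x) r (g t)"
proof -
  have "\<forall>\<^sub>F t in F. \<exists>x. (\<forall>i<9. norm (x i - a $ of_nat i) < e) \<and>
      (\<forall>k<Suc (8 - r). (\<Sum>i<9. coeff (g t * monom 1 k) i * x i) = 0)"
  proof (rule kernel_perturbation)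
    fix c assume c: "\<forall>i<9. (\<Sum>k<Suc (8 - r). c k * coeff (h * monom 1 k) i) = 0"
    define q where "q = (\<Sum>k\<le>8 - r. monom (c k) k)"
    have dq: "degree q \<le> 8 - r" unfolding q_def
      by (intro degree_sum_le) (auto intro: order_trans[OF degree_monom_le])
    have "h * q = (\<Sum>k<Suc (8 - r). smult (c k) (h * monom 1 k))"
      by (simp add: q_def sum_distrib_left mult_smult_right[symmetric] smult_monom lessThan_Suc_atMost del: mult_smult_right)
    then have "coeff (h * q) i = (\<Sum>k<Suc (8 - r). c k * coeff (h * monom 1 k) i)" for i
      by (simp only: coeff_sum coeff_smult)
    then have "coeff (h * q) i = 0" if "i < 9" for i using c that by simp
    moreover have "degree (h * q) \<le> 8" using degree_mult_le[of h q] dq deg(2) r by linarith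
    then have "coeff (h * q) i = 0" if "\<not> i < 9" for i using that by (intro coeff_eq_0) auto
    ultimately have "h * q = 0" by (metis coeff_0 poly_eqI)
    then have "q = 0" using h by simp
    moreover have "coeff q k = c k" if "k < Suc (8 - r)" for k using that by (simp add: q_def coeff_sum)
    ultimately show "\<forall>k<Suc (8 - r). c k = 0" by (metis coeff_0)
  next
    fix i k show "((\<lambda>t. coeff (g t * monom 1 k) i) \<longlongrightarrow> coeff (h * monom 1 k) i) F"
      using ptends_mult[OF lim ptends_const[of "monom 1 k"]] by (simp add: ptends_def)
  next
    fix k assume "k < Suc (8 - r)"
    then have "pairing a (h * monom 1 k) = 0" using ann by (simp add: annih_def)
    then show "(\<Sum>i<9. coeff (h * monom 1 k) i * a $ of_nat i) = 0"
      by (simp add: pairing_def lessThan_Suc_atMost[symmetric])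
  qed (rule e)
  then show ?thesis
  proof eventually_elim
    case (elim t)
    then obtain x where x: "\<And>i. i < 9 \<Longrightarrow> norm (x i - a $ of_nat i) < e"
      "\<And>k. k < Suc (8 - r) \<Longrightarrow> (\<Sum>i<9. coeff (g t * monom 1 k) i * x i) = 0" by blast
    have "pairing (vec_of x) (g t * monom 1 k) = 0" if "k \<le> 8 - r" for k
    proof -
      have "pairing (vec_of x) (g t * monom 1 k) = (\<Sum>i\<le>8. coeff (g t * monom 1 k) i * x i)"
        unfolding pairing_def by (intro sum.cong) auto
      also have "{..8::nat} = {..<9}" by auto
      finally show ?thesis using x(2)[of k] that by simp
    qed
    then show ?case using x(1) by (intro exI[of _ x]) (auto simp: annih_def)
  qed
qed

lemma Wset_subset_Pset: "r \<le> 8 \<Longrightarrow> Wset r \<subseteq> Pset r" using waring_Pset by blast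

text \<open>The roots of the annihilator are separated slightly and the form is carried along; with
  distinct roots Sylvester's criterion gives a decomposition of the nearby form.\<close>

lemma Pset_subset_closure_Wset:
  assumes r: "r \<le> 8"
  shows "Pset r \<subseteq> closure (Wset r)"
proof
  fix a assume "a \<in> Pset r"
  then obtain v where v: "\<And>j. j < r \<Longrightarrow> norm (v j) = 1" "annih a r (\<Prod>j<r. lin (v j))"
    unfolding Pset_unit_nodes by blast
  let ?g = "\<Prod>j<r. lin (v j)"
  have "\<forall>n. \<exists>w. (\<forall>i<r. norm (w i - v i) < inverse (real (Suc n)) \<and> w i \<noteq> (0, 0)) \<and>
      (\<forall>i<r. \<forall>j<r. i \<noteq> j \<longrightarrow> ndet (w i) (w j) \<noteq> 0)"
    by (intro allI independent_nodes_dense) simp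
  then obtain w where w: "\<And>n i. i < r \<Longrightarrow> norm (w n i - v i) < inverse (real (Suc n))"
    "\<And>n i. i < r \<Longrightarrow> w n i \<noteq> (0, 0)"
    "\<And>n i j. i < r \<Longrightarrow> j < r \<Longrightarrow> i \<noteq> j \<Longrightarrow> ndet (w n i) (w n j) \<noteq> 0" by metis
  have wl: "(\<lambda>n. w n i) \<longlonglongrightarrow> v i" if "i < r" for i
  proof -
    have "(\<lambda>n. w n i - v i) \<longlonglongrightarrow> 0"
      by (rule tendsto_0_le[OF LIMSEQ_inverse_real_of_nat, of _ 1])
         (use w(1)[OF that] in \<open>auto intro!: always_eventually less_imp_le simp del: of_nat_Suc\<close>)
    then show ?thesis by (simp add: LIM_zero_iff)
  qed
  have gl: "ptends (\<lambda>n. \<Prod>j<r. lin (w n j)) ?g sequentially"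
    by (intro ptends_prod ptends_lin wl) auto
  have dg: "degree (\<Prod>j<r. lin (w n j)) \<le> r" for n
    using degree_lprod[of "image_mset (w n) (mset_set {..<r})"] by (simp add: lprod_family)
  have dg0: "degree ?g \<le> r"
    using degree_lprod[of "image_mset v (mset_set {..<r})"] by (simp add: lprod_family)
  have gnz: "?g \<noteq> 0" using lin_nz[OF unit_nz[OF v(1)]] by simp
  show "a \<in> closure (Wset r)"
    unfolding closure_approachable
  proof (intro allI impI)
    fix e :: real assume e: "e > 0"
    have "\<exists>n x. (\<forall>i\<le>8. norm (x i - a $ of_nat i) < e / 9) \<and> annih (vec_of x) r (\<Prod>j<r. lin (w n j))"
      using annih_perturb[OF gl gnz v(2), of "e / 9"] e dg r dg0 by (auto dest!: eventually_happens)
    then obtain n x where x: "\<And>i. i \<le> 8 \<Longrightarrow> norm (x i - a $ of_nat i) < e / 9"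
      "annih (vec_of x) r (\<Prod>j<r. lin (w n j))" by blast
    define N where "N = image_mset canon (image_mset (w n) (mset_set {..<r}))"
    have inj: "inj_on (\<lambda>j. canon (w n j)) {..<r}"
    proof (rule inj_onI, rule ccontr)
      fix i j assume "i \<in> {..<r}" "j \<in> {..<r}" "canon (w n i) = canon (w n j)" "i \<noteq> j"
      then show False using ndet_canon[of "w n i" "w n j"] w(2,3) by auto
    qed
    have N: "N = mset_set ((\<lambda>j. canon (w n j)) ` {..<r})"
      unfolding N_def multiset.map_comp o_def using image_mset_mset_set[OF inj] by simp
    obtain k where "k \<noteq> 0" "(\<Prod>j<r. lin (w n j)) = smult k (lprod N)"
      using lprod_canon[of "image_mset (w n) (mset_set {..<r})"] w(2) by (auto simp: lprod_family N_def)
    then have "annih (vec_of x) r (lprod N)" using x(2) by (simp add: annih_smult)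
    moreover define X where "X = (\<lambda>j. canon (w n j)) ` {..<r}"
    have X: "finite X" "X \<subseteq> cnode" "card X = r" using inj by (auto simp: X_def card_image)
    ultimately obtain k where "vec_of x = (\<Sum>v\<in>X. k v *\<^sub>R evv v)"
      using annih_distinct_decomp[OF X(1,2), of "vec_of x"] r N by (auto simp: X_def)
    then have "vec_of x \<in> Wset r" using waring_card[OF X(1)] X(3) by auto
    moreover have "dist (vec_of x) a < e"
    proof -
      have "norm (vec_of x - a) \<le> (\<Sum>k\<in>UNIV. norm ((vec_of x - a) $ k))"
        by (rule norm_le_l1_cart[unfolded real_norm_def[symmetric]])
      also have "\<dots> < (\<Sum>k\<in>(UNIV::9 set). e / 9)"
      proof (rule sum_strict_mono)
        fix k :: 9
        obtain i where "i \<le> 8" "k = of_nat i" using ex_of_nat_9 by blast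
        then show "norm ((vec_of x - a) $ k) < e / 9" using x(1) by simp
      qed auto
      finally show ?thesis by (simp add: dist_norm)
    qed
    ultimately show "\<exists>y\<in>Wset r. dist y a < e" by blast
  qed
qed

text \<open>In degree 8 annihilation is one linear condition, which some product of u^7 with a
  linear form satisfies. The exceptional set \<open>Dset 8\<close> allows no root at all and so
  contains only the form annihilated by 1, namely 0.\<close>

lemma Wset_8: "Wset 8 = UNIV"
proof -
  have "a \<in> Wset 8" for a :: "real ^ 9"
  proof -
    \<comment> \<open>The condition on \<open>v\<close> is that \<open>fst v\<close> times a_8
      equals \<open>snd v\<close> times a_7, so v = (a_7, a_8) works unless it is the zero
      vector.\<close>
    define v where "v = (if a $ of_nat 7 = 0 \<and> a $ of_nat 8 =
        0 then (1, 0) else (a $ of_nat 7, a $ of_nat 8))"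
    define N where "N = add_mset v (replicate_mset 7 (1, 0 :: real))"
    have "lprod (replicate_mset 7 (1, 0 :: real)) = monom 1 7"
      by (simp add: lprod_def lin_def monom_altdef)
    moreover have "lin v = monom (fst v) 1 - monom (snd v) 0" by (simp add: lin_def monom_Suc monom_0)
    ultimately have "lprod N = (monom (fst v) 1 - monom (snd v) 0) * monom 1 7"
      by (simp only: N_def lprod_add_mset)
    then have "lprod N = monom (fst v) 8 - monom (snd v) 7"
      by (simp add: left_diff_distrib mult_monom)
    then have "pairing a (lprod N) = fst v * a $ of_nat 8 - snd v * a $ of_nat 7"
      by (simp add: pairing_diff pairing_monom)
    also have "\<dots> = 0" by (simp add: v_def)
    finally have "annih a 8 (lprod N)" by (simp add: annih_def)
    moreover have "size N = 8" "\<forall>v\<in>#N. v \<noteq> (0,0)" by (auto simp: N_def v_def)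
    ultimately have "a \<in> Pset 8" using PsetI by blast
    then consider "a \<in> interior (Wset 8)" | "a \<in> Dset 8" using Pset_interior_or_Dset[of 8 a] by auto
    then show "a \<in> Wset 8"
    proof cases
      case 1 then show ?thesis using interior_subset by blast
    next
      case 2
      then have "annih a 0 1" by (auto simp: Dset_def)
      then have "pairing a p = 0" if "degree p \<le> 8" for p using annih_pairing[of a 0 1 p] that by simp
      then have "a = 0" by (intro pairing_eqI) (simp add: pairing_def)
      then have "waring_decomp 8 0 a" by (simp add: waring_iff)
      then show ?thesis using waring_mono by blast
    qed
  qed
  then show ?thesis by blast
qed

section \<open>Rank regions and their boundaries\<close>

lemma Omega_eq: "Omega 8 (Suc r) = Wset (Suc r) - Wset r"
proof -
  have "real_rank 8 a = Suc r \<longleftrightarrow> waring_decomp 8 (Suc r) a \<and> \<not> waring_decomp 8 r a" for a :: "real ^ 9"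
  proof
    assume *: "real_rank 8 a = Suc r"
    have "waring_decomp 8 (real_rank 8 a) a" unfolding real_rank_def
      by (rule LeastI[of _ 8]) (use Wset_8 in blast)
    moreover have "\<not> waring_decomp 8 r a" using not_less_Least[of r "\<lambda>r. waring_decomp 8 r a"] *
      by (auto simp: real_rank_def)
    ultimately show "waring_decomp 8 (Suc r) a \<and> \<not> waring_decomp 8 r a" using * by simp
  next
    assume "waring_decomp 8 (Suc r) a \<and> \<not> waring_decomp 8 r a"
    then show "real_rank 8 a = Suc r" unfolding real_rank_def
      by (intro Least_equality) (use waring_mono not_less_eq_eq in blast)+
  qed
  then show ?thesis by (auto simp: Omega_def)
qed

abbreviation Reg :: "nat \<Rightarrow> (real ^ 9) set" where "Reg r \<equiv> rank_region 8 r"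

lemma open_Reg: "open (Reg r)" by (simp add: rank_region_def)

lemma Reg_subset: "Reg (Suc r) \<subseteq> Wset (Suc r) - Wset r"
  unfolding rank_region_def Omega_eq by (rule interior_subset)

lemma Reg_superset: "r \<le> 8 \<Longrightarrow> interior (Wset (Suc r)) - Pset r \<subseteq> Reg (Suc r)"
  unfolding rank_region_def Omega_eq
  by (rule interior_maximal)
     (use interior_subset[of "Wset (Suc r)"] Wset_subset_Pset[of r] closed_Pset[of r] in \<open>auto intro: open_Diff\<close>)

lemma closure_Reg_Pset: "Suc r \<le> 8 \<Longrightarrow> closure (Reg (Suc r)) \<subseteq> Pset (Suc r)"
  using Reg_subset[of r] Wset_subset_Pset[of "Suc r"] closed_Pset by (intro closure_minimal) auto

lemma closure_Reg_interior: "closure (Reg (Suc r)) \<inter> interior (Wset r) = {}"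
proof -
  have "interior (Wset r) \<inter> Reg (Suc r) = {}"
    using Reg_subset[of r] interior_subset[of "Wset r"] by blast
  then show ?thesis using open_Int_closure_eq_empty[OF open_interior] by blast
qed

text \<open>The point is approximated by sums of r + 1 eighth powers with distinct nodes and nonzero
  weights. These are interior to \<open>Wset (Suc r)\<close>, and they avoid \<open>Pset r\<close>:
  near a because that set is closed, and for r = 4 because such a sum of five powers has a
  nonsingular catalecticant in degree 4.\<close>

lemma closure_WsetI:
  assumes a: "a \<in> closure (Wset (Suc r))" and r: "4 \<le> r" "r < 8" and P: "r = 4 \<or> a \<notin> Pset r"
  shows "a \<in> closure (Reg (Suc r))"
proof -
  define U where "U = (if r = 4 then UNIV else - Pset r)"
  have U: "open U" "a \<in> U" using closed_Pset[of r] P by (auto simp: U_def)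
  show ?thesis unfolding closure_iff_nhds_not_empty
  proof (intro allI impI)
    fix A V assume V: "V \<subseteq> A" "open V" "a \<in> V"
    then obtain w where w: "w \<in> Wset (Suc r)" "w \<in> U \<inter> V"
      using a[unfolded closure_iff_nhds_not_empty, rule_format, of "U \<inter> V" "U \<inter> V"] U by auto
    obtain b where b: "b \<longlonglongrightarrow> w"
      "\<And>n. \<exists>S c. finite S \<and> S \<subseteq> cnode \<and> card S = Suc r \<and> (\<forall>v\<in>S. c v \<noteq> 0) \<and> b n = (\<Sum>v\<in>S. c v *\<^sub>R evv v)"
      using generic_decomposition_dense[of "Suc r" w] w by blast
    have "\<forall>\<^sub>F n in sequentially. b n \<in> U \<inter> V" using b(1) w U V
      by (intro topological_tendstoD) auto
    then obtain n where n: "b n \<in> U" "b n \<in> V" by (auto dest!: eventually_happens)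
    obtain S c where S: "finite S" "S \<subseteq> cnode" "card S = Suc r" "\<forall>v\<in>S. c v \<noteq> 0" "b n = (\<Sum>v\<in>S. c v *\<^sub>R evv v)"
      using b(2)[of n] by (elim exE conjE) (rule that)
    have "(\<Sum>v\<in>S. c v *\<^sub>R evv v) \<in> interior (Wset (card S))"
      by (rule generic_in_interior[OF S(1,2)]) (use S(3,4) r in auto)
    then have "b n \<in> interior (Wset (Suc r))" by (simp only: S(3,5))
    moreover have "b n \<notin> Pset r"
    proof (cases "r = 4")
      case True
      show ?thesis
      proof
        assume "b n \<in> Pset r"
        then obtain N where N: "size N = 4" "set_mset N \<subseteq> cnode" "annih (b n) 4 (lprod N)" using True
          by (auto simp: Pset_def)
        have "lprod N = 0"
        proof (rule quadrature_nonsingular[OF S(1,2)])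
          show "degree (lprod N) \<le> 4" using degree_lprod[of N] N by simp
          show "\<And>M. degree M \<le> 8 - 4 \<Longrightarrow> pairing (\<Sum>v\<in>S. c v *\<^sub>R evv v) (lprod N * M) = 0"
            using annih_pairing[OF N(3)] S(5) by simp
        qed (use S True in auto)
        then show False using lprod_nz N by blast
      qed
    next
      case False then show ?thesis using n by (simp add: U_def)
    qed
    ultimately have "b n \<in> Reg (Suc r)" using Reg_superset[of r] r by auto
    then show "Reg (Suc r) \<inter> A \<noteq> {}" using n V by blast
  qed
qed

text \<open>Regions of different rank are disjoint and open, so an interior point of the closure of
  one of them cannot be a limit of the other.\<close>

lemma two_closures_boundary:
  assumes "a \<in> closure (Reg (Suc r))" "a \<in> closure (Reg (Suc (Suc r)))"
  shows "a \<in> topo_boundary 8 (Suc r) \<inter> topo_boundary 8 (Suc (Suc r))"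
proof -
  have disj: "Reg (Suc r) \<inter> Reg (Suc (Suc r)) = {}"
    using Reg_subset[of r] Reg_subset[of "Suc r"] by blast
  have 1: "Reg (Suc r) \<inter> closure (Reg (Suc (Suc r))) = {}" "Reg (Suc (Suc r)) \<inter> closure (Reg (Suc r)) = {}"
    using open_Int_closure_eq_empty[OF open_Reg] disj by blast+
  have "a \<notin> interior (closure (Reg (Suc r)))"
  proof
    assume "a \<in> interior (closure (Reg (Suc r)))"
    moreover have "interior (closure (Reg (Suc r))) \<inter> closure (Reg (Suc (Suc r))) = {}"
      using open_Int_closure_eq_empty[OF open_interior] 1(2) interior_subset by blast
    ultimately show False using assms by blast
  qed
  moreover have "a \<notin> interior (closure (Reg (Suc (Suc r))))"
  proof
    assume "a \<in> interior (closure (Reg (Suc (Suc r))))"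
    moreover have "interior (closure (Reg (Suc (Suc r)))) \<inter> closure (Reg (Suc r)) = {}"
      using open_Int_closure_eq_empty[OF open_interior] 1(1) interior_subset by blast
    ultimately show False using assms by blast
  qed
  ultimately show ?thesis using assms by (simp add: topo_boundary_def)
qed

text \<open>Outside the exceptional sets, a limit of the region of rank r + 1 is interior to
  \<open>Wset (Suc r)\<close>. It also avoids \<open>Pset r\<close>, since it cannot be interior to
  \<open>Wset r\<close>. Both conditions are open and describe a neighbourhood that stays in the
  closure of the region. For r = 4 the second one is dropped.\<close>

lemma boundary_subset_Dset:
  assumes r: "4 \<le> r" "r < 8"
  shows "topo_boundary 8 (Suc r) \<subseteq> Dset (Suc r) \<union> (if r = 4 then {} else Dset r)"
proof
  fix a :: "real ^ 9" assume a: "a \<in> topo_boundary 8 (Suc r)"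
  show "a \<in> Dset (Suc r) \<union> (if r = 4 then {} else Dset r)"
  proof (rule ccontr)
    assume neg: "\<not> ?thesis"
    have ac: "a \<in> closure (Reg (Suc r))" using a by (simp add: topo_boundary_def)
    then have iW: "a \<in> interior (Wset (Suc r))"
      using closure_Reg_Pset[of r] Pset_interior_or_Dset[of "Suc r" a] neg r by auto
    define V where "V = interior (Wset (Suc r)) \<inter> (if r = 4 then UNIV else - Pset r)"
    have "open V" using closed_Pset[of r] by (auto simp: V_def)
    moreover have "a \<in> V"
    proof (cases "r = 4")
      case False
      have "a \<notin> interior (Wset r)" using ac closure_Reg_interior by blast
      then have "a \<notin> Pset r" using Pset_interior_or_Dset[of r a] neg False r by auto
      then show ?thesis using iW False by (simp add: V_def)
    qed (use iW in \<open>simp add: V_def\<close>)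
    moreover have "V \<subseteq> closure (Reg (Suc r))"
    proof
      fix b assume "b \<in> V"
      then show "b \<in> closure (Reg (Suc r))"
        using interior_subset[of "Wset (Suc r)"] closure_subset[of "Wset (Suc r)"] r
        by (intro closure_WsetI) (auto simp: V_def split: if_splits)
    qed
    ultimately have "a \<in> interior (closure (Reg (Suc r)))" by (meson interiorI)
    then show False using a by (simp add: topo_boundary_def)
  qed
qed

lemma Dset_8: "Dset 8 \<subseteq> Dset 7"
proof
  fix a assume "a \<in> Dset 8"
  then have "annih a 0 1" by (auto simp: Dset_def)
  then show "a \<in> Dset 7" unfolding Dset_def by (intro CollectI exI[of _ "{#}"]) simp
qed

text \<open>Adding an eighth power to a form of rank at most r gives rank at most r + 1, and this
  passes to limits; outside \<open>Pset r\<close> the limit is approached through the open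
  region.\<close>

lemma perturbed_closure:
  assumes a: "a \<in> Pset r" and r: "5 \<le> r" "r < 8" and n: "a + t *\<^sub>R evv w \<notin> Pset r"
  shows "a + t *\<^sub>R evv w \<in> closure (Reg (Suc r))"
proof (rule closure_WsetI)
  have "a \<in> closure (Wset r)" using a Pset_subset_closure_Wset[of r] r by auto
  then obtain x where x: "\<And>n. x n \<in> Wset r" "x \<longlonglongrightarrow> a" by (auto simp: closure_sequential)
  have "x n + t *\<^sub>R evv w \<in> Wset (Suc r)" for n
  proof -
    obtain c v where cv: "x n = (\<Sum>j<r. c j *\<^sub>R evv (v j))" using x(1)[of n] by (auto simp: waring_iff)
    have "(\<Sum>j<r. (c(r := t)) j *\<^sub>R evv ((v(r := w)) j)) = (\<Sum>j<r. c j *\<^sub>R evv (v j))" by (intro sum.cong) auto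
    then have "x n + t *\<^sub>R evv w = (\<Sum>j<Suc r. (c(r := t)) j *\<^sub>R evv ((v(r := w)) j))"
      by (simp add: cv)
    then show ?thesis unfolding mem_Collect_eq waring_iff by blast
  qed
  moreover have "(\<lambda>n. x n + t *\<^sub>R evv w) \<longlonglongrightarrow> a + t *\<^sub>R evv w" by (intro tendsto_intros x)
  ultimately show "a + t *\<^sub>R evv w \<in> closure (Wset (Suc r))" unfolding closure_sequential
    by (intro exI[of _ "\<lambda>n. x n + t *\<^sub>R evv w"]) auto
qed (use r n in auto)

text \<open>The point b is itself a limit of rank r, and the perturbed points, which tend to b, are
  limits of rank r + 1.\<close>

lemma boundary_pointI:
  assumes r: "5 \<le> r" "r < 8" and b: "b \<in> Pset r" "r = 5 \<or> b \<notin> Pset (r - 1)"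
    and pert: "\<And>n::nat. b - (\<delta> / real (Suc n)) *\<^sub>R evv w \<notin> Pset r"
  shows "b \<in> topo_boundary 8 r \<inter> topo_boundary 8 (Suc r)"
proof -
  obtain s where s: "r = Suc s" using r by (cases r) auto
  have "b \<in> closure (Reg (Suc s))"
    using b Pset_subset_closure_Wset[of r] r s by (intro closure_WsetI) auto
  moreover have "b \<in> closure (Reg (Suc r))"
  proof -
    have "b + (- \<delta> / real (Suc n)) *\<^sub>R evv w \<in> closure (Reg (Suc r))" for n
      by (rule perturbed_closure[OF b(1) r]) (use pert[of n] in simp)
    moreover have "(\<lambda>n. b + (- \<delta> / real (Suc n)) *\<^sub>R evv w) \<longlonglongrightarrow> b + 0 *\<^sub>R evv w"
      using LIMSEQ_inverse_real_of_nat[THEN tendsto_mult_right, of "- \<delta>"]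
      by (intro tendsto_intros) (simp add: divide_inverse mult.commute)
    ultimately show ?thesis
      using closed_sequentially[OF closed_closure, of "\<lambda>n. b + (- \<delta> / real (Suc n)) *\<^sub>R evv w"] by auto
  qed
  ultimately show ?thesis using two_closures_boundary[of b s] s by auto
qed

section \<open>A local obstruction to real-rootedness\<close>

lemma coeff_linear_mult_Suc: "coeff ([:a, b:] * p) (Suc k) = a * coeff p (Suc k) + b * coeff p k"
  for a :: "'a::comm_ring_1" by simp

lemma coeff_linear_mult_0: "coeff ([:a, b:] * p) 0 = a * coeff p 0"
  for a :: "'a::comm_ring_1" by (simp add: coeff_mult)

text \<open>Up to sign the coefficients are the elementary symmetric functions of the \<tau>. Each
  new root doubles the constant, and from degree 3 on a further factor of size \<eta> is gained,
  which makes these terms negligible against the sum of squares.\<close>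

lemma cluster_coeffs:
  fixes \<tau> :: "'i \<Rightarrow> real"
  assumes "finite I" "\<And>i. i \<in> I \<Longrightarrow> \<bar>\<tau> i\<bar> \<le> \<eta>" "\<eta> \<le> 1"
  shows "coeff (\<Prod>i\<in>I. [:1, - \<tau> i:]) 0 = 1 \<and> coeff (\<Prod>i\<in>I. [:1, - \<tau> i:]) 1 = - (\<Sum>i\<in>I. \<tau> i) \<and>
    coeff (\<Prod>i\<in>I. [:1, - \<tau> i:]) 2 = ((\<Sum>i\<in>I. \<tau> i)\<^sup>2 - (\<Sum>i\<in>I. (\<tau> i)\<^sup>2)) / 2 \<and>
    \<bar>coeff (\<Prod>i\<in>I. [:1, - \<tau> i:]) 2\<bar> \<le> 2 ^ card I * (\<Sum>i\<in>I. (\<tau> i)\<^sup>2) \<and>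
    (\<forall>k\<ge>3. \<bar>coeff (\<Prod>i\<in>I. [:1, - \<tau> i:]) k\<bar> \<le> 2 ^ card I * (\<eta> * (\<Sum>i\<in>I. (\<tau> i)\<^sup>2)))"
  using assms
proof (induction I rule: finite_induct)
  case empty show ?case by simp
next
  case (insert x I)
  define P where "P = (\<Prod>i\<in>I. [:1, - \<tau> i:])"
  define S where "S = (\<Sum>i\<in>I. (\<tau> i)\<^sup>2)"
  define s where "s = (\<Sum>i\<in>I. \<tau> i)"
  define t where "t = \<tau> x"
  define m where "m = (2::real) ^ card I"
  have m: "m \<ge> 1" "real (card I) \<le> m" unfolding m_def
    using one_le_power[of "2::real"] less_imp_le[OF of_nat_less_two_power[of "card I"]] by auto
  have S: "S \<ge> 0" by (simp add: S_def sum_nonneg)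
  have t: "\<bar>t\<bar> \<le> \<eta>" "\<eta> \<le> 1" "0 \<le> \<eta>"
  proof -
    show "\<bar>t\<bar> \<le> \<eta>" "\<eta> \<le> 1" using insert.prems by (auto simp: t_def)
    then show "0 \<le> \<eta>" using abs_ge_zero[of t] by linarith
  qed
  have IH: "coeff P 0 = 1" "coeff P 1 = - s" "coeff P 2 = (s\<^sup>2 - S) / 2" "\<bar>coeff P 2\<bar> \<le> m * S"
    "\<And>k. k \<ge> 3 \<Longrightarrow> \<bar>coeff P k\<bar> \<le> m * (\<eta> * S)"
    using insert.IH insert.prems unfolding P_def S_def s_def m_def by auto
  have eq: "(\<Prod>i\<in>insert x I. [:1, - \<tau> i:]) = [:1, -t:] * P" using insert.hyps by (simp add: P_def t_def)
  have c0: "coeff ([:1, -t:] * P) 0 = 1" using IH by (simp add: coeff_mult)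
  have c1: "coeff ([:1, -t:] * P) 1 = - (t + s)" unfolding One_nat_def coeff_linear_mult_Suc using IH by simp
  have c2: "coeff ([:1, -t:] * P) 2 = coeff P 2 + t * s" unfolding numeral_2_eq_2 coeff_linear_mult_Suc
    using IH by (simp add: numeral_2_eq_2)
  have c2': "coeff P 2 + t * s = ((t + s)\<^sup>2 - (t\<^sup>2 + S)) / 2" unfolding IH
    by (simp add: power2_eq_square field_simps)
  have ts: "\<bar>t * s\<bar> \<le> m * t\<^sup>2 + S"
  proof -
    have "\<bar>t * s\<bar> \<le> (\<Sum>i\<in>I. \<bar>t * \<tau> i\<bar>)" unfolding s_def sum_distrib_left by (rule sum_abs)
    also have "\<dots> \<le> (\<Sum>i\<in>I. t\<^sup>2 + (\<tau> i)\<^sup>2)"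
    proof (rule sum_mono)
      fix i
      have "0 \<le> (\<bar>t\<bar> - \<bar>\<tau> i\<bar>)\<^sup>2" by simp
      then have "2 * \<bar>t * \<tau> i\<bar> \<le> t\<^sup>2 + (\<tau> i)\<^sup>2" by (simp add: power2_diff abs_mult)
      then show "\<bar>t * \<tau> i\<bar> \<le> t\<^sup>2 + (\<tau> i)\<^sup>2" using abs_ge_zero[of "t * \<tau> i"] by linarith
    qed
    also have "\<dots> = real (card I) * t\<^sup>2 + S" by (simp add: sum.distrib S_def)
    also have "\<dots> \<le> m * t\<^sup>2 + S" using mult_right_mono[OF m(2), of "t\<^sup>2"] by simp
    finally show ?thesis .
  qed
  have mS: "S \<le> m * S" using mult_right_mono[OF m(1) S] by simp
  have c2b: "\<bar>coeff ([:1, -t:] * P) 2\<bar> \<le> 2 * m * (t\<^sup>2 + S)"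
  proof -
    have "\<bar>coeff P 2 + t * s\<bar> \<le> m * S + (m * t\<^sup>2 + S)" using IH(4) ts by linarith
    moreover have "0 \<le> m * t\<^sup>2" using m by simp
    ultimately show ?thesis unfolding c2 using mS by (simp add: algebra_simps)
  qed
  have ck: "\<bar>coeff ([:1, -t:] * P) k\<bar> \<le> 2 * m * (\<eta> * (t\<^sup>2 + S))" if k: "k \<ge> 3" for k
  proof -
    obtain k' where k': "k = Suc k'" "k' \<ge> 2" using k by (cases k) auto
    have eS: "\<eta> * S \<le> S" using mult_right_mono[OF t(2) S] by simp
    have "\<bar>coeff P k'\<bar> \<le> m * S"
    proof (cases "k' = 2")
      case False
      then have "\<bar>coeff P k'\<bar> \<le> m * (\<eta> * S)" using IH(5) k' by simp
      also have "\<dots> \<le> m * S" using eS m by (intro mult_left_mono) auto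
      finally show ?thesis .
    qed (use IH in simp)
    then have "\<bar>t\<bar> * \<bar>coeff P k'\<bar> \<le> \<eta> * (m * S)" using t by (intro mult_mono) auto
    moreover have "\<bar>coeff P k\<bar> \<le> m * (\<eta> * S)" using IH(5) k by simp
    moreover have "\<bar>coeff ([:1, -t:] * P) k\<bar> \<le> \<bar>coeff P k\<bar> + \<bar>t\<bar> * \<bar>coeff P k'\<bar>"
      unfolding k'(1) coeff_linear_mult_Suc using abs_triangle_ineq4[of "coeff P (Suc k')" "t * coeff P k'"]
        by (simp add: abs_mult)
    moreover have "0 \<le> m * (\<eta> * t\<^sup>2)" using m t by simp
    ultimately show ?thesis by (simp add: algebra_simps)
  qed
  have sums: "(\<Sum>i\<in>insert x I. \<tau> i) = t + s" "(\<Sum>i\<in>insert x I. (\<tau> i)\<^sup>2) = t\<^sup>2 + S"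
    "2 ^ card (insert x I) = 2 * m"
    using insert.hyps by (auto simp: t_def s_def S_def m_def)
  show ?case unfolding eq sums using c0 c1 c2 c2' c2b ck by auto
qed

lemma homp_prod_linear:
  assumes "finite J"
  shows "homp (card J) (\<Prod>j\<in>J. [:a j, b j:]) A B = (\<Prod>j\<in>J. smult (a j) A + smult (b j) B) \<and>
      degree (\<Prod>j\<in>J. [:a j, b j:]) \<le> card J"
  using assms
proof (induction J rule: finite_induct)
  case empty show ?case by (simp add: homp_def)
next
  case (insert x J)
  have "homp (1 + card J) ([:a x, b x:] * (\<Prod>j\<in>J. [:a j, b j:])) A B =
      homp 1 [:a x, b x:] A B * homp (card J) (\<Prod>j\<in>J. [:a j, b j:]) A B"
    by (rule homp_mult) (use insert.IH in auto)
  moreover have "homp 1 [:a x, b x:] A B = smult (a x) A + smult (b x) B" by (simp add: homp_def)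
  moreover have "degree ([:a x, b x:] * (\<Prod>j\<in>J. [:a j, b j:])) \<le> Suc (card J)"
    using degree_mult_le[of "[:a x, b x:]" "\<Prod>j\<in>J. [:a j, b j:]"] insert.IH by (simp split: if_splits)
  ultimately show ?case using insert by simp
qed

text \<open>The substitution exchanges the two variables and hence the points 0 and infinity, so a
  cluster at infinity can be treated like one at 0.\<close>

lemma coeff_homp_rev: "t \<le> d \<Longrightarrow> coeff (homp d p [:0, 1:] 1) t = coeff p (d - t)"
  for p :: "'a::comm_ring_1 poly"
proof -
  assume t: "t \<le> d"
  have "[:0, 1:] ^ k = (monom 1 k :: 'a poly)" for k by (simp add: monom_altdef)
  then have "coeff (homp d p [:0, 1:] 1) t = (\<Sum>i\<le>d. if i = d - t then coeff p i else 0)"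
    unfolding homp_def coeff_sum using t by (intro sum.cong) auto
  then show ?thesis using t by simp
qed

text \<open>For roots summing to 0 the second elementary symmetric function is -1/2 times the sum of squares, and
it dominates all higher ones; hence the coefficient of index m - 1 determines the sign.\<close>

lemma cluster_sum_nonpos:
  fixes \<rho> :: "nat \<Rightarrow> 'i \<Rightarrow> real"
  assumes J: "finite J" "card J = Suc m" "m \<ge> 1"
    and \<rho>: "\<And>j. j \<in> J \<Longrightarrow> (\<lambda>n. \<rho> n j) \<longlonglongrightarrow> 0" "\<And>n. (\<Sum>j\<in>J. \<rho> n j) = 0"
    and Y: "ptends Y Y0 sequentially" "coeff Y0 0 = 1"
    and \<alpha>: "\<And>i. i < m \<Longrightarrow> (\<lambda>n. \<alpha> n i) \<longlonglongrightarrow> \<alpha>0 i" "\<alpha>0 (m - 1) > 0"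
  shows "\<forall>\<^sub>F n in sequentially. (\<Sum>i<m. \<alpha> n i * coeff ((\<Prod>j\<in>J. [:- \<rho> n j, 1:]) * Y n) i) \<le> 0"
proof -
  define c where "c = (\<lambda>n. \<Prod>j\<in>J. [:- \<rho> n j, 1:])"
  define \<eta> where "\<eta> = (\<lambda>n. \<Sum>j\<in>J. \<bar>\<rho> n j\<bar>)"
  define S where "S = (\<lambda>n. \<Sum>j\<in>J. (\<rho> n j)\<^sup>2)"
  have \<eta>0: "\<eta> \<longlonglongrightarrow> 0" unfolding \<eta>_def using tendsto_sum[OF tendsto_rabs[OF \<rho>(1)]] by simp
  have crev: "coeff (c n) i = coeff (\<Prod>j\<in>J. [:1, - \<rho> n j:]) (Suc m - i)" if "i \<le> Suc m" for n i
  proof -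
    have "homp (Suc m) (\<Prod>j\<in>J. [:1, - \<rho> n j:]) [:0,1:] 1 = (\<Prod>j\<in>J. smult 1 [:0,1:] + smult (- \<rho> n j) 1)"
      using homp_prod_linear[OF J(1), of "\<lambda>_. 1" "\<lambda>j. - \<rho> n j"] J(2) by simp
    also have "\<dots> = c n" unfolding c_def by (intro prod.cong refl) (simp add: one_pCons)
    finally show ?thesis using coeff_homp_rev[OF that] by metis
  qed
  \<comment> \<open>The coefficients divided by the sum of squares S. If S vanishes, the bound makes
    the coefficient vanish as well, so that coefficient = S d holds without exception; in the limit
    only the index m - 1 contributes, with -1/2.\<close>
  define d where "d = (\<lambda>n i. if i = m - 1 then - 1 / 2 else coeff (c n) i / S n)"
  have ev1: "\<forall>\<^sub>F n in sequentially. \<eta> n \<le> 1" using order_tendstoD(2)[OF \<eta>0, of 1]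
    by (auto elim: eventually_mono)
  have bnd: "coeff (c n) (m - 1) = - S n / 2 \<and> (\<forall>i<m - 1. \<bar>coeff (c n) i\<bar> \<le> 2 ^ Suc m * (\<eta> n * S n))"
    if "\<eta> n \<le> 1" for n
  proof -
    have "\<bar>\<rho> n j\<bar> \<le> \<eta> n" if "j \<in> J" for j unfolding \<eta>_def
      using J(1) that by (intro member_le_sum) auto
    from cluster_coeffs[of J "\<rho> n" "\<eta> n", OF J(1) this \<open>\<eta> n \<le> 1\<close>]
    have *: "coeff (\<Prod>j\<in>J. [:1, - \<rho> n j:]) 2 = - S n / 2"
      "\<And>k. k \<ge> 3 \<Longrightarrow> \<bar>coeff (\<Prod>j\<in>J. [:1, - \<rho> n j:]) k\<bar> \<le> 2 ^ Suc m * (\<eta> n * S n)"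
      using \<rho>(2) J(2) by (auto simp: S_def)
    have "Suc m - (m - 1) = 2" using J(3) by simp
    then show ?thesis using * crev[of "m - 1" n] crev[of _ n] by auto
  qed
  have cS: "coeff (c n) i = S n * d n i" if "\<eta> n \<le> 1" "i < m" for n i
  proof (cases "i = m - 1")
    case True then show ?thesis using bnd[OF that(1)] by (simp add: d_def)
  next
    case False
    then have "\<bar>coeff (c n) i\<bar> \<le> 2 ^ Suc m * (\<eta> n * S n)" using bnd[OF that(1)] that(2) by auto
    then have "S n = 0 \<Longrightarrow> coeff (c n) i = 0" by simp
    then show ?thesis using False by (auto simp: d_def)
  qed
  have dl: "(\<lambda>n. d n i) \<longlonglongrightarrow> (if i = m - 1 then - 1 / 2 else 0)" if "i < m" for i
  proof (cases "i = m - 1")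
    case False
    have "(\<lambda>n. 2 ^ Suc m * \<eta> n) \<longlonglongrightarrow> 2 ^ Suc m * 0" by (intro tendsto_intros \<eta>0)
    then have l0: "(\<lambda>n. 2 ^ Suc m * \<eta> n) \<longlonglongrightarrow> 0" by simp
    have "\<forall>\<^sub>F n in sequentially. norm (d n i) \<le> norm (2 ^ Suc m * \<eta> n) * 1"
      using ev1
    proof eventually_elim
      case (elim n)
      have e0: "\<eta> n \<ge> 0" "S n \<ge> 0" by (auto simp: \<eta>_def S_def sum_nonneg)
      have "\<bar>coeff (c n) i\<bar> \<le> (2 ^ Suc m * \<eta> n) * S n" using bnd[OF elim] False that
        by (auto simp: mult.assoc)
      then have "\<bar>coeff (c n) i\<bar> / S n \<le> 2 ^ Suc m * \<eta> n" using e0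
        by (cases "S n = 0") (auto simp: divide_le_eq)
      then show ?case using False e0 by (simp add: d_def abs_mult)
    qed
    from tendsto_0_le[OF l0 this] show ?thesis using False by simp
  qed (simp add: d_def)
  \<comment> \<open>The sum in question divided by S; its limit is negative, and multiplying by S,
    which is at least 0, gives the claim.\<close>
  define q where "q = (\<lambda>n. \<Sum>i<m. \<alpha> n i * (\<Sum>t\<le>i. d n t * coeff (Y n) (i - t)))"
  have ql: "q \<longlonglongrightarrow> (\<Sum>i<m. \<alpha>0 i * (\<Sum>t\<le>i. (if t = m - 1 then - 1 / 2 else 0) * coeff Y0 (i - t)))"
    unfolding q_def using Y(1) by (intro tendsto_intros \<alpha> dl) (auto simp: ptends_def)
  have "(\<Sum>i<m. \<alpha>0 i * (\<Sum>t\<le>i. (if t = m - 1 then - 1 / 2 else 0) * coeff Y0 (i - t))) =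
      (\<Sum>i<m. if i = m - 1 then - \<alpha>0 (m - 1) / 2 else 0)"
  proof (intro sum.cong refl)
    fix i assume i: "i \<in> {..<m}"
    have "(\<Sum>t\<le>i. (if t = m - 1 then - 1 / 2 else 0) * coeff Y0 (i - t)) = (\<Sum>t\<le>i. if t =
        m - 1 then - 1 / 2 * coeff Y0 (i - t) else 0)"
      by (intro sum.cong) auto
    also have "\<dots> = (if m - 1 \<le> i then - 1 / 2 * coeff Y0 (i - (m - 1)) else 0)" by (simp add: sum.delta)
    finally show "\<alpha>0 i * (\<Sum>t\<le>i. (if t = m - 1 then - 1 / 2 else 0) * coeff Y0 (i - t)) = (if i =
        m - 1 then - \<alpha>0 (m - 1) / 2 else 0)"
      using i Y(2) by auto
  qed
  also have "\<dots> = - \<alpha>0 (m - 1) / 2" using J(3) by simp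
  finally have "q \<longlonglongrightarrow> - \<alpha>0 (m - 1) / 2" using ql by simp
  then have "\<forall>\<^sub>F n in sequentially. q n < 0" using \<alpha>(2) by (intro order_tendstoD) auto
  then show ?thesis using ev1
  proof eventually_elim
    case (elim n)
    have "(\<Sum>i<m. \<alpha> n i * coeff (c n * Y n) i) = (\<Sum>i<m. \<alpha> n i * (\<Sum>t\<le>i. S n * d n t * coeff (Y n) (i - t)))"
      unfolding coeff_mult using cS[OF elim(2)] by (intro sum.cong refl arg_cong2[where f = "(*)"]) auto
    also have "\<dots> = S n * q n" unfolding q_def by (simp add: sum_distrib_left mult_ac)
    also have "\<dots> \<le> 0" using elim by (intro mult_nonneg_nonpos) (auto simp: S_def sum_nonneg)
    finally show ?case by (simp only: c_def)
  qed
qed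

text \<open>The multiplicity mi of the root at infinity does not appear in the polynomial; it is
  carried by the nominal degree m0 + mi + m1.\<close>

definition gpoly :: "nat \<Rightarrow> nat \<Rightarrow> 'a::comm_ring_1 poly" where
  "gpoly m0 m1 = monom 1 m0 * [:-1, 1:] ^ m1"

text \<open>The forms annihilated by \<open>gpoly m0 m1\<close>, regarded as a form with roots of multiplicity m0 at 0, mi at
infinity and m1 at 1.\<close>

definition constant_gap :: "nat \<Rightarrow> nat \<Rightarrow> nat \<Rightarrow> 'a::zero ^ 9 \<Rightarrow> bool" where
  "constant_gap m0 mi m1 b \<longleftrightarrow> (\<exists>\<beta>. (m1 = 0 \<longrightarrow> \<beta> = 0) \<and> (\<forall>i. m0 \<le> i \<longrightarrow> i \<le> 8 - mi \<longrightarrow> b $ of_nat i = \<beta>))"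

lemma monom_mult_cancel:
  fixes A B :: "'a::comm_ring_1 poly"
  assumes "monom 1 p * A = monom 1 q * B" "coeff A 0 \<noteq> 0" "coeff B 0 \<noteq> 0"
  shows "p = q \<and> A = B"
proof -
  have c: "coeff (monom 1 p * A) i = (if p \<le> i then coeff A (i - p) else 0)" for p i and A :: "'a poly"
    by (simp add: coeff_monom_mult)
  have "p = q"
  proof (rule ccontr)
    assume "p \<noteq> q"
    then consider "p < q" | "q < p" by linarith
    then show False
    proof cases
      case 1 then show False using arg_cong[OF assms(1), of "\<lambda>x. coeff x p"] assms(2) by (simp add: c)
    next
      case 2 then show False using arg_cong[OF assms(1), of "\<lambda>x. coeff x q"] assms(3) by (simp add: c)
    qed
  qed
  moreover have "coeff A i = coeff B i" for i
    using arg_cong[OF assms(1), of "\<lambda>x. coeff x (i + p)"] \<open>p = q\<close> by (simp add: c)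
  ultimately show ?thesis by (simp add: poly_eq_iff)
qed

lemma coeff_0_prod: "coeff (prod f I) 0 = (\<Prod>i\<in>I. coeff (f i) 0)" for f :: "'i \<Rightarrow> 'a::comm_ring_1 poly"
  by (induction I rule: infinite_finite_induct) (simp_all add: coeff_mult)

text \<open>Unique factorisation: the power of u counts the nodes with \<open>snd (l j) = 0\<close>,
  the degree of the rest counts the finite nonzero roots, and what remains is at infinity. As m1 is
  at most 1, comparing the single remaining factor with u - 1 places its root at 1.\<close>

lemma limit_root_pattern:
  fixes l :: "nat \<Rightarrow> real \<times> real"
  assumes l': "\<forall>j<r. l j \<noteq> (0, 0)" and eq: "(\<Prod>j<r. lin (l j)) = smult c (gpoly m0 m1)"
    and r: "r = m0 + mi + m1" "m1 \<le> 1"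
  defines "I0 \<equiv> {j. j < r \<and> snd (l j) = 0}" and "Ii \<equiv> {j. j < r \<and> fst (l j) = 0}"
    and "I1 \<equiv> {j. j < r \<and> fst (l j) \<noteq> 0 \<and> snd (l j) \<noteq> 0}"
  shows "card I0 = m0" "card Ii = mi" "card I1 = m1" "\<And>j. j \<in> I1 \<Longrightarrow> fst (l j) = snd (l j)"
proof -
  have l: "l j \<noteq> (0, 0)" if "j < r" for j using l' that by blast
  have fin: "finite I0" "finite Ii" "finite I1" by (auto simp: I0_def Ii_def I1_def)
  have un: "{..<r} = I0 \<union> (Ii \<union> I1)" by (auto simp: I0_def Ii_def I1_def)
  have d1: "I0 \<inter> (Ii \<union> I1) = {}" "Ii \<inter> I1 = {}"
    using l by (auto simp: I0_def Ii_def I1_def prod_eq_iff)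
  have nz0: "fst (l j) \<noteq> 0" if "j \<in> I0" for j using l[of j] that by (cases "l j") (auto simp: I0_def)
  have nzi: "snd (l j) \<noteq> 0" if "j \<in> Ii" for j using l[of j] that by (cases "l j") (auto simp: Ii_def)
  have "(\<Prod>j<r. lin (l j)) = (\<Prod>j\<in>I0. lin (l j)) * ((\<Prod>j\<in>Ii. lin (l j)) * (\<Prod>j\<in>I1. lin (l j)))"
    unfolding un using fin d1 by (simp add: prod.union_disjoint)
  also have "(\<Prod>j\<in>I0. lin (l j)) = (\<Prod>j\<in>I0. smult (fst (l j)) [:0, 1:])"
    by (intro prod.cong refl) (auto simp: lin_def I0_def)
  also have "\<dots> = smult (\<Prod>j\<in>I0. fst (l j)) (monom 1 (card I0))"
    by (simp only: prod_smult prod_constant monom_altdef smult_1_left)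
  also have "(\<Prod>j\<in>Ii. lin (l j)) = (\<Prod>j\<in>Ii. smult (- snd (l j)) 1)"
    by (intro prod.cong refl) (auto simp: lin_def Ii_def)
  also have "\<dots> = smult (\<Prod>j\<in>Ii. - snd (l j)) 1" by (simp only: prod_smult prod.neutral_const)
  finally have fact: "(\<Prod>j<r. lin (l j)) =
      monom 1 (card I0) * smult ((\<Prod>j\<in>I0. fst (l j)) * (\<Prod>j\<in>Ii. - snd (l j))) (\<Prod>j\<in>I1. lin (l j))"
    by (simp add: mult_ac)
  define C where "C = (\<Prod>j\<in>I0. fst (l j)) * (\<Prod>j\<in>Ii. - snd (l j))"
  have C: "C \<noteq> 0" using nz0 nzi fin by (simp add: C_def)
  have c0: "coeff (\<Prod>j\<in>I1. lin (l j)) 0 \<noteq> 0"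
    using fin(3) by (simp add: coeff_0_prod) (auto simp: lin_def I1_def)
  have "(\<Prod>j<r. lin (l j)) \<noteq> 0" using lin_nz[OF l] by simp
  then have cn: "c \<noteq> 0" using eq by auto
  have "monom 1 (card I0) * smult C (\<Prod>j\<in>I1. lin (l j)) = monom 1 m0 * smult c ([:-1, 1:] ^ m1)"
    using eq fact by (simp add: gpoly_def C_def)
  then have eqs: "card I0 = m0" "smult C (\<Prod>j\<in>I1. lin (l j)) = smult c ([:-1, 1:] ^ m1)"
    using monom_mult_cancel[of "card I0" "smult C (\<Prod>j\<in>I1. lin (l j))" m0 "smult c ([:-1, 1:] ^ m1)"] C c0 cn
    by (auto simp: coeff_0_power)
  have "degree (smult C (\<Prod>j\<in>I1. lin (l j))) = card I1"
  proof -
    have "degree (\<Prod>j\<in>I1. lin (l j)) = (\<Sum>j\<in>I1. degree (lin (l j)))"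
      by (rule degree_prod_eq_sum_degree) (use lin_nz[OF l] in \<open>auto simp: I1_def\<close>)
    also have "\<dots> = (\<Sum>j\<in>I1. 1)" by (intro sum.cong refl) (auto simp: lin_def I1_def)
    finally show ?thesis using C by simp
  qed
  moreover have "degree (smult c ([:-1, 1:] ^ m1)) = m1" using cn by (simp add: degree_power_eq)
  ultimately have c1: "card I1 = m1" using eqs(2) by simp
  have "card {..<r} = card I0 + (card Ii + card I1)" unfolding un using fin d1 by (simp add: card_Un_disjoint)
  then show "card I0 = m0" "card Ii = mi" "card I1 = m1" using c1 eqs(1) r by auto
  fix j assume j: "j \<in> I1"
  then have "m1 = 1" using c1 r(2) fin by (metis One_nat_def card_0_eq empty_iff le_SucE le_zero_eq)
  then have "I1 = {j}" using c1 j by (metis card_1_singletonE singletonD)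
  then have "smult C (lin (l j)) = smult c [:-1, 1:]" using eqs(2) \<open>m1 = 1\<close> by simp
  then have "C * snd (l j) = c" "C * fst (l j) = c" by (auto simp: lin_def)
  then show "fst (l j) = snd (l j)" using C by (metis mult_left_cancel)
qed

text \<open>Subtracting the common value \<beta> removes the coordinates of the gap. What remains
  are two end blocks, one for each cluster, and \<beta> times the value of the polynomial at
  1.\<close>

lemma sum_split_pattern:
  fixes b p :: "nat \<Rightarrow> real"
  assumes "\<And>i. m0 \<le> i \<Longrightarrow> i \<le> 8 - mi \<Longrightarrow> b i = \<beta>" "m0 + mi \<le> 8"
  shows "(\<Sum>i\<le>8. p i * b i) =
      (\<Sum>i<m0. (b i - \<beta>) * p i) + (\<Sum>t<mi. (b (8 - t) - \<beta>) * p (8 - t)) + \<beta> * (\<Sum>i\<le>8. p i)"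
proof -
  have un: "{..8} = {..<m0} \<union> ({m0..8 - mi} \<union> {8 - mi<..8})" using assms(2) by auto
  have "(\<Sum>i\<le>8. p i * b i) - \<beta> * (\<Sum>i\<le>8. p i) = (\<Sum>i\<le>8. (b i - \<beta>) * p i)"
    by (simp add: sum_distrib_left sum_subtractf algebra_simps)
  also have "\<dots> = (\<Sum>i<m0. (b i - \<beta>) * p i) + ((\<Sum>i\<in>{m0..8 - mi}. (b i - \<beta>) * p i) + (\<Sum>i\<in>{8 - mi<..8}. (b i - \<beta>) * p i))"
    unfolding un using assms(2)
      by (subst sum.union_disjoint, simp, simp, force, subst sum.union_disjoint) auto
  also have "(\<Sum>i\<in>{m0..8 - mi}. (b i - \<beta>) * p i) = 0" using assms(1) by (intro sum.neutral) auto
  also have "(\<Sum>i\<in>{8 - mi<..8}. (b i - \<beta>) * p i) = (\<Sum>t<mi. (b (8 - t) - \<beta>) * p (8 - t))"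
    using assms(2) by (intro sum.reindex_bij_witness[of _ "\<lambda>t. 8 - t" "\<lambda>i. 8 - i"]) auto
  finally show ?thesis by simp
qed

text \<open>The additional root, with index None, makes the sum of all roots vanish.\<close>

definition centred :: "'i set \<Rightarrow> ('i \<Rightarrow> real) \<Rightarrow> 'i option \<Rightarrow> real" where
  "centred I \<rho> j = (case j of None \<Rightarrow> - (\<Sum>i\<in>I. \<rho> i) | Some i \<Rightarrow> \<rho> i)"

lemma centred_props:
  assumes "finite I"
  shows "finite (insert None (Some ` I))" "card (insert None (Some ` I)) = Suc (card I)"
    "(\<Sum>j\<in>insert None (Some ` I). centred I \<rho> j) = 0"
    "(\<Prod>j\<in>insert None (Some ` I). f (centred I \<rho> j)) = f (- (\<Sum>i\<in>I. \<rho> i)) * (\<Prod>i\<in>I. f (\<rho> i))"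
  using assms by (auto simp: card_image sum.reindex prod.reindex centred_def)

text \<open>If h annihilates the perturbed form and has its roots near 0, infinity and 1, multiply h by one
further root for each cluster: those at 0 and infinity centre the clusters, the one at 1 makes the
constant part of b drop out. The product p then has pairing at most 0 with b, whereas annihilation
forces this pairing to be \<open>\<epsilon>\<close> times the positive value of p at 2.\<close>

lemma local_obstruction:
  fixes b :: "nat \<Rightarrow> real ^ 9" and \<epsilon> :: "nat \<Rightarrow> real"
  assumes m: "1 \<le> m0" "m1 \<le> 1" "r = m0 + mi + m1" "8 - r = Suc m1 + (if mi = 0 then 0 else 1)" "r \<le> 8"
    and uniq: "\<And>v. (\<And>j. j < r \<Longrightarrow> norm (v j) = 1) \<Longrightarrow> annih b0 r (\<Prod>j<r. lin (v j)) \<Longrightarrow>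
        \<exists>c. (\<Prod>j<r. lin (v j)) = smult c (gpoly m0 m1)"
    and pos: "b0 $ of_nat (m0 - 1) > b0 $ of_nat m0" "mi > 0 \<Longrightarrow> b0 $ of_nat (9 - mi) > b0 $ of_nat m0"
    and b: "b \<longlonglongrightarrow> b0" "\<And>n. constant_gap m0 mi m1 (b n)" and \<epsilon>: "\<epsilon> \<longlonglongrightarrow> 0" "\<And>n. \<epsilon> n > 0"
    and P: "\<And>n. b n - \<epsilon> n *\<^sub>R evv (1, 2) \<in> Pset r"
  shows False
proof -
  define a where "a = (\<lambda>n. b n - \<epsilon> n *\<^sub>R evv (1, 2))"
  have "a \<longlonglongrightarrow> b0 - 0 *\<^sub>R evv (1, 2)" unfolding a_def by (intro tendsto_intros b \<epsilon>)
  then have al: "a \<longlonglongrightarrow> b0" by simp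
  obtain \<sigma> v l where \<sigma>: "strict_mono \<sigma>" and va: "\<And>n. annih (a (\<sigma> n)) r (\<Prod>j<r. lin (v n j))"
    and vl: "\<And>j. j < r \<Longrightarrow> (\<lambda>n. v n j) \<longlonglongrightarrow> l j \<and> norm (l j) = 1" and la: "annih b0 r (\<Prod>j<r. lin (l j))"
    using Pset_limit[OF al, of r] P by (auto simp: a_def)
  obtain c where c: "(\<Prod>j<r. lin (l j)) = smult c (gpoly m0 m1)" using uniq[of l] vl la by blast
  have lnz: "l j \<noteq> (0, 0)" if "j < r" for j using vl[OF that] unit_nz by blast
  define I0 where "I0 = {j. j < r \<and> snd (l j) = 0}"
  define Ii where "Ii = {j. j < r \<and> fst (l j) = 0}"
  define I1 where "I1 = {j. j < r \<and> fst (l j) \<noteq> 0 \<and> snd (l j) \<noteq> 0}"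
  have "\<forall>j<r. l j \<noteq> (0, 0)" using lnz by blast
  note pat = limit_root_pattern[OF this c m(3) m(2), folded I0_def Ii_def I1_def]
  have fin: "finite I0" "finite Ii" "finite I1" by (auto simp: I0_def Ii_def I1_def)
  have un: "{..<r} = I0 \<union> (Ii \<union> I1)" by (auto simp: I0_def Ii_def I1_def)
  have dj: "I0 \<inter> (Ii \<union> I1) = {}" "Ii \<inter> I1 = {}"
    using lnz by (auto simp: I0_def Ii_def I1_def prod_eq_iff)
  have fl: "(\<lambda>n. fst (v n j)) \<longlonglongrightarrow> fst (l j)" "(\<lambda>n. snd (v n j)) \<longlonglongrightarrow> snd (l j)" if "j < r" for j
    using vl[OF that] by (auto intro: tendsto_fst tendsto_snd)
  have nz0: "fst (l j) \<noteq> 0" if "j \<in> I0" for j using lnz[of j] that by (cases "l j") (auto simp: I0_def)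
  have nzi: "snd (l j) \<noteq> 0" if "j \<in> Ii" for j using lnz[of j] that by (cases "l j") (auto simp: Ii_def)
  define \<rho> where "\<rho> = (\<lambda>n j. snd (v n j) / fst (v n j))"
  define \<tau> where "\<tau> = (\<lambda>n j. fst (v n j) / snd (v n j))"
  have \<rho>0: "(\<lambda>n. \<rho> n j) \<longlonglongrightarrow> 0" if "j \<in> I0" for j
    using tendsto_divide[OF fl(2,1)[of j] nz0[OF that]] that by (auto simp: \<rho>_def I0_def)
  have \<tau>0: "(\<lambda>n. \<tau> n j) \<longlonglongrightarrow> 0" if "j \<in> Ii" for j
    using tendsto_divide[OF fl(1,2)[of j] nzi[OF that]] that by (auto simp: \<tau>_def Ii_def)
  have \<rho>1: "(\<lambda>n. \<rho> n j) \<longlonglongrightarrow> 1" if "j \<in> I1" for j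
    using tendsto_divide[OF fl(2,1)[of j]] that pat(4)[OF that] by (auto simp: \<rho>_def I1_def)
  define J0 where "J0 = insert None (Some ` I0)"
  \<comment> \<open>Without roots at infinity no centring root is added there, in accordance with
    the degree condition in the hypotheses.\<close>
  define Ji where "Ji = (if mi = 0 then {} else insert None (Some ` Ii))"
  define c0 where "c0 = (\<lambda>n. \<Prod>j\<in>J0. [:- centred I0 (\<rho> n) j, 1:])"
  define ci where "ci = (\<lambda>n. \<Prod>j\<in>Ji. [:1, - centred Ii (\<tau> n) j:])"
  \<comment> \<open>For m1 = 1 the second factor is a root exactly at 1, so that p(1) = 0; for m1 =
    0 the value \<beta> is 0. In both cases the third term of the splitting drops out.\<close>
  define R where "R = (\<lambda>n. (\<Prod>j\<in>I1. [:- \<rho> n j, 1:]) * [:-1, 1:] ^ m1)"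
  define p where "p = (\<lambda>n. c0 n * (ci n * R n))"
  have J0: "finite J0" "card J0 = Suc m0" "\<And>n. (\<Sum>j\<in>J0. centred I0 (\<rho> n) j) = 0"
    using centred_props[OF fin(1)] pat(1) by (auto simp: J0_def)
  have Ji: "finite Ji" "mi > 0 \<Longrightarrow> card Ji = Suc mi" "mi = 0 \<Longrightarrow> card Ji = 0"
    "\<And>n. mi > 0 \<Longrightarrow> (\<Sum>j\<in>Ji. centred Ii (\<tau> n) j) = 0"
    using centred_props[OF fin(2)] pat(2) by (auto simp: Ji_def)
  have cent0: "(\<lambda>n. centred I0 (\<rho> n) j) \<longlonglongrightarrow> 0" if "j \<in> J0" for j
    using that tendsto_minus[OF tendsto_sum[of I0 "\<lambda>i n. \<rho> n i" "\<lambda>_. 0"]] \<rho>0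
      by (auto simp: J0_def centred_def)
  have centi: "(\<lambda>n. centred Ii (\<tau> n) j) \<longlonglongrightarrow> 0" if "j \<in> Ji" for j
    using that tendsto_minus[OF tendsto_sum[of Ii "\<lambda>i n. \<tau> n i" "\<lambda>_. 0"]] \<tau>0
      by (auto simp: Ji_def centred_def split: if_splits)
  have c0l: "ptends c0 (\<Prod>j\<in>J0. [:- 0, 1:]) sequentially" unfolding c0_def
    by (intro ptends_prod ptends_linear tendsto_intros cent0)
  have cil: "ptends ci (\<Prod>j\<in>Ji. [:1, - 0:]) sequentially" unfolding ci_def
    by (intro ptends_prod ptends_linear tendsto_intros centi)
  have Rl: "ptends R ((\<Prod>j\<in>I1. [:- 1, 1:]) * [:-1, 1:] ^ m1) sequentially" unfolding R_def
    by (intro ptends_mult ptends_prod ptends_linear ptends_const tendsto_intros \<rho>1)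
  have dc0: "degree (c0 n) \<le> Suc m0" for n
    using homp_prod_linear[OF J0(1), of "\<lambda>j. - centred I0 (\<rho> n) j" "\<lambda>_. 1"] J0(2) by (simp add: c0_def)
  have dci: "degree (ci n) \<le> card Ji" for n
    using homp_prod_linear[OF Ji(1), of "\<lambda>_. 1" "\<lambda>j. - centred Ii (\<tau> n) j"] by (simp add: ci_def)
  have dX: "degree (\<Prod>j\<in>I1. [:- \<rho> n j, 1:]) \<le> m1" for n
    using homp_prod_linear[OF fin(3), of "\<lambda>j. - \<rho> n j" "\<lambda>_. 1"] pat(3) by simp
  have dm1: "degree ([:-1, 1:] ^ m1 :: real poly) \<le> m1" using degree_power_le[of "[:-1, 1:] :: real poly" m1]
    by simp
  have dR: "degree (R n) \<le> m1 + m1" for n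
    using degree_mult_le[of "\<Prod>j\<in>I1. [:- \<rho> n j, 1:]" "[:-1, 1:] ^ m1"] dX[of n] dm1 by (simp add: R_def)
  \<comment> \<open>The r roots of h and one additional root per cluster fill degree 8 exactly; this
    is what the hypothesis on 8 - r expresses.\<close>
  have tot: "Suc m0 + (card Ji + (m1 + m1)) = 8" using m Ji(2,3) by (cases "mi = 0") auto
  have dp: "degree (p n) \<le> 8" for n
    unfolding p_def using degree_mult_le[of "c0 n" "ci n * R n"] degree_mult_le[of "ci n"
      "R n"] dc0[of n] dci[of n] dR[of n] tot by linarith
  \<comment> \<open>The product of the added roots. Its degree is at most 8 - r, hence the pairing
    with h k vanishes as soon as h annihilates the perturbed form.\<close>
  define k where "k = (\<lambda>n. [:\<Sum>i\<in>I0. \<rho> n i, 1:] * ((if mi =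
      0 then 1 else [:1, \<Sum>i\<in>Ii. \<tau> n i:]) * [:-1, 1:] ^ m1))"
  have dk: "degree (k n) \<le> 8 - r" for n
  proof -
    have "degree ((if mi = 0 then 1 else [:1, \<Sum>i\<in>Ii. \<tau> n i:]) * [:-1, 1:] ^ m1) \<le> (if mi =
        0 then 0 else 1) + m1"
      using degree_mult_le[of "if mi = 0 then 1 else [:1, \<Sum>i\<in>Ii. \<tau> n i:]" "[:-1, 1:] ^ m1"] dm1
        by (auto split: if_splits)
    then show ?thesis unfolding k_def m(4)
      using degree_mult_le[of "[:\<Sum>i\<in>I0. \<rho> n i, 1:]"
        "(if mi = 0 then 1 else [:1, \<Sum>i\<in>Ii. \<tau> n i:]) * [:-1, 1:] ^ m1"] by simp
  qed
  define h where "h = (\<lambda>n. (\<Prod>j\<in>I0. [:- \<rho> n j, 1:]) * ((\<Prod>j\<in>Ii. [:1, - \<tau> n j:]) * (\<Prod>j\<in>I1. [:- \<rho> n j, 1:])))"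
  have pk: "p n = h n * k n" for n
  proof -
    have "c0 n = [:\<Sum>i\<in>I0. \<rho> n i, 1:] * (\<Prod>j\<in>I0. [:- \<rho> n j, 1:])"
      using centred_props(4)[OF fin(1), of "\<lambda>x. [:- x, 1:]" "\<rho> n"] by (simp add: c0_def J0_def)
    moreover have "ci n = (if mi = 0 then 1 else [:1, \<Sum>i\<in>Ii. \<tau> n i:]) * (\<Prod>j\<in>Ii. [:1, - \<tau> n j:])"
    proof (cases "mi = 0")
      case True
      then have "Ii = {}" using pat(2) fin by simp
      then show ?thesis using True by (simp add: ci_def Ji_def)
    next
      case False
      then show ?thesis using centred_props(4)[OF fin(2), of "\<lambda>x. [:1, - x:]" "\<tau> n"]
        by (simp add: ci_def Ji_def)
    qed
    ultimately show ?thesis by (simp only: p_def h_def k_def R_def mult_ac)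
  qed
  have ev_nz: "\<forall>\<^sub>F n in sequentially. (\<forall>j\<in>I0 \<union> I1. fst (v n j) \<noteq> 0) \<and> (\<forall>j\<in>Ii. snd (v n j) \<noteq> 0)"
  proof (intro eventually_conj eventually_ball_finite ballI)
    fix j assume "j \<in> I0 \<union> I1"
    then have "fst (l j) \<noteq> 0" "j < r" using nz0 by (auto simp: I1_def I0_def)
    then show "\<forall>\<^sub>F n in sequentially. fst (v n j) \<noteq> 0" using tendsto_imp_eventually_ne[OF fl(1)] by blast
  next
    fix j assume "j \<in> Ii"
    then have "snd (l j) \<noteq> 0" "j < r" using nzi by (auto simp: Ii_def)
    then show "\<forall>\<^sub>F n in sequentially. snd (v n j) \<noteq> 0" using tendsto_imp_eventually_ne[OF fl(2)] by blast
  qed (use fin in auto)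
  have ev_ann: "\<forall>\<^sub>F n in sequentially. pairing (a (\<sigma> n)) (p n) = 0"
    using ev_nz
  proof eventually_elim
    case (elim n)
    have e0: "(\<Prod>j\<in>I. lin (v n j)) = smult (\<Prod>j\<in>I. fst (v n j)) (\<Prod>j\<in>I. [:- \<rho> n j, 1:])" if "I \<subseteq> I0 \<union> I1" for I
      unfolding prod_smult[symmetric] by (intro prod.cong refl) (use elim that in \<open>auto simp: lin_def \<rho>_def\<close>)
    have ei: "(\<Prod>j\<in>Ii. lin (v n j)) = smult (\<Prod>j\<in>Ii. - snd (v n j)) (\<Prod>j\<in>Ii. [:1, - \<tau> n j:])"
      unfolding prod_smult[symmetric] by (intro prod.cong refl) (use elim in \<open>auto simp: lin_def \<tau>_def\<close>)
    have "(\<Prod>j<r. lin (v n j)) = (\<Prod>j\<in>I0. lin (v n j)) * ((\<Prod>j\<in>Ii. lin (v n j)) * (\<Prod>j\<in>I1. lin (v n j)))"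
      unfolding un using fin dj by (simp add: prod.union_disjoint)
    also have "\<dots> = smult ((\<Prod>j\<in>I0. fst (v n j)) * ((\<Prod>j\<in>Ii. - snd (v n j)) * (\<Prod>j\<in>I1. fst (v n j)))) (h n)"
      by (simp add: e0[of I0] e0[of I1] ei h_def mult_ac)
    finally have "annih (a (\<sigma> n)) r (smult ((\<Prod>j\<in>I0. fst (v n j)) * ((\<Prod>j\<in>Ii. - snd (v n j)) * (\<Prod>j\<in>I1. fst (v n j)))) (h n))"
      using va[of n] by simp
    then have "annih (a (\<sigma> n)) r (h n)" using elim fin by (auto simp: annih_smult)
    then show ?case unfolding pk using dk by (rule annih_pairing)
  qed
  have b\<sigma>: "(\<lambda>n. b (\<sigma> n) $ of_nat i) \<longlonglongrightarrow> b0 $ of_nat i" for i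
    using tendsto_vec_nth[OF LIMSEQ_subseq_LIMSEQ[OF b(1) \<sigma>]] by (simp add: o_def)
  have mm: "m0 \<le> 8 - mi" "m0 + mi \<le> 8" using m by auto
  define \<beta> where "\<beta> = (\<lambda>n. b (\<sigma> n) $ of_nat m0)"
  have \<beta>: "b (\<sigma> n) $ of_nat i = \<beta> n" if "m0 \<le> i" "i \<le> 8 - mi" for i n
    using b(2)[of "\<sigma> n"] that mm unfolding constant_gap_def \<beta>_def by (metis le_refl)
  have \<beta>0: "\<beta> n = 0" if "m1 = 0" for n
    using b(2)[of "\<sigma> n"] that mm unfolding constant_gap_def \<beta>_def by (metis le_refl)
  have p1: "\<beta> n * (\<Sum>i\<le>8. coeff (p n) i) = 0" for n
  proof (cases "m1 = 0")
    case False
    have "(\<Sum>i\<le>8. coeff (p n) i) = poly (p n) 1"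
      by (subst (2) poly_as_sum_le[OF dp]) (simp add: poly_sum poly_monom)
    also have "\<dots> = 0" using False by (simp add: p_def R_def)
    finally show ?thesis by simp
  qed (simp add: \<beta>0)
  have split: "pairing (b (\<sigma> n)) (p n) = (\<Sum>i<m0. (b (\<sigma> n) $ of_nat i - \<beta> n) * coeff (p n) i) +
      (\<Sum>t<mi. (b (\<sigma> n) $ of_nat (8 - t) - \<beta> n) * coeff (p n) (8 - t))" for n
    unfolding pairing_def
      using sum_split_pattern[of m0 mi "\<lambda>i. b (\<sigma> n) $ of_nat i" "\<beta> n" "coeff (p n)"] \<beta> mm(2) p1 by simp
  have first: "\<forall>\<^sub>F n in sequentially. (\<Sum>i<m0. (b (\<sigma> n) $ of_nat i - \<beta> n) * coeff (p n) i) \<le> 0"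
    unfolding p_def c0_def
  proof (rule cluster_sum_nonpos[OF J0(1,2) m(1) cent0 J0(3)])
    show "ptends (\<lambda>n. ci n * R n) ((\<Prod>j\<in>Ji. [:1, - 0:]) * ((\<Prod>j\<in>I1. [:- 1, 1:]) * [:-1, 1:] ^ m1)) sequentially"
      by (intro ptends_mult cil Rl)
    show "coeff ((\<Prod>j\<in>Ji. [:1, - 0:]) * ((\<Prod>j\<in>I1. [:- 1, 1:]) * [:-1, 1:] ^ m1) :: real poly) 0 = 1"
      using pat(3) m(2) by (cases "m1 = 0") (auto simp: coeff_mult coeff_0_power coeff_0_prod)
    show "\<And>i. i < m0 \<Longrightarrow> (\<lambda>n. b (\<sigma> n) $ of_nat i - \<beta> n) \<longlonglongrightarrow> b0 $ of_nat i - b0 $ of_nat m0"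
      unfolding \<beta>_def by (intro tendsto_intros b\<sigma>)
    show "0 < b0 $ of_nat (m0 - 1) - b0 $ of_nat m0" using pos(1) by simp
  qed
  have second: "\<forall>\<^sub>F n in sequentially. (\<Sum>t<mi. (b (\<sigma> n) $ of_nat (8 - t) - \<beta> n) * coeff (p n) (8 - t)) \<le> 0"
  proof (cases "mi = 0")
    case False
    then have mi: "mi > 0" by simp
    \<comment> \<open>The reversed cofactor: after reversal the cluster at infinity lies at 0, and
      the top coefficients of p become the low ones.\<close>
    define Y where "Y = (\<lambda>n. (\<Prod>j\<in>J0. [:1, - centred I0 (\<rho> n) j:]) * ((\<Prod>j\<in>I1. [:1, - \<rho> n j:]) * [:1, -1:] ^ m1))"
    have rev: "coeff (p n) (8 - t) = coeff ((\<Prod>j\<in>Ji. [:- centred Ii (\<tau> n) j, 1:]) * Y n) t" if t: "t \<le> 8"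
      for n t
    proof -
      have h0: "homp (Suc m0) (c0 n) [:0,1:] 1 = (\<Prod>j\<in>J0. [:1, - centred I0 (\<rho> n) j:])"
      proof -
        have "homp (card J0) (c0 n) [:0,1:] 1 = (\<Prod>j\<in>J0. smult (- centred I0 (\<rho> n) j) [:0,1:] + smult 1 1)"
          unfolding c0_def using homp_prod_linear[OF J0(1), of "\<lambda>j. - centred I0 (\<rho> n) j" "\<lambda>_. 1"] by blast
        also have "\<dots> = (\<Prod>j\<in>J0. [:1, - centred I0 (\<rho> n) j:])" by (intro prod.cong refl) (simp add: one_pCons)
        finally show ?thesis using J0(2) by simp
      qed
      have hi: "homp (card Ji) (ci n) [:0,1:] 1 = (\<Prod>j\<in>Ji. [:- centred Ii (\<tau> n) j, 1:])"
      proof -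
        have "homp (card Ji) (ci n) [:0,1:] 1 = (\<Prod>j\<in>Ji. smult 1 [:0,1:] + smult (- centred Ii (\<tau> n) j) 1)"
          unfolding ci_def using homp_prod_linear[OF Ji(1), of "\<lambda>_. 1" "\<lambda>j. - centred Ii (\<tau> n) j"] by blast
        also have "\<dots> = (\<Prod>j\<in>Ji. [:- centred Ii (\<tau> n) j, 1:])" by (intro prod.cong refl) (simp add: one_pCons)
        finally show ?thesis .
      qed
      have hX: "homp m1 (\<Prod>j\<in>I1. [:- \<rho> n j, 1:]) [:0,1:] 1 = (\<Prod>j\<in>I1. [:1, - \<rho> n j:])"
      proof -
        have "homp (card I1) (\<Prod>j\<in>I1. [:- \<rho> n j, 1:]) [:0,1:] 1 = (\<Prod>j\<in>I1. smult (- \<rho> n j) [:0,1:] + smult 1 1)"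
          using homp_prod_linear[OF fin(3), of "\<lambda>j. - \<rho> n j" "\<lambda>_. 1"] by blast
        also have "\<dots> = (\<Prod>j\<in>I1. [:1, - \<rho> n j:])" by (intro prod.cong refl) (simp add: one_pCons)
        finally show ?thesis using pat(3) by simp
      qed
      have hm: "homp m1 ([:-1, 1:] ^ m1) [:0,1:] 1 = ([:1, -1:] ^ m1 :: real poly)"
        using m(2) by (cases "m1 = 0") (auto simp: homp_def le_Suc_eq one_pCons)
      have "homp (m1 + m1) (R n) [:0,1:] 1 = (\<Prod>j\<in>I1. [:1, - \<rho> n j:]) * [:1, -1:] ^ m1"
        unfolding R_def by (subst homp_mult[OF dX dm1]) (simp only: hX hm)
      then have "homp (card Ji + (m1 + m1)) (ci n * R n) [:0,1:] 1 =
          (\<Prod>j\<in>Ji. [:- centred Ii (\<tau> n) j, 1:]) * ((\<Prod>j\<in>I1. [:1, - \<rho> n j:]) * [:1, -1:] ^ m1)"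
        by (subst homp_mult[OF dci dR]) (simp only: hi)
      moreover have "degree (ci n * R n) \<le> card Ji + (m1 + m1)"
        using degree_mult_le[of "ci n" "R n"] dci[of n] dR[of n] by linarith
      ultimately have "homp (Suc m0 + (card Ji + (m1 + m1))) (p n) [:0,1:] 1 =
          (\<Prod>j\<in>Ji. [:- centred Ii (\<tau> n) j, 1:]) * Y n"
        unfolding p_def by (subst homp_mult[OF dc0]) (simp_all only: h0 Y_def mult_ac)
      then show ?thesis using coeff_homp_rev[OF t, of "p n"] unfolding tot by simp
    qed
    have "\<forall>\<^sub>F n in sequentially. (\<Sum>t<mi. (b (\<sigma> n) $ of_nat (8 - t) - \<beta> n) * coeff ((\<Prod>j\<in>Ji. [:- centred Ii (\<tau> n) j, 1:]) * Y n) t) \<le> 0"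
    proof (rule cluster_sum_nonpos[OF Ji(1) Ji(2)[OF mi] _ centi Ji(4)[OF mi]])
      show "ptends Y ((\<Prod>j\<in>J0. [:1, - 0:]) * ((\<Prod>j\<in>I1. [:1, - 1:]) * [:1, -1:] ^ m1)) sequentially"
        unfolding Y_def by (intro ptends_mult ptends_prod ptends_linear ptends_const tendsto_intros \<rho>1 cent0)
      show "coeff ((\<Prod>j\<in>J0. [:1, - 0:]) * ((\<Prod>j\<in>I1. [:1, - 1:]) * [:1, -1:] ^ m1) :: real poly) 0 = 1"
        by (auto simp: coeff_mult coeff_0_power coeff_0_prod)
      show "\<And>t. t < mi \<Longrightarrow> (\<lambda>n. b (\<sigma> n) $ of_nat (8 - t) - \<beta> n) \<longlonglongrightarrow> b0 $ of_nat (8 - t) - b0 $ of_nat m0"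
        unfolding \<beta>_def by (intro tendsto_intros b\<sigma>)
      have "8 - (mi - 1) = 9 - mi" using mi mm by simp
      then show "0 < b0 $ of_nat (8 - (mi - 1)) - b0 $ of_nat m0" using pos(2)[OF mi] by simp
    qed (use mi in simp)
    moreover have "(\<Sum>t<mi. (b (\<sigma> n) $ of_nat (8 - t) - \<beta> n) * coeff (p n) (8 - t)) =
        (\<Sum>t<mi. (b (\<sigma> n) $ of_nat (8 - t) - \<beta> n) * coeff ((\<Prod>j\<in>Ji. [:- centred Ii (\<tau> n) j, 1:]) * Y n) t)" for n
      using mm by (intro sum.cong refl) (simp add: rev)
    ultimately show ?thesis by simp
  qed simp
  \<comment> \<open>The limit of p is u^(m0 + 1) (u - 1)^(2 m1), which is positive at 2; this is the
    reason for perturbing by the eighth power at the node (1, 2).\<close>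
  have "(\<lambda>n. heval 8 (p n) (1, 2)) \<longlonglongrightarrow> heval 8 ((\<Prod>j\<in>J0. [:- 0, 1:]) * ((\<Prod>j\<in>Ji. [:1, - 0:]) * ((\<Prod>j\<in>I1. [:- 1, 1:]) * [:-1, 1:] ^ m1))) (1, 2)"
    unfolding p_def by (intro tendsto_heval ptends_mult c0l cil Rl)
  moreover have "heval 8 ((\<Prod>j\<in>J0. [:- 0, 1:]) * ((\<Prod>j\<in>Ji. [:1, - 0:]) * ((\<Prod>j\<in>I1. [:- 1, 1:]) * [:-1, 1:] ^ m1))) (1, 2 :: real) > 0"
  proof -
    have "(\<Prod>j\<in>Ji. [:1, - 0:]) = (1 :: real poly)" by (simp add: one_pCons[symmetric])
    then have eq: "(\<Prod>j\<in>J0. [:- 0, 1:]) * ((\<Prod>j\<in>Ji. [:1, - 0:]) * ((\<Prod>j\<in>I1. [:- 1, 1:]) * [:-1, 1:] ^ m1)) = (monom 1 (Suc m0) * [:-1, 1:] ^ (m1 + m1) :: real poly)"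
      by (simp add: J0(2) pat(3) monom_altdef power_add)
    have dm2: "degree ([:-1, 1:] ^ (m1 + m1) :: real poly) \<le> m1 + m1"
      using degree_power_le[of "[:-1, 1:] :: real poly" "m1 + m1"] by simp
    have "degree (monom 1 (Suc m0) * [:-1, 1:] ^ (m1 + m1) :: real poly) \<le> 8"
      using degree_mult_le[of "monom 1 (Suc m0) :: real poly"
        "[:-1, 1:] ^ (m1 + m1)"] degree_monom_le[of "1::real" "Suc m0"] dm2 tot by linarith
    then show ?thesis unfolding eq by (subst heval_fst_nz) (auto simp: poly_monom poly_power)
  qed
  ultimately have third: "\<forall>\<^sub>F n in sequentially. heval 8 (p n) (1, 2) > 0" by (rule order_tendstoD)
  have "\<forall>\<^sub>F n::nat in sequentially. False"
    using ev_ann first second third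
  proof eventually_elim
    case (elim n)
    have "pairing (b (\<sigma> n)) (p n) = \<epsilon> (\<sigma> n) * heval 8 (p n) (1, 2)"
      using elim(1) by (simp add: a_def pairing_diff_left pairing_scaleR_left pairing_evv)
    moreover have "\<dots> > 0" using elim(4) \<epsilon>(2) by simp
    moreover have "pairing (b (\<sigma> n)) (p n) \<le> 0" unfolding split using elim(2,3) by simp
    ultimately show False by simp
  qed
  then show False by simp
qed

section \<open>Real forms with a unique real-rooted annihilator\<close>

lemma coeff_prod_alternate:
  fixes a b :: "'i \<Rightarrow> real"
  shows "coeff (\<Prod>j\<in>I. [:a j, - b j:]) i = (-1) ^ i * coeff (\<Prod>j\<in>I. [:a j, b j:]) i"
proof (induction I arbitrary: i rule: infinite_finite_induct)
  case (insert x I)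
  show ?case
  proof (cases i)
    case 0 then show ?thesis using insert by (simp add: coeff_linear_mult_0 del: mult_pCons_left)
  next
    case (Suc k)
    then show ?thesis using insert by (simp add: coeff_linear_mult_Suc algebra_simps del: mult_pCons_left)
  qed
qed (auto intro!: gr0I)

lemma coeff_square_product_sign:
  fixes a b :: "'i \<Rightarrow> real"
  shows "0 \<le> (-1) ^ k * coeff (\<Prod>j\<in>I. [:(a j)\<^sup>2, 0, - (b j)\<^sup>2:]) (2 * k)"
proof (induction I arbitrary: k rule: infinite_finite_induct)
  case (insert x I)
  let ?P = "\<Prod>j\<in>I. [:(a j)\<^sup>2, 0, - (b j)\<^sup>2:]"
  have eq: "[:(a x)\<^sup>2, 0, - (b x)\<^sup>2:] * ?P = smult ((a x)\<^sup>2) ?P - smult ((b x)\<^sup>2) (pCons 0 (pCons 0 ?P))"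
    by simp
  show ?case
  proof (cases k)
    case 0 then show ?thesis using insert.IH[of 0] insert.hyps by (simp add: coeff_mult)
  next
    case (Suc m)
    have "(-1) ^ k * coeff ([:(a x)\<^sup>2, 0, - (b x)\<^sup>2:] * ?P) (2 * k) =
        (a x)\<^sup>2 * ((-1) ^ k * coeff ?P (2 * k)) + (b x)\<^sup>2 * ((-1) ^ m * coeff ?P (2 * m))"
      unfolding eq by (simp add: Suc algebra_simps)
    also have "\<dots> \<ge> 0" using insert.IH[of k] insert.IH[of m]
      by (intro add_nonneg_nonneg mult_nonneg_nonneg[of "_\<^sup>2"]) auto
    finally show ?thesis using insert.hyps by simp
  qed
qed (auto simp: coeff_1 split: if_splits)

text \<open>Graeffe root squaring: the coefficients of \<open>h(u) h(-u)\<close> alternate in sign when h is real-rooted.\<close>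

lemma graeffe:
  fixes v :: "nat \<Rightarrow> real \<times> real" and r :: nat
  defines "h \<equiv> \<Prod>j<r. lin (v j)"
  shows "0 \<le> (-1) ^ k * (\<Sum>i\<le>2 * k. coeff h i * ((-1) ^ (2 * k - i) * coeff h (2 * k - i)))"
proof -
  define g where "g = (\<Prod>j<r. [:- snd (v j), - fst (v j):])"
  have hg: "h * g = (\<Prod>j<r. [:(snd (v j))\<^sup>2, 0, - (fst (v j))\<^sup>2:])"
    unfolding h_def g_def prod.distrib[symmetric]
      by (intro prod.cong refl) (simp add: lin_def power2_eq_square)
  have cg: "coeff g i = (-1) ^ i * coeff h i" for i
    unfolding h_def g_def lin_def by (rule coeff_prod_alternate)
  have "(\<Sum>i\<le>2 * k. coeff h i * ((-1) ^ (2 * k - i) * coeff h (2 * k - i))) = coeff (h * g) (2 * k)"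
    by (simp only: coeff_mult cg)
  then show ?thesis unfolding hg
    using coeff_square_product_sign[of k "\<lambda>j. snd (v j)" "\<lambda>j. fst (v j)" "{..<r}"] by simp
qed

lemma sum_atMost_unfold:
  fixes g :: "nat \<Rightarrow> real"
  shows "sum g {..2} = g 0 + g 1 + g 2" "sum g {..4} = g 0 + g 1 + g 2 + g 3 + g 4"
    "sum g {..6} = g 0 + g 1 + g 2 + g 3 + g 4 + g 5 + g 6"
    "sum g {..8} = g 0 + g 1 + g 2 + g 3 + g 4 + g 5 + g 6 + g 7 + g 8"
    "sum g {..10} = g 0 + g 1 + g 2 + g 3 + g 4 + g 5 + g 6 + g 7 + g 8 + g 9 + g 10"
  by (simp_all add: eval_nat_numeral)

lemma degree_node_product: "degree (\<Prod>j<r. lin (v j)) \<le> r"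
  using degree_lprod[of "image_mset v (mset_set {..<r})"] by (simp add: lprod_family)

text \<open>The sign conditions of Graeffe written out for k = 1, ..., 5. They turn real-rootedness
  in degree at most 6 into quadratic inequalities that can be combined with the linear annihilation
  conditions.\<close>

lemma graeffe_inequalities:
  fixes v :: "nat \<Rightarrow> real \<times> real"
  assumes h: "h = (\<Prod>j<r. lin (v j))" and r: "r \<le> 6"
  shows "2 * (coeff h 0 * coeff h 2) \<le> (coeff h 1)\<^sup>2"
    "2 * (coeff h 1 * coeff h 3) \<le> (coeff h 2)\<^sup>2 + 2 * (coeff h 0 * coeff h 4)"
    "2 * (coeff h 2 * coeff h 4) + 2 * (coeff h 0 * coeff h 6) \<le> (coeff h 3)\<^sup>2 + 2 * (coeff h 1 * coeff h 5)"
    "2 * (coeff h 3 * coeff h 5) \<le> (coeff h 4)\<^sup>2 + 2 * (coeff h 2 * coeff h 6)"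
    "2 * (coeff h 4 * coeff h 6) \<le> (coeff h 5)\<^sup>2"
proof -
  have z: "coeff h i = 0" if "i > 6" for i
    using degree_node_product[of v r] r that unfolding h by (intro coeff_eq_0) auto
  have z': "coeff h 7 = 0" "coeff h 8 = 0" "coeff h 9 = 0" "coeff h 10 = 0" by (auto intro: z)
  note g = graeffe[of _ v r, folded h]
  show "2 * (coeff h 0 * coeff h 2) \<le> (coeff h 1)\<^sup>2"
    using g[of 1] by (simp add: sum_atMost_unfold power2_eq_square algebra_simps numeral_2_eq_2)
  show "2 * (coeff h 1 * coeff h 3) \<le> (coeff h 2)\<^sup>2 + 2 * (coeff h 0 * coeff h 4)"
    using g[of 2] by (simp add: sum_atMost_unfold power2_eq_square algebra_simps)
  show "2 * (coeff h 2 * coeff h 4) + 2 * (coeff h 0 * coeff h 6) \<le>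
      (coeff h 3)\<^sup>2 + 2 * (coeff h 1 * coeff h 5)"
    using g[of 3] by (simp add: sum_atMost_unfold power2_eq_square algebra_simps)
  show "2 * (coeff h 3 * coeff h 5) \<le> (coeff h 4)\<^sup>2 + 2 * (coeff h 2 * coeff h 6)"
    using g[of 4] by (simp add: sum_atMost_unfold power2_eq_square algebra_simps z')
  show "2 * (coeff h 4 * coeff h 6) \<le> (coeff h 5)\<^sup>2"
    using g[of 5] by (simp add: sum_atMost_unfold power2_eq_square algebra_simps z')
qed

section \<open>Uniqueness of the real-rooted annihilator for six explicit forms\<close>

lemma pairing_vec_of: "pairing (vec_of f) p = (\<Sum>i\<le>8. coeff p i * f i)"
  unfolding pairing_def by (intro sum.cong) auto

lemma annih_vec_of:
  assumes "annih (vec_of f) e h" "k \<le> 8 - e"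
  shows "(\<Sum>i\<le>8. (if k \<le> i then coeff h (i - k) else 0) * f i) = (0 :: real)"
  using assms unfolding annih_def pairing_vec_of coeff_mult_monom_one by blast

lemma eq_gpoly_0:
  fixes h :: "real poly"
  assumes "\<And>i. i \<noteq> m \<Longrightarrow> coeff h i = 0" shows "\<exists>c. h = smult c (gpoly m 0)"
  using assms by (intro exI[of _ "coeff h m"]) (auto simp: poly_eq_iff gpoly_def)

lemma nat_cases_6: "i \<le> 6 \<Longrightarrow> i = 0 \<or> i = 1 \<or> i = 2 \<or> i = 3 \<or> i = 4 \<or> i = 5 \<or> i = (6::nat)" by auto

text \<open>The form vanishes on the gap 3, ..., 5 and is 1 at both neighbours 2 and 6. The
  annihilation conditions make x1 x3 and x3 x5 opposite, so adding the second and fourth inequality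
  leaves a negative definite expression in x0 and x2.\<close>

lemma unique_annihilator_44:
  fixes v :: "nat \<Rightarrow> real \<times> real"
  assumes ann: "annih (vec_of (\<lambda>i. [0,0,1,0,0,0,1,0,0] ! i)) 6 (\<Prod>j<6. lin (v j))"
  shows "\<exists>c. (\<Prod>j<6. lin (v j)) = smult c (gpoly 3 0)"
proof -
  define h where "h = (\<Prod>j<6. lin (v j))"
  define x where "x = coeff h"
  have z78: "coeff h 7 = 0" "coeff h 8 = 0" unfolding h_def using degree_node_product[of v 6]
    by (auto intro!: coeff_eq_0)
  have e: "x 2 + x 6 = 0" "x 1 + x 5 = 0" "x 0 + x 4 = 0"
    using annih_vec_of[OF ann[folded h_def], of 0] annih_vec_of[OF ann[folded h_def], of 1] annih_vec_of[OF ann[folded h_def], of 2]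
    by (simp_all add: sum_atMost_unfold x_def z78)
  note D = graeffe_inequalities[OF h_def order_refl, folded x_def]
  have s: "x 4 = - x 0" "x 5 = - x 1" "x 6 = - x 2" using e by auto
  have "(x 0)\<^sup>2 + (x 2)\<^sup>2 \<le> 0" using D(2,4) unfolding s by (simp add: power2_eq_square algebra_simps)
  then have z: "x 0 = 0" "x 2 = 0" by (auto simp: sum_power2_le_zero_iff)
  have "x 1 * x 3 = 0" using D(2,4) unfolding s z by simp
  moreover have "2 * (x 1)\<^sup>2 \<le> (x 3)\<^sup>2" using D(3) unfolding s z by (simp add: power2_eq_square)
  ultimately have "x 1 = 0" by auto
  then have "coeff h i = 0" if "i \<noteq> 3" for i
    using that z s nat_cases_6[of i] degree_node_product[of v 6] coeff_eq_0[of h i]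
      unfolding h_def[symmetric] x_def by fastforce
  then show ?thesis unfolding h_def[symmetric] by (rule eq_gpoly_0)
qed

text \<open>The gap is 5, ..., 7 with entries 1 at its neighbours; without the entry at index 2 the
  constant 1, with six roots at infinity, would annihilate the form as well. With t = x2 - x0 the
  inequalities combine to 5 t^2 \<le> x0^2 and x0^2 \<le> t^2.\<close>

lemma unique_annihilator_62:
  fixes v :: "nat \<Rightarrow> real \<times> real"
  assumes ann: "annih (vec_of (\<lambda>i. [0,0,-1,0,1,0,0,0,1] ! i)) 6 (\<Prod>j<6. lin (v j))"
  shows "\<exists>c. (\<Prod>j<6. lin (v j)) = smult c (gpoly 5 0)"
proof -
  define h where "h = (\<Prod>j<6. lin (v j))"
  define x where "x = coeff h"
  have z78: "coeff h 7 = 0" "coeff h 8 = 0" unfolding h_def using degree_node_product[of v 6]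
    by (auto intro!: coeff_eq_0)
  have e: "x 4 - x 2 = 0" "x 3 - x 1 = 0" "x 2 + x 6 - x 0 = 0"
    using annih_vec_of[OF ann[folded h_def], of 0] annih_vec_of[OF ann[folded h_def], of 1] annih_vec_of[OF ann[folded h_def], of 2]
    by (simp_all add: sum_atMost_unfold x_def z78)
  note D = graeffe_inequalities[OF h_def order_refl, folded x_def]
  have s: "x 4 = x 2" "x 3 = x 1" "x 6 = x 0 - x 2" using e by auto
  have D2: "0 \<le> (x 2)\<^sup>2 - 2 * (x 1)\<^sup>2 + 2 * (x 0 * x 2)" using D(2) unfolding s
    by (simp add: power2_eq_square)
  have "0 \<le> (x 1)\<^sup>2 - (x 2)\<^sup>2 - 2 * (x 0 - x 2)\<^sup>2" using D(3,4) unfolding s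
    by (simp add: power2_eq_square algebra_simps)
  then have k: "5 * (x 2 - x 0)\<^sup>2 \<le> (x 0)\<^sup>2" using D2 by (simp add: power2_eq_square algebra_simps)
  have D1: "2 * (x 0 * x 2) \<le> (x 1)\<^sup>2" using D(1) by simp
  have m: "0 \<le> x 2 * (x 2 - 2 * x 0)" using D2 D1 by (simp add: power2_eq_square algebra_simps)
  have "x 2 * (x 2 - 2 * x 0) = (x 2 - x 0)\<^sup>2 - (x 0)\<^sup>2" by (simp add: power2_eq_square algebra_simps)
  then have "(x 0)\<^sup>2 \<le> (x 2 - x 0)\<^sup>2" using m by simp
  then have "(x 0)\<^sup>2 \<le> 0" "(x 2 - x 0)\<^sup>2 \<le> 0" using k zero_le_power2[of "x 0"] zero_le_power2[of "x 2 - x 0"]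
    by linarith+
  then have z: "x 0 = 0" "x 2 = 0" by auto
  then have "x 1 = 0" using D2 by simp
  then have "coeff h i = 0" if "i \<noteq> 5" for i
    using that z s nat_cases_6[of i] degree_node_product[of v 6] coeff_eq_0[of h i]
      unfolding h_def[symmetric] x_def by fastforce
  then show ?thesis unfolding h_def[symmetric] by (rule eq_gpoly_0)
qed

text \<open>The entry 1/16 at index 0 prevents the constant 1 from annihilating the form and ties x3
  to x0. If x0 were nonzero, no root would be 0, and the inequalities would bound the sum of squares
  of the six reciprocal roots by 1/256. Their third elementary symmetric function is then at most
  1/64 in size, whereas the condition x0 / 16 + x3 = 0 requires 1/16.\<close>

lemma unique_annihilator_53:
  fixes v :: "nat \<Rightarrow> real \<times> real"
  assumes ann: "annih (vec_of (\<lambda>i. [1/16,0,0,1,0,0,0,1,0] ! i)) 6 (\<Prod>j<6. lin (v j))"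
  shows "\<exists>c. (\<Prod>j<6. lin (v j)) = smult c (gpoly 4 0)"
proof -
  define h where "h = (\<Prod>j<6. lin (v j))"
  define x where "x = coeff h"
  have z78: "coeff h 7 = 0" "coeff h 8 = 0" unfolding h_def using degree_node_product[of v 6]
    by (auto intro!: coeff_eq_0)
  have e: "x 0 / 16 + x 3 = 0" "x 2 + x 6 = 0" "x 1 + x 5 = 0"
    using annih_vec_of[OF ann[folded h_def], of 0] annih_vec_of[OF ann[folded h_def], of 1] annih_vec_of[OF ann[folded h_def], of 2]
    by (simp_all add: sum_atMost_unfold x_def z78)
  note D = graeffe_inequalities[OF h_def order_refl, folded x_def]
  have s: "x 3 = - x 0 / 16" "x 6 = - x 2" "x 5 = - x 1" using e by auto
  have b: "(x 1)\<^sup>2 - 2 * (x 0 * x 2) \<le> (x 0)\<^sup>2 / 256" using D(3,5) unfolding s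
    by (simp add: power2_eq_square algebra_simps)
  have x0: "x 0 = 0"
  proof (rule ccontr)
    assume nz: "x 0 \<noteq> 0"
    have "x 0 = (\<Prod>j<6. - snd (v j))" unfolding x_def h_def by (simp add: coeff_0_prod lin_def)
    then have sn: "snd (v j) \<noteq> 0" if "j < 6" for j using nz that by auto
    define \<tau> where "\<tau> = (\<lambda>j. fst (v j) / snd (v j))"
    have "h = (\<Prod>j<6. smult (- snd (v j)) [:1, - \<tau> j:])"
      unfolding h_def by (intro prod.cong refl) (use sn in \<open>auto simp: lin_def \<tau>_def\<close>)
    also have "\<dots> = smult (x 0) (\<Prod>j<6. [:1, - \<tau> j:])"
      using \<open>x 0 = (\<Prod>j<6. - snd (v j))\<close> by (simp only: prod_smult)
    finally have h': "h = smult (x 0) (\<Prod>j<6. [:1, - \<tau> j:])" .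
    define S where "S = (\<Sum>j<6. (\<tau> j)\<^sup>2)"
    define P where "P = (\<Prod>j<6. [:1, - \<tau> j:])"
    have c0: "coeff P 1 = - (\<Sum>j<6. \<tau> j)" "coeff P 2 = ((\<Sum>j<6. \<tau> j)\<^sup>2 - S) / 2"
      unfolding P_def S_def by (simp_all add: eval_nat_numeral field_simps)
    have xk: "x k = x 0 * coeff P k" for k
      using arg_cong[OF h', of "\<lambda>p. coeff p k"] by (simp only: coeff_smult P_def x_def)
    have "(x 1)\<^sup>2 - 2 * (x 0 * x 2) = (x 0)\<^sup>2 * S"
      unfolding xk[of 1] xk[of 2] c0 by (simp add: power2_eq_square field_simps)
    then have "S \<le> 1 / 256" using b nz by (simp add: field_simps)
    then have S: "S \<le> (1 / 16)\<^sup>2" by (simp add: power2_eq_square)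
    have "\<bar>\<tau> j\<bar> \<le> 1 / 16" if "j \<in> {..<6}" for j
    proof -
      have "(\<tau> j)\<^sup>2 \<le> S" unfolding S_def using that by (intro member_le_sum) auto
      then have "(\<tau> j)\<^sup>2 \<le> (1 / 16)\<^sup>2" using S by simp
      then show ?thesis by (metis abs_le_square_iff abs_of_nonneg zero_le_divide_1_iff zero_le_numeral)
    qed
    then have "\<bar>coeff P 3\<bar> \<le> 2 ^ card {..<6::nat} * ((1 / 16) * S)"
      using cluster_coeffs[of "{..<6::nat}" \<tau> "1/16"] by (auto simp: P_def S_def)
    also have "\<dots> \<le> 64 * (1/16 * (1/256))" using S by (simp add: power2_eq_square)
    finally have p3: "\<bar>coeff P 3\<bar> \<le> 1 / 64" by simp
    have "x 3 = x 0 * coeff P 3" by (rule xk)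
    then have "x 0 * (coeff P 3 + 1 / 16) = 0" using s(1) by (simp add: algebra_simps)
    then have "coeff P 3 = - 1 / 16" using nz by simp
    then show False using p3 by simp
  qed
  have "(x 1)\<^sup>2 \<le> 0" using b unfolding x0 by simp
  then have x1: "x 1 = 0" by simp
  have "x 2 * x 4 = 0" using D(3,5) unfolding s x0 x1 by simp
  moreover have "2 * (x 2)\<^sup>2 \<le> (x 4)\<^sup>2" using D(4) unfolding s x0 x1 by (simp add: power2_eq_square)
  ultimately have "x 2 = 0" by auto
  then have "coeff h i = 0" if "i \<noteq> 4" for i
    using that x0 x1 s nat_cases_6[of i] degree_node_product[of v 6] coeff_eq_0[of h i]
      unfolding h_def[symmetric] x_def by fastforce
  then show ?thesis unfolding h_def[symmetric] by (rule eq_gpoly_0)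
qed

lemma nat_cases_5: "i \<le> 5 \<Longrightarrow> i = 0 \<or> i = 1 \<or> i = 2 \<or> i = 3 \<or> i = 4 \<or> i = (5::nat)" by auto

lemma coeff_gpoly_1: "coeff (gpoly m (Suc 0)) i = (if i = Suc m then 1 else if i =
    m then -1 else (0 :: real))"
proof -
  have "gpoly m (Suc 0) = monom 1 (Suc m) - (monom 1 m :: real poly)"
    by (simp add: gpoly_def monom_Suc mult_monom algebra_simps)
  then show ?thesis by (simp only: coeff_diff coeff_monom) simp
qed

text \<open>The gap 2, ..., 6 has the value -1, below its neighbours. Four linear conditions leave a
  pencil with parameters x0 and x2; the first and the fourth Graeffe inequality add up to 2 x0^2
  \<le> 0, so only multiples of u^2 (u - 1) remain.\<close>

lemma unique_annihilator_332:
  fixes v :: "nat \<Rightarrow> real \<times> real"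
  assumes ann: "annih (vec_of (\<lambda>i. [2,2,-1,-1,-1,-1,-1,2,2] ! i)) 5 (\<Prod>j<5. lin (v j))"
  shows "\<exists>c. (\<Prod>j<5. lin (v j)) = smult c (gpoly 2 1)"
proof -
  define h where "h = (\<Prod>j<5. lin (v j))"
  define x where "x = coeff h"
  have z: "coeff h i = 0" if "i > 5" for i
    using degree_node_product[of v 5] that unfolding h_def by (intro coeff_eq_0) auto
  have z': "x 6 = 0" "x 7 = 0" "x 8 = 0" unfolding x_def by (auto intro: z)
  have e: "2 * x 0 + 2 * x 1 - x 2 - x 3 - x 4 - x 5 = 0" "2 * x 0 - x 1 - x 2 - x 3 - x 4 - x 5 = 0"
     "- x 0 - x 1 - x 2 - x 3 - x 4 + 2 * x 5 = 0" "- x 0 - x 1 - x 2 - x 3 + 2 * x 4 + 2 * x 5 = 0"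
    using annih_vec_of[OF ann[folded h_def], of 0] annih_vec_of[OF ann[folded h_def], of 1] annih_vec_of[OF ann[folded h_def], of 2]
      annih_vec_of[OF ann[folded h_def], of 3] z'
    by (simp_all add: sum_atMost_unfold x_def)
  have s: "x 1 = 0" "x 4 = 0" "x 5 = x 0" "x 3 = x 0 - x 2" using e by linarith+
  have "(5::nat) \<le> 6" by simp
  note D = graeffe_inequalities[OF h_def this, folded x_def]
  have "2 * (x 0)\<^sup>2 \<le> 0" using D(1,4) unfolding s z' by (simp add: power2_eq_square algebra_simps)
  then have x0: "x 0 = 0" by simp
  have "h = smult (x 3) (gpoly 2 1)"
  proof (rule poly_eqI)
    fix i show "coeff h i = coeff (smult (x 3) (gpoly 2 1)) i"
      using nat_cases_5[of i] z[of i] s x0 by (fastforce simp: coeff_gpoly_1 x_def)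
  qed
  then show ?thesis unfolding h_def[symmetric] by blast
qed

text \<open>The gap is 3, ..., 7. The linear conditions leave a pencil with parameters x0 and x3 in
  which x1 = 0 and x2 = x0, so the first Graeffe inequality alone excludes x0 \<noteq> 0.\<close>

lemma unique_annihilator_422:
  fixes v :: "nat \<Rightarrow> real \<times> real"
  assumes ann: "annih (vec_of (\<lambda>i. [-1,2,2,-1,-1,-1,-1,-1,2] ! i)) 5 (\<Prod>j<5. lin (v j))"
  shows "\<exists>c. (\<Prod>j<5. lin (v j)) = smult c (gpoly 3 1)"
proof -
  define h where "h = (\<Prod>j<5. lin (v j))"
  define x where "x = coeff h"
  have z: "coeff h i = 0" if "i > 5" for i
    using degree_node_product[of v 5] that unfolding h_def by (intro coeff_eq_0) auto
  have z': "x 6 = 0" "x 7 = 0" "x 8 = 0" unfolding x_def by (auto intro: z)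
  have e: "- x 0 + 2 * x 1 + 2 * x 2 - x 3 - x 4 - x 5 = 0" "2 * x 0 + 2 * x 1 - x 2 - x 3 - x 4 - x 5 = 0"
     "2 * x 0 - x 1 - x 2 - x 3 - x 4 - x 5 = 0" "- x 0 - x 1 - x 2 - x 3 - x 4 + 2 * x 5 = 0"
    using annih_vec_of[OF ann[folded h_def], of 0] annih_vec_of[OF ann[folded h_def], of 1] annih_vec_of[OF ann[folded h_def], of 2]
      annih_vec_of[OF ann[folded h_def], of 3] z'
    by (simp_all add: sum_atMost_unfold x_def)
  have s: "x 1 = 0" "x 2 = x 0" "x 5 = x 0" "x 4 = - x 3" using e by linarith+
  have "(5::nat) \<le> 6" by simp
  note D = graeffe_inequalities[OF h_def this, folded x_def]
  have "2 * (x 0)\<^sup>2 \<le> 0" using D(1) unfolding s by (simp add: power2_eq_square)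
  then have x0: "x 0 = 0" by simp
  have "h = smult (x 4) (gpoly 3 1)"
  proof (rule poly_eqI)
    fix i show "coeff h i = coeff (smult (x 4) (gpoly 3 1)) i"
      using nat_cases_5[of i] z[of i] s x0 by (fastforce simp: coeff_gpoly_1 x_def)
  qed
  then show ?thesis unfolding h_def[symmetric] by blast
qed

lemma coeff_prod_of_real:
  "coeff (\<Prod>j\<in>I. [:complex_of_real (a j), complex_of_real (b j):]) i =
      complex_of_real (coeff (\<Prod>j\<in>I. [:a j, b j:]) i)"
proof (induction I arbitrary: i rule: infinite_finite_induct)
  case (insert x I)
  then show ?case by (cases i) (simp_all add: coeff_linear_mult_0 coeff_linear_mult_Suc del: mult_pCons_left)
qed (auto intro!: gr0I)

text \<open>With the nodes normalised to unit vectors, all factors of h(\<open>\<i>\<close>) are unimodular. The annihilation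
conditions say \<open>15 h(\<i>) = 2 \<i> h'(\<i>) - cnj (h(\<i>))\<close>, and dividing by h(\<open>\<i>\<close>) bounds the
sum of the seven \<open>(fst (v j))\<^sup>2\<close> below by 7.\<close>

lemma unique_annihilator_8:
  fixes v :: "nat \<Rightarrow> real \<times> real"
  assumes ann: "annih (vec_of (\<lambda>i. [-4,0,3,0,-2,0,1,0,0] ! i)) 7 (\<Prod>j<7. lin (v j))"
    and unit: "\<And>j. j < 7 \<Longrightarrow> norm (v j) = 1"
  shows "\<exists>c. (\<Prod>j<7. lin (v j)) = smult c (gpoly 7 0)"
proof -
  define h where "h = (\<Prod>j<7. lin (v j))"
  define x where "x = coeff h"
  have dh: "degree h \<le> 7" unfolding h_def by (rule degree_node_product)
  have z: "x 8 = 0" unfolding x_def using dh by (intro coeff_eq_0) auto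
  have e: "- 4 * x 0 + 3 * x 2 - 2 * x 4 + x 6 = 0" "3 * x 1 - 2 * x 3 + x 5 = 0"
    using annih_vec_of[OF ann[folded h_def], of 0] annih_vec_of[OF ann[folded h_def], of 1] z
    by (simp_all add: sum_atMost_unfold x_def)
  define f where "f = (\<lambda>j. [:complex_of_real (- snd (v j)), complex_of_real (fst (v j)):])"
  define P where "P = (\<Prod>j<7. f j)"
  have cP: "coeff P i = complex_of_real (x i)" for i
    unfolding P_def f_def x_def h_def lin_def by (rule coeff_prod_of_real)
  have "degree P \<le> 7" using cP dh by (intro degree_le) (simp add: x_def coeff_eq_0)
  then have "P = (\<Sum>i\<le>7. monom (complex_of_real (x i)) i)" by (subst poly_as_sum_le[of P 7]) (simp_all add: cP)
  then have P: "P = [:of_real (x 0), of_real (x 1), of_real (x 2), of_real (x 3), of_real (x 4), of_real (x 5), of_real (x 6), of_real (x 7):]"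
    by (simp add: eval_nat_numeral monom_Suc monom_0)
  define H where "H = poly P \<i>"
  define H' where "H' = poly (pderiv P) \<i>"
  define w where "w = (\<lambda>j. Complex (- snd (v j)) (fst (v j)))"
  have wf: "poly (f j) \<i> = w j" for j by (simp add: f_def w_def complex_eq_iff)
  \<comment> \<open>In 2 \<i> H' - cnj H - 15 H the coefficient of \<open>x k\<close> is 2 k - 16
    for even k and 2 k - 14 for odd k, times the k-th power of \<i>. Up to the factors 4 and -4 the
    real and imaginary parts are the two annihilation conditions, which is the origin of the entries
    -4, 3, -2, 1.\<close>
  have key: "15 * H = 2 * \<i> * H' - cnj H"
    using e unfolding H_def H'_def P by (simp add: complex_eq_iff pderiv_pCons algebra_simps)
  have wn: "w j * cnj (w j) = 1" if "j < 7" for j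
  proof -
    have "(fst (v j))\<^sup>2 + (snd (v j))\<^sup>2 = 1" using unit[OF that] by (simp add: norm_prod_def)
    then show ?thesis by (simp add: w_def complex_eq_iff power2_eq_square algebra_simps)
  qed
  have H: "H = (\<Prod>j<7. w j)" by (simp add: H_def P_def poly_prod wf)
  have HH: "H * cnj H = 1" unfolding H cnj_prod prod.distrib[symmetric] using wn by simp
  have nH: "norm (cnj H * cnj H) = 1"
  proof -
    have "norm (H * cnj H) = 1" by (simp only: HH norm_one)
    then show ?thesis by (simp add: norm_mult)
  qed
  have "H' = (\<Sum>j<7. (\<Prod>k\<in>{..<7} - {j}. w k) * of_real (fst (v j)))"
    unfolding H'_def P_def pderiv_prod by (simp add: poly_sum poly_prod wf) (simp add: f_def pderiv_pCons)
  also have "\<dots> = (\<Sum>j<7. H * (of_real (fst (v j)) * cnj (w j)))"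
  proof (intro sum.cong refl)
    fix j :: nat assume j: "j \<in> {..<7}"
    have hw: "H * cnj (w j) = (w j * cnj (w j)) * (\<Prod>k\<in>{..<7} - {j}. w k)"
      unfolding H using prod.remove[OF _ j, of w] by (simp add: mult_ac)
    have "w j * cnj (w j) = 1" using wn j by blast
    then have "(\<Prod>k\<in>{..<7} - {j}. w k) = H * cnj (w j)" unfolding hw by (simp only: mult_1_left)
    then show "(\<Prod>k\<in>{..<7} - {j}. w k) * of_real (fst (v j)) = H * (of_real (fst (v j)) * cnj (w j))"
      by (simp only: mult_ac)
  qed
  finally have H': "H' = H * (\<Sum>j<7. of_real (fst (v j)) * cnj (w j))" by (simp add: sum_distrib_left)
  have "15 = 15 * H * cnj H" using HH by (simp add: mult.assoc)
  also have "\<dots> = 2 * \<i> * H' * cnj H - cnj H * cnj H" unfolding key by (simp add: algebra_simps)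
  also have "2 * \<i> * H' * cnj H = 2 * \<i> * (\<Sum>j<7. of_real (fst (v j)) * cnj (w j)) * (H * cnj H)"
    unfolding H' by (simp only: mult_ac)
  finally have "15 = 2 * \<i> * (\<Sum>j<7. of_real (fst (v j)) * cnj (w j)) - cnj H * cnj H"
    by (simp only: HH mult_1_right)
  then have "Re 15 = Re (2 * \<i> * (\<Sum>j<7. of_real (fst (v j)) * cnj (w j)) - cnj H * cnj H)" by (rule arg_cong)
  then have "15 = 2 * (\<Sum>j<7. (fst (v j))\<^sup>2) - Re (cnj H * cnj H)"
    by (simp only: minus_complex.simps) (simp add: w_def sum_distrib_left power2_eq_square)
  moreover have "- Re (cnj H * cnj H) \<le> 1" using abs_Re_le_cmod[of "cnj H * cnj H"] nH by linarith
  \<comment> \<open>This is the extremal case: the seven unit vectors have total squared length 7,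
    so every \<open>snd (v j)\<close> vanishes and all roots lie at 0.\<close>
  ultimately have ge: "7 \<le> (\<Sum>j<7. (fst (v j))\<^sup>2)" by linarith
  have s1: "(fst (v j))\<^sup>2 + (snd (v j))\<^sup>2 = 1" if "j < 7" for j using unit[OF that]
    by (simp add: norm_prod_def)
  have "(\<Sum>j<7. (snd (v j))\<^sup>2) = (\<Sum>j<7. 1 - (fst (v j))\<^sup>2)"
    by (intro sum.cong refl) (use s1 in \<open>force simp: algebra_simps\<close>)
  also have "\<dots> \<le> 0" using ge by (simp add: sum_subtractf)
  finally have "(\<Sum>j<7. (snd (v j))\<^sup>2) = 0" by (simp add: sum_nonneg order_antisym)
  then have "snd (v j) = 0" if "j < 7" for j using that by (simp add: sum_nonneg_eq_0_iff)
  then have "h = (\<Prod>j<7. smult (fst (v j)) [:0, 1:])" unfolding h_def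
    by (intro prod.cong refl) (auto simp: lin_def)
  also have "\<dots> = smult (\<Prod>j<7. fst (v j)) (gpoly 7 0)"
    by (simp only: prod_smult prod_constant card_lessThan gpoly_def monom_altdef smult_1_left power_0 mult_1_right)
  finally show ?thesis unfolding h_def by blast
qed

section \<open>Forms with a constant gap near an explicit form\<close>

lemma constant_gap_iff_annih:
  fixes b :: "'a::comm_ring_1 ^ 9"
  assumes "r = m0 + mi + m1" "m1 \<le> 1" "r \<le> 8"
  shows "constant_gap m0 mi m1 b \<longleftrightarrow> annih b r (gpoly m0 m1)"
proof (cases "m1 = 0")
  case True
  have "pairing b (gpoly m0 m1 * monom 1 k) = b $ of_nat (m0 + k)" if "k \<le> 8 - r" for k
    using True that assms by (simp add: gpoly_def mult_monom pairing_monom del: of_nat_add)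
  then have "annih b r (gpoly m0 m1) \<longleftrightarrow> (\<forall>k\<le>8 - r. b $ of_nat (m0 + k) = 0)" by (simp add: annih_def)
  also have "\<dots> \<longleftrightarrow> (\<forall>i. m0 \<le> i \<longrightarrow> i \<le> 8 - mi \<longrightarrow> b $ of_nat i = 0)"
  proof (intro iffI allI impI)
    fix i assume *: "\<forall>k\<le>8 - r. b $ of_nat (m0 + k) = 0" "m0 \<le> i" "i \<le> 8 - mi"
    then have "i - m0 \<le> 8 - r" using assms True by simp
    then show "b $ of_nat i = 0" using * by (metis le_add_diff_inverse)
  qed (use assms True in \<open>auto simp del: of_nat_add\<close>)
  finally show ?thesis using True by (auto simp: constant_gap_def)
next
  case False
  then have m1: "m1 = 1" using assms by simp
  have g: "gpoly m0 m1 = (monom 1 (Suc m0) - monom 1 m0 :: 'a poly)"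
    unfolding gpoly_def m1 by (simp add: monom_Suc mult_monom algebra_simps)
  have "pairing b (gpoly m0 m1 * monom 1 k) = b $ of_nat (Suc (m0 + k)) - b $ of_nat (m0 + k)" if "k \<le> 8 - r"
    for k
    using that assms m1 unfolding g
      by (simp add: left_diff_distrib mult_monom pairing_diff pairing_monom del: of_nat_add of_nat_Suc)
  then have iff: "annih b r (gpoly m0 m1) \<longleftrightarrow> (\<forall>k\<le>8 - r. b $ of_nat (Suc (m0 + k)) = b $ of_nat (m0 + k))"
    by (simp add: annih_def)
  show ?thesis
  proof
    assume "constant_gap m0 mi m1 b"
    then obtain \<beta> where \<beta>: "\<And>i. m0 \<le> i \<Longrightarrow> i \<le> 8 - mi \<Longrightarrow> b $ of_nat i = \<beta>" by (auto simp: constant_gap_def)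
    show "annih b r (gpoly m0 m1)" unfolding iff
    proof (intro allI impI)
      fix k assume "k \<le> 8 - r"
      then show "b $ of_nat (Suc (m0 + k)) = b $ of_nat (m0 + k)"
        using \<beta>[of "Suc (m0 + k)"] \<beta>[of "m0 + k"] assms m1 by (simp del: of_nat_add of_nat_Suc)
    qed
  next
    assume "annih b r (gpoly m0 m1)"
    then have step: "\<And>k. k \<le> 8 - r \<Longrightarrow> b $ of_nat (Suc (m0 + k)) = b $ of_nat (m0 + k)" using iff by blast
    have con: "b $ of_nat (m0 + k) = b $ of_nat m0" if "k \<le> Suc (8 - r)" for k
      using that
    proof (induction k)
      case (Suc k) then show ?case using step[of k] by (simp del: of_nat_add of_nat_Suc)
    qed simp
    have "b $ of_nat i = b $ of_nat m0" if "m0 \<le> i" "i \<le> 8 - mi" for i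
    proof -
      have "i - m0 \<le> Suc (8 - r)" using that assms m1 by simp
      from con[OF this] show ?thesis by (simp only: le_add_diff_inverse[OF that(1)])
    qed
    then have "(m1 = 0 \<longrightarrow> b $ of_nat m0 = 0) \<and> (\<forall>i. m0 \<le> i \<longrightarrow> i \<le> 8 - mi \<longrightarrow> b $ of_nat i = b $ of_nat m0)"
      using False by blast
    then show "constant_gap m0 mi m1 b" unfolding constant_gap_def by (rule exI)
  qed
qed

lemma constant_gap_Pset:
  fixes b :: "real ^ 9"
  assumes "r = m0 + mi + m1" "m1 \<le> 1" "r \<le> 8" "constant_gap m0 mi m1 b"
  shows "b \<in> Pset r"
proof -
  define N where "N = replicate_mset m0 (1 :: real, 0 :: real) + replicate_mset mi (0, 1) + replicate_mset m1 (1, 1)"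
  have l: "lin (1 :: real, 0) = [:0, 1:]" "lin (0 :: real, 1) = [:-1:]" "lin (1 :: real, 1) = [:-1, 1:]"
    by (auto simp: lin_def one_pCons)
  have "lprod N = smult ((-1) ^ mi) (gpoly m0 m1)"
    unfolding N_def lprod_union by (simp add: lprod_def l gpoly_def monom_altdef poly_const_pow mult_ac)
  moreover have "annih b r (gpoly m0 m1)" using constant_gap_iff_annih[OF assms(1-3)] assms(4) by blast
  ultimately have "annih b r (lprod N)" by (simp add: annih_smult)
  moreover have "size N = r" "\<forall>v\<in>#N. v \<noteq> (0, 0)" using assms(1) by (auto simp: N_def split: if_splits)
  ultimately show ?thesis using PsetI by blast
qed

text \<open>If the perturbed forms returned to \<open>Pset r\<close> arbitrarily close to
  \<open>b0\<close>, sequences of counterexamples would contradict the local obstruction; this gives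
  a radius uniform in b and \<epsilon>.\<close>

lemma boundary_family:
  fixes b0 :: "real ^ 9"
  assumes m: "1 \<le> m0" "m1 \<le> 1" "r = m0 + mi + m1" "8 - r = Suc m1 + (if mi = 0 then 0 else 1)" "5 \<le> r" "r < 8"
    "r = 5 \<or> m1 = 0"
    and uniq: "\<And>v. (\<And>j. j < r \<Longrightarrow> norm (v j) = 1) \<Longrightarrow> annih b0 r (\<Prod>j<r. lin (v j)) \<Longrightarrow>
        \<exists>c. (\<Prod>j<r. lin (v j)) = smult c (gpoly m0 m1)"
    and pos: "b0 $ of_nat (m0 - 1) > b0 $ of_nat m0" "mi > 0 \<Longrightarrow> b0 $ of_nat (9 - mi) > b0 $ of_nat m0"
  shows "\<exists>\<delta>>0. \<forall>b. constant_gap m0 mi m1 b \<longrightarrow> dist b b0 < \<delta> \<longrightarrow> b \<in> topo_boundary 8 r \<inter> topo_boundary 8 (Suc r)"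
proof -
  have "\<exists>\<delta>>0. \<forall>b \<epsilon>. constant_gap m0 mi m1 b \<longrightarrow> dist b b0 < \<delta> \<longrightarrow> 0 < \<epsilon> \<longrightarrow> \<epsilon> < \<delta> \<longrightarrow> b - \<epsilon> *\<^sub>R evv (1, 2) \<notin> Pset r"
  proof (rule ccontr)
    assume "\<not> ?thesis"
    then have "\<forall>n::nat. \<exists>b \<epsilon>. constant_gap m0 mi m1 b \<and> dist b b0 < inverse (real (Suc n)) \<and> 0 < \<epsilon> \<and>
        \<epsilon> < inverse (real (Suc n)) \<and> b - \<epsilon> *\<^sub>R evv (1, 2) \<in> Pset r"
      by (meson inverse_positive_iff_positive of_nat_0_less_iff zero_less_Suc)
    then obtain b \<epsilon> where b: "\<And>n. constant_gap m0 mi m1 (b n)" "\<And>n. dist (b n) b0 < inverse (real (Suc n))"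
      and \<epsilon>: "\<And>n. 0 < \<epsilon> n" "\<And>n. \<epsilon> n < inverse (real (Suc n))" and P: "\<And>n. b n - \<epsilon> n *\<^sub>R evv (1, 2) \<in> Pset r"
      by metis
    have bl: "b \<longlonglongrightarrow> b0"
    proof (rule metric_LIMSEQ_I)
      fix e :: real assume "e > 0"
      then obtain N where N: "inverse (real (Suc N)) < e" using reals_Archimedean by blast
      show "\<exists>no. \<forall>n\<ge>no. dist (b n) b0 < e"
      proof (intro exI[of _ N] allI impI)
        fix n assume "n \<ge> N"
        then have "inverse (real (Suc n)) \<le> inverse (real (Suc N))" by (intro le_imp_inverse_le) auto
        then show "dist (b n) b0 < e" using b(2)[of n] N by linarith
      qed
    qed
    have \<epsilon>l: "\<epsilon> \<longlonglongrightarrow> 0"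
      by (rule tendsto_sandwich[OF _ _ tendsto_const LIMSEQ_inverse_real_of_nat])
         (use \<epsilon> in \<open>auto intro!: always_eventually less_imp_le simp del: of_nat_Suc\<close>)
    show False
      by (rule local_obstruction[OF m(1-4) _ uniq pos bl b(1) \<epsilon>l \<epsilon>(1) P]) (use m in auto)
  qed
  then obtain \<delta> where \<delta>: "\<delta> > 0"
    "\<And>b \<epsilon>. constant_gap m0 mi m1 b \<Longrightarrow> dist b b0 < \<delta> \<Longrightarrow> 0 < \<epsilon> \<Longrightarrow> \<epsilon> < \<delta> \<Longrightarrow> b - \<epsilon> *\<^sub>R evv (1, 2) \<notin> Pset r"
    by blast
  \<comment> \<open>An annihilator of degree r - 1 could be completed by a root at infinity as well
    as by a root at 0. Uniqueness in degree r would force both products to be multiples of the same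
    monomial, which is impossible.\<close>
  have "b0 \<notin> Pset (r - 1)" if r: "r \<noteq> 5"
  proof
    assume "b0 \<in> Pset (r - 1)"
    then obtain v where v: "\<And>j. j < r - 1 \<Longrightarrow> norm (v j) = 1" "annih b0 (r - 1) (\<Prod>j<r - 1. lin (v j))"
      unfolding Pset_unit_nodes by blast
    define h where "h = (\<Prod>j<r - 1. lin (v j))"
    have hnz: "h \<noteq> 0" using lin_nz[OF unit_nz[OF v(1)]] by (simp add: h_def)
    obtain s where s: "r = Suc s" using m(5) by (cases r) simp_all
    have m1: "m1 = 0" using m(7) r by simp
    have ext: "\<exists>c. h * lin w = smult c (monom 1 m0)" if w: "norm w = 1" for w
    proof -
      have eq: "(\<Prod>j<r. lin ((v(s := w)) j)) = h * lin w"
        unfolding s h_def by simp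
      have "annih b0 (r - 1 + 1) (h * lin w)"
        by (rule annih_mult[OF v(2)[folded h_def]]) (use degree_lin[of w] m s in auto)
      then have "annih b0 r (\<Prod>j<r. lin ((v(s := w)) j))" unfolding eq using s by simp
      then show ?thesis using uniq[of "v(s := w)"] v(1) w s unfolding eq by (auto simp: m1 gpoly_def)
    qed
    obtain c where c: "h * lin (0, 1) = smult c (monom 1 m0)" using ext[of "(0, 1)"] by auto
    obtain c' where c': "h * lin (1, 0) = smult c' (monom 1 m0)" using ext[of "(1, 0)"] by auto
    have "h = monom (- c) m0" using c by (simp add: lin_def smult_monom minus_monom[symmetric])
    then have "h * [:0, 1:] = monom (- c) (Suc m0)" by (simp add: monom_Suc)
    moreover have "h * [:0, 1:] = monom c' m0" using c' by (simp add: lin_def smult_monom)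
    ultimately have "monom (- c) (Suc m0) = monom c' m0" by simp
    then have "coeff (monom (- c) (Suc m0)) (Suc m0) = coeff (monom c' m0) (Suc m0)" by (simp only:)
    then have "c = 0" by simp
    then show False using hnz \<open>h = monom (- c) m0\<close> by simp
  qed
  then have "\<exists>\<delta>'>0. \<forall>b. dist b b0 < \<delta>' \<longrightarrow> r = 5 \<or> b \<notin> Pset (r - 1)"
  proof (cases "r = 5")
    case False
    assume "r \<noteq> 5 \<Longrightarrow> b0 \<notin> Pset (r - 1)"
    then have "b0 \<in> - Pset (r - 1)" using False by simp
    moreover have "open (- Pset (r - 1))" using closed_Pset by blast
    ultimately show ?thesis using False unfolding open_dist by (metis ComplD)
  qed (auto intro: exI[of _ 1])
  then obtain \<delta>' where \<delta>': "\<delta>' > 0" "\<And>b. dist b b0 < \<delta>' \<Longrightarrow> r = 5 \<or> b \<notin> Pset (r - 1)" by blast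
  show ?thesis
  proof (intro exI[of _ "min \<delta> \<delta>'"] conjI allI impI)
    fix b assume b: "constant_gap m0 mi m1 b" "dist b b0 < min \<delta> \<delta>'"
    show "b \<in> topo_boundary 8 r \<inter> topo_boundary 8 (Suc r)"
    proof (rule boundary_pointI[OF m(5,6)])
      show "b \<in> Pset r" using constant_gap_Pset[OF m(3,2) _ b(1)] m by simp
      show "r = 5 \<or> b \<notin> Pset (r - 1)" using \<delta>'(2) b by simp
      fix n :: nat
      have "\<delta> / 2 / real (Suc n) < \<delta>" using \<delta>(1) by (simp add: field_simps add_pos_nonneg)
      then show "b - (\<delta> / 2 / real (Suc n)) *\<^sub>R evv (1, 2) \<notin> Pset r"
        using \<delta> b by (intro \<delta>(2)) auto
    qed
  qed (use \<delta> \<delta>' in auto)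
qed

section \<open>The action of GL(2)\<close>

text \<open>The transpose of the substitution that replaces the two dual variables by A and B; on
  functionals it is given by its values on monomials.\<close>

definition act :: "'a::comm_ring_1 poly \<Rightarrow> 'a poly \<Rightarrow> 'a ^ 9 \<Rightarrow> 'a ^ 9" where
  "act A B b = vec_of (\<lambda>i. pairing b (A ^ (8 - i) * B ^ i))"

lemma pairing_act: "pairing (act A B b) P = pairing b (homp 8 P A B)"
  by (simp add: act_def pairing_def[of "vec_of _"] homp_def pairing_sum pairing_smult)

lemma homp_1: "homp 1 [:p, q:] A B = smult p A + smult q B" by (simp add: homp_def)

lemma homp_power:
  assumes "degree P \<le> 1" shows "homp k (P ^ k) A B = homp 1 P A B ^ k \<and> degree (P ^ k) \<le> k"
proof (induction k)
  case 0 show ?case by (simp add: homp_def)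
next
  case (Suc k)
  have "degree (P ^ Suc k) \<le> Suc k"
    using degree_mult_le[of P "P ^ k"] Suc assms by simp
  moreover have "homp (1 + k) (P * P ^ k) A B = homp 1 P A B * homp k (P ^ k) A B"
    by (rule homp_mult) (use Suc assms in auto)
  ultimately show ?case using Suc by simp
qed

lemma homp_monom: "i \<le> d \<Longrightarrow> homp d (monom 1 i) A B = A ^ (d - i) * B ^ i"
proof -
  assume i: "i \<le> d"
  have "homp d (monom 1 i) A B = (\<Sum>k\<le>d. if k = i then A ^ (d - i) * B ^ i else 0)"
    unfolding homp_def by (intro sum.cong) auto
  then show ?thesis using i by simp
qed

lemma act_act:
  "act [:p, q:] [:s, t:] (act A B b) = act (smult p A + smult q B) (smult s A + smult t B) b"
  unfolding vec9_eq_iff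
proof (intro allI impI)
  fix i :: nat assume i: "i \<le> 8"
  let ?A = "[:p, q:]" and ?B = "[:s, t:]"
  have d: "degree ?A \<le> 1" "degree ?B \<le> 1" by auto
  have "act ?A ?B (act A B b) $ of_nat i = pairing b (homp 8 (?A ^ (8 - i) * ?B ^ i) A B)"
    using i by (simp add: act_def[of ?A] pairing_act)
  also have "homp 8 (?A ^ (8 - i) * ?B ^ i) A B = homp ((8 - i) + i) (?A ^ (8 - i) * ?B ^ i) A B" using i
    by simp
  also have "\<dots> = homp (8 - i) (?A ^ (8 - i)) A B * homp i (?B ^ i) A B"
    by (rule homp_mult) (use homp_power[OF d(1)] homp_power[OF d(2)] in auto)
  also have "\<dots> = (smult p A + smult q B) ^ (8 - i) * (smult s A + smult t B) ^ i"
    using homp_power[OF d(1), of "8 - i" A B] homp_power[OF d(2), of i A B] by (simp only: homp_1)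
  finally show "act ?A ?B (act A B b) $ of_nat i =
      act (smult p A + smult q B) (smult s A + smult t B) b $ of_nat i"
    using i by (simp add: act_def)
qed

lemma act_id: "act 1 [:0, 1:] b = b"
  unfolding vec9_eq_iff
proof (intro allI impI)
  fix i :: nat assume i: "i \<le> 8"
  have "[:0, 1:] ^ i = (monom 1 i :: 'a poly)" by (simp add: monom_altdef)
  then show "act 1 [:0, 1:] b $ of_nat i = b $ of_nat i" using i by (simp add: act_def pairing_monom)
qed

lemma act_inverse:
  fixes p q s t :: "'a::field"
  assumes "p * t - q * s \<noteq> 0"
  obtains p' q' s' t' where "\<And>b. act [:p', q':] [:s', t':] (act [:p, q:] [:s, t:] b) = b"
    "\<And>b. act [:p, q:] [:s, t:] (act [:p', q':] [:s', t':] b) = b"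
proof -
  define D where "D = p * t - q * s"
  have D: "D \<noteq> 0" using assms by (simp add: D_def)
  have e: "smult (t / D) [:p, q:] + smult (- q / D) [:s, t:] = 1"
    "smult (- s / D) [:p, q:] + smult (p / D) [:s, t:] = [:0, 1:]"
    "smult p [:t / D, - q / D:] + smult q [:- s / D, p / D:] = 1"
      "smult s [:t / D, - q / D:] + smult t [:- s / D, p / D:] = [:0, 1:]"
    using D by (simp_all add: one_pCons field_simps) (simp_all add: D_def algebra_simps)
  show ?thesis
    by (rule that[of "t / D" "- q / D" "- s / D" "p / D"]) (simp_all only: act_act e act_id)
qed

lemma act_evv:
  fixes A B :: "real poly"
  assumes "degree A \<le> 1" "degree B \<le> 1"
  shows "act A B (evv v) = evv (heval 1 A v, heval 1 B v)"
  unfolding vec9_eq_iff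
proof (intro allI impI)
  fix i :: nat assume i: "i \<le> 8"
  have "heval ((8 - i) + i) (A ^ (8 - i) * B ^ i) v = heval (8 - i) (A ^ (8 - i)) v * heval i (B ^ i) v"
    by (rule heval_mult) (use heval_power[OF assms(1)] heval_power[OF assms(2)] in auto)
  also have "\<dots> = heval 1 A v ^ (8 - i) * heval 1 B v ^ i"
    using heval_power[OF assms(1), of "8 - i" v] heval_power[OF assms(2), of i v] by simp
  finally show "act A B (evv v) $ of_nat i = evv (heval 1 A v, heval 1 B v) $ of_nat i"
    using i by (simp add: act_def pairing_evv) (simp add: evv_def)
qed

lemma linear_act: "linear (act A B :: real ^ 9 \<Rightarrow> _)"
  by (rule linearI) (simp_all add: vec9_eq_iff act_def pairing_add_left pairing_scaleR_left)

lemma act_waring: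
  assumes "degree A \<le> 1" "degree B \<le> 1" "waring_decomp 8 r b"
  shows "waring_decomp 8 r (act A B b)"
proof -
  obtain c v where b: "b = (\<Sum>j<r. c j *\<^sub>R evv (v j))" using assms(3) by (auto simp: waring_iff)
  have "act A B b = (\<Sum>j<r. c j *\<^sub>R evv (heval 1 A (v j), heval 1 B (v j)))"
    unfolding b linear_sum[OF linear_act] linear_scale[OF linear_act] act_evv[OF assms(1,2)] by simp
  then show ?thesis unfolding waring_iff
    by (intro exI[of _ c] exI[of _ "\<lambda>j. (heval 1 A (v j), heval 1 B (v j))"])
qed

text \<open>An invertible substitution is a linear bijection that maps eighth powers to eighth
  powers, so it preserves rank, interiors and closures.\<close>

lemma act_boundary:
  fixes p q s t :: real
  assumes "p * t - q * s \<noteq> 0" "b \<in> topo_boundary 8 r"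
  shows "act [:p, q:] [:s, t:] b \<in> topo_boundary 8 r"
proof -
  let ?f = "act [:p, q:] [:s, t:]"
  obtain p' q' s' t' where inv: "\<And>b. act [:p', q':] [:s', t':] (?f b) = b"
    "\<And>b. ?f (act [:p', q':] [:s', t':] b) = b"
    using act_inverse[OF assms(1)] by blast
  let ?g = "act [:p', q':] [:s', t':]"
  have bij: "bij ?f" using inv by (metis bijI')
  have w: "waring_decomp 8 k (?f a) \<longleftrightarrow> waring_decomp 8 k a" for k a
    using act_waring[of "[:p, q:]" "[:s, t:]" k a] act_waring[of "[:p', q':]" "[:s', t':]" k "?f a"] inv(1)
      by auto
  then have rk: "real_rank 8 (?f a) = real_rank 8 a" for a by (simp add: real_rank_def)
  have "?f ` Omega 8 r = Omega 8 r"
  proof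
    show "?f ` Omega 8 r \<subseteq> Omega 8 r" using rk by (auto simp: Omega_def)
    show "Omega 8 r \<subseteq> ?f ` Omega 8 r"
    proof
      fix a :: "real ^ 9" assume "a \<in> Omega 8 r"
      then have "?g a \<in> Omega 8 r" using rk[of "?g a"] inv(2) by (simp add: Omega_def)
      then show "a \<in> ?f ` Omega 8 r" using inv(2)[of a] by (metis imageI)
    qed
  qed
  then have "?f ` Reg r = Reg r"
    unfolding rank_region_def using interior_bijective_linear_image[OF linear_act bij] by metis
  then have "?f ` closure (Reg r) = closure (Reg r)"
    using closure_injective_linear_image[OF linear_act bij_is_inj[OF bij]] by metis
  then have "?f ` topo_boundary 8 r = topo_boundary 8 r"
    unfolding topo_boundary_def image_set_diff[OF bij_is_inj[OF bij]]
    using interior_bijective_linear_image[OF linear_act bij] by metis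
  then show ?thesis using assms(2) by blast
qed

lemma homp_gpoly:
  fixes A B :: "'a::comm_ring_1 poly"
  assumes "m1 \<le> 1"
  shows "homp (m0 + mi + m1) (gpoly m0 m1) A B = A ^ mi * B ^ m0 * (B - A) ^ m1 \<and>
      degree (gpoly m0 m1 :: 'a poly) \<le> m0 + mi + m1"
proof -
  have d1: "degree ([:-1, 1:] :: 'a poly) \<le> 1" by simp
  have dm: "degree (monom 1 m0 :: 'a poly) \<le> m0 + mi" by (rule order_trans[OF degree_monom_le]) simp
  have dp: "degree ([:-1, 1:] ^ m1 :: 'a poly) \<le> m1" using homp_power[OF d1] by blast
  have "homp (m0 + mi + m1) (gpoly m0 m1) A B =
      homp (m0 + mi) (monom 1 m0) A B * homp m1 ([:-1, 1:] ^ m1) A B"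
    unfolding gpoly_def by (rule homp_mult[OF dm dp])
  also have "\<dots> = A ^ mi * B ^ m0 * (smult (-1) A + smult 1 B) ^ m1"
    using homp_power[OF d1, of m1 A B] by (simp add: homp_monom homp_1[unfolded One_nat_def])
  finally have "homp (m0 + mi + m1) (gpoly m0 m1) A B = A ^ mi * B ^ m0 * (B - A) ^ m1" by simp
  moreover have "degree (gpoly m0 m1 :: 'a poly) \<le> m0 + mi + m1"
    unfolding gpoly_def using degree_mult_le[of "monom 1 m0 :: 'a poly" "[:-1, 1:] ^ m1"] dm dp by linarith
  ultimately show ?thesis by blast
qed

text \<open>The substitution sends the roots infinity, 0 and 1 of \<open>gpoly m0 m1\<close> to the
  roots of A, B and B - A, keeping multiplicities. Hence the transformed form is annihilated by
  \<open>gpoly m0 m1\<close> whenever a is annihilated by the product.\<close>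

lemma annih_act_constant_gap:
  fixes a :: "'a::comm_ring_1 ^ 9"
  assumes r: "r = m0 + mi + m1" "m1 \<le> 1" "r \<le> 8" and d: "degree A \<le> 1" "degree B \<le> 1"
    and ann: "annih a r (A ^ mi * B ^ m0 * (B - A) ^ m1)"
  shows "constant_gap m0 mi m1 (act A B a)"
  unfolding constant_gap_iff_annih[OF r] annih_def
proof (intro allI impI)
  fix k assume k: "k \<le> 8 - r"
  have "pairing (act A B a) (gpoly m0 m1 * monom 1 k) =
      pairing a (homp (r + (8 - r)) (gpoly m0 m1 * monom 1 k) A B)"
    using r by (simp add: pairing_act)
  also have "homp (r + (8 - r)) (gpoly m0 m1 * monom 1 k) A B =
      homp r (gpoly m0 m1) A B * homp (8 - r) (monom 1 k) A B"
    by (rule homp_mult) (use homp_gpoly[OF r(2), of m0 mi A B] r k in \<open>auto intro: order_trans[OF degree_monom_le]\<close>)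
  also have "\<dots> = (A ^ mi * B ^ m0 * (B - A) ^ m1) * (A ^ (8 - r - k) * B ^ k)"
    using homp_gpoly[OF r(2), of m0 mi A B] r k by (simp add: homp_monom)
  also have "pairing a \<dots> = 0"
  proof (rule annih_pairing[OF ann])
    have "degree (A ^ (8 - r - k)) \<le> 8 - r - k" "degree (B ^ k) \<le> k"
      using homp_power[OF d(1), of "8 - r - k"] homp_power[OF d(2), of k] by blast+
    then show "degree (A ^ (8 - r - k) * B ^ k) \<le> 8 - r"
      using degree_mult_le[of "A ^ (8 - r - k)" "B ^ k"] k by linarith
  qed
  finally show "pairing (act A B a) (gpoly m0 m1 * monom 1 k) = 0" .
qed

section \<open>The dual loci as sets of annihilated forms\<close>

lemma dxs_eq: "dxs m k b i = (\<Prod>t<k. of_nat (m - t - i)) * b i"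
proof (induction k arbitrary: m b)
  case (Suc k)
  then show ?case by (simp add: prod.lessThan_Suc_shift del: prod.lessThan_Suc)
qed simp

lemma dy_pow_eq: "(dy ^^ j) b i = (\<Prod>t<j. of_nat (Suc i + t)) * b (i + j)"
proof (induction j arbitrary: i)
  case (Suc j)
  then show ?case by (simp add: dy_def prod.lessThan_Suc_shift del: prod.lessThan_Suc)
qed simp

lemma falling_prod: "n \<le> N \<Longrightarrow> (\<Prod>t<n. N - t) * fact (N - n) = (fact N :: nat)"
proof (induction n)
  case (Suc n)
  then have "fact (N - n) = (N - n) * (fact (N - Suc n) :: nat)"
    by (metis Suc_diff_Suc Suc_le_lessD fact_Suc of_nat_id)
  then show ?case using Suc by (simp add: mult.assoc)
qed simp

lemma rising_prod: "(\<Prod>t<j. Suc k + t) * fact k = (fact (k + j) :: nat)"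
proof (induction j)
  case (Suc j)
  have "(\<Prod>t<Suc j. Suc k + t) * fact k = (Suc k + j) * ((\<Prod>t<j. Suc k + t) * fact k)"
    by (simp only: prod.lessThan_Suc mult_ac)
  also have "\<dots> = fact (k + Suc j)" unfolding Suc by simp
  finally show ?case .
qed simp

text \<open>The factorials from the two derivatives cancel against the binomial coefficient of the
  coordinate and leave a factor that does not depend on j. It can therefore be taken out of the sum
  over the terms of the operator.\<close>

lemma derivative_coeff:
  fixes a :: "complex ^ 9"
  assumes "j \<le> e" "e \<le> 8"
  shows "dxs (8 - j) (e - j) ((dy ^^ j) (form_coeffs 8 a)) k =
    (if k \<le> 8 - e then fact 8 / (fact (8 - e - k) * fact k) * a $ of_nat (k + j) else 0)"
proof (cases "k \<le> 8 - e")
  case True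
  define X where "X = (\<Prod>t<e - j. 8 - j - t - k)"
  define Y where "Y = (\<Prod>t<j. Suc k + t)"
  have kj: "k + j \<le> 8" using True assms by simp
  have Xeq: "X = (\<Prod>t<e - j. (8 - j - k) - t)" unfolding X_def by (intro prod.cong) auto
  have X: "X * fact (8 - e - k) = fact (8 - j - k)"
  proof -
    have "8 - j - k - (e - j) = 8 - e - k" "e - j \<le> 8 - j - k" using True assms by auto
    then show ?thesis using falling_prod[of "e - j" "8 - j - k"] Xeq by (simp only:)
  qed
  have Y: "Y * fact k = fact (k + j)" unfolding Y_def by (rule rising_prod)
  have "fact (k + j) * fact (8 - (k + j)) * (8 choose (k + j)) = (fact 8 :: nat)"
    by (rule binomial_fact_lemma[OF kj])
  moreover have "8 - (k + j) = 8 - j - k" by simp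
  ultimately have "(X * Y * (8 choose (k + j))) * (fact (8 - e - k) * fact k) = (fact 8 :: nat)"
    unfolding X[symmetric] Y[symmetric] by (metis X Y mult.assoc mult.commute mult.left_commute)
  then have "(of_nat X * of_nat Y * of_nat (8 choose (k + j))) * (fact (8 - e - k) * fact k) =
      (fact 8 :: complex)"
    by (metis of_nat_fact of_nat_mult)
  moreover have "fact (8 - e - k) * fact k \<noteq> (0 :: complex)" by simp
  ultimately have "of_nat X * of_nat Y * of_nat (8 choose (k + j)) =
      fact 8 / (fact (8 - e - k) * fact k :: complex)"
    by (metis nonzero_mult_div_cancel_right)
  moreover have "dxs (8 - j) (e - j) ((dy ^^ j) (form_coeffs 8 a)) k =
      of_nat X * of_nat Y * of_nat (8 choose (k + j)) * a $ of_nat (k + j)"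
    using kj unfolding dxs_eq dy_pow_eq by (simp add: form_coeffs_def X_def Y_def mult.assoc)
  ultimately show ?thesis using True by simp
next
  case False
  show ?thesis
  proof (cases "k + j \<le> 8")
    case True
    \<comment> \<open>Differentiating this often in x passes through the exponent 0, at t = 8 - j -
      k, so the coefficient vanishes.\<close>
    have "(\<Prod>t<e - j. of_nat (8 - j - t - k)) = (0 :: complex)"
      by (rule prod_zero) (use False True assms in \<open>auto intro!: bexI[of _ "8 - j - k"]\<close>)
    then show ?thesis using False by (simp add: dxs_eq)
  next
    case F: False
    then have "form_coeffs 8 a (k + j) = 0" by (simp add: form_coeffs_def)
    then show ?thesis using False by (simp add: dxs_eq dy_pow_eq)
  qed
qed

lemma apply_op_annih:
  assumes "e \<le> 8" "degree G \<le> e"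
  shows "apply_op 8 e (coeff G) (form_coeffs 8 a) = (\<lambda>_. 0) \<longleftrightarrow> annih a e G"
proof -
  have ev: "apply_op 8 e (coeff G) (form_coeffs 8 a) k = (if k \<le>
      8 - e then fact 8 / (fact (8 - e - k) * fact k) * pairing a (G * monom 1 k) else 0)" for k
  proof (cases "k \<le> 8 - e")
    case True
    have "pairing a (monom 1 k * G) = (\<Sum>i\<le>e. coeff G i * pairing a (monom 1 k * monom 1 i))"
      by (rule pairing_mult_expand[OF assms(2)])
    also have "\<dots> = (\<Sum>i\<le>e. coeff G i * a $ of_nat (k + i))"
      using True assms by (intro sum.cong refl) (simp add: mult_monom pairing_monom del: of_nat_add)
    finally have "pairing a (G * monom 1 k) = (\<Sum>i\<le>e. coeff G i * a $ of_nat (k + i))"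
      by (simp add: mult.commute)
    moreover have "apply_op 8 e (coeff G) (form_coeffs 8 a) k =
        (\<Sum>j\<le>e. coeff G j * (fact 8 / (fact (8 - e - k) * fact k) * a $ of_nat (k + j)))"
      unfolding apply_op_def using derivative_coeff[OF _ assms(1), of _ a k] True
        by (intro sum.cong refl) simp
    moreover have "(\<Sum>j\<le>e. f j * (K * g j)) = K * (\<Sum>j\<le>e. f j * g j)" for K :: complex and f g
      by (simp add: sum_distrib_left mult_ac)
    ultimately show ?thesis using True by (simp only: if_True)
  next
    case False
    then show ?thesis unfolding apply_op_def using derivative_coeff[OF _ assms(1), of _ a k] by simp
  qed
  have "(\<lambda>k. apply_op 8 e (coeff G) (form_coeffs 8 a) k) = (\<lambda>_. 0) \<longleftrightarrow>
      (\<forall>k\<le>8 - e. pairing a (G * monom 1 k) = 0)"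
    unfolding fun_eq_iff ev by auto
  then show ?thesis by (simp add: annih_def)
qed

text \<open>Here l lists coefficients, as in the operators of the dual variety, whereas
  \<open>lin v\<close> is given by its zero: it is \<open>lform\<close> at (- snd v, fst v).\<close>

definition lform :: "'a::comm_ring_1 \<times> 'a \<Rightarrow> 'a poly" where "lform l = [:fst l, snd l:]"

lemma degree_lform: "degree (lform l) \<le> 1" by (simp add: lform_def)

lemma fmult_coeff: "fmult (coeff p) (coeff q) = coeff (p * q)"
  by (rule ext) (simp add: fmult_def coeff_mult)

lemma fone_coeff: "fone = coeff 1" by (rule ext) (simp add: fone_def)

lemma lin_form_coeff: "lin_form l = coeff (lform l)"
proof
  fix i show "lin_form l i = coeff (lform l) i"
    by (cases i; cases "i - 1") (auto simp: lin_form_def lform_def)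
qed

lemma lin_pow_coeff: "lin_pow l k = coeff (lform l ^ k)"
  unfolding lin_pow_def by (induction k) (simp_all add: fone_coeff lin_form_coeff fmult_coeff)

lemma crl_operator_coeff: "crl_operator lam ls = coeff (\<Prod>i<length lam. lform (ls i) ^ (lam ! i - 1))"
proof -
  have "foldr (\<lambda>i acc. fmult (lin_pow (ls i) (lam ! i - 1)) acc) xs fone =
      coeff (prod_list (map (\<lambda>i. lform (ls i) ^ (lam ! i - 1)) xs))" for xs
    by (induction xs) (simp_all add: fone_coeff lin_pow_coeff fmult_coeff)
  moreover have "prod_list (map (\<lambda>i. lform (ls i) ^ (lam ! i - 1)) [0..<length lam]) =
      (\<Prod>i<length lam. lform (ls i) ^ (lam ! i - 1))"
    by (subst prod.distinct_set_conv_list[symmetric]) (simp_all add: atLeast0LessThan)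
  ultimately show ?thesis by (simp add: crl_operator_def)
qed

definition annihilated_locus :: "nat list \<Rightarrow> (complex ^ 9) set" where
  "annihilated_locus lam = {a. \<exists>ls. (\<forall>i<length lam. ls i \<noteq> (0, 0)) \<and>
      annih a (8 - length lam) (\<Prod>i<length lam. lform (ls i) ^ (lam ! i - 1))}"

lemma degree_lform_product:
  "degree (\<Prod>i<n. lform (ls i) ^ e i) \<le> (\<Sum>i<n. e i)" for e :: "nat \<Rightarrow> nat"
proof (induction n)
  case (Suc n)
  have "degree (lform (ls n) ^ e n) \<le> e n" using homp_power[OF degree_lform, of "e n" "ls n"] by blast
  then show ?case using Suc degree_mult_le[of "\<Prod>i<n. lform (ls i) ^ e i" "lform (ls n) ^ e n"] by simp
qed simp

lemma dual_crl_annihilated_locus: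
  assumes "(\<Sum>i<length lam. lam ! i - 1) = 8 - length lam"
  shows "dual_crl 8 lam = zariski_closure (annihilated_locus lam)"
proof -
  have "apply_op 8 (8 - length lam) (crl_operator lam ls) (form_coeffs 8 a) = (\<lambda>_. 0) \<longleftrightarrow>
      annih a (8 - length lam) (\<Prod>i<length lam. lform (ls i) ^ (lam ! i - 1))" for ls and a :: "complex ^ 9"
    unfolding crl_operator_coeff using degree_lform_product[of ls "\<lambda>i. lam ! i - 1" "length lam"] assms
    by (intro apply_op_annih) auto
  then show ?thesis by (simp add: dual_crl_def annihilated_locus_def)
qed

section \<open>Zariski density of the real families\<close>

definition separately_poly :: "((nat \<Rightarrow> complex) \<Rightarrow> complex) \<Rightarrow> bool" where
  "separately_poly \<Phi> \<longleftrightarrow> (\<forall>x i. \<exists>P. \<forall>t. \<Phi> (x(i := t)) = poly P t)"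

lemma separately_poly_const: "separately_poly (\<lambda>x. c)" unfolding separately_poly_def
  by (intro allI exI[of _ "[:c:]"]) simp

lemma separately_poly_var: "separately_poly (\<lambda>x. x k)"
  unfolding separately_poly_def
proof (intro allI)
  fix x :: "nat \<Rightarrow> complex" and i
  show "\<exists>P. \<forall>t. (x(i := t)) k = poly P t"
    by (cases "i = k") (auto intro: exI[of _ "[:0, 1:]"] exI[of _ "[:x k:]"])
qed

lemma separately_poly_add: "separately_poly f \<Longrightarrow> separately_poly g \<Longrightarrow> separately_poly (\<lambda>x. f x + g x)"
  unfolding separately_poly_def by (metis poly_add)

lemma separately_poly_mult: "separately_poly f \<Longrightarrow> separately_poly g \<Longrightarrow> separately_poly (\<lambda>x. f x * g x)"
  unfolding separately_poly_def by (metis poly_mult)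

lemma separately_poly_sum: "(\<And>i. i \<in> I \<Longrightarrow> separately_poly (f i)) \<Longrightarrow> separately_poly (\<lambda>x. \<Sum>i\<in>I. f i x)"
  by (induction I rule: infinite_finite_induct) (auto intro: separately_poly_const separately_poly_add)

lemma separately_poly_if: "separately_poly f \<Longrightarrow> separately_poly g \<Longrightarrow>
    separately_poly (\<lambda>x. if b then f x else g x)" by (cases b) auto

lemma separately_poly_coeff_mult:
  assumes "\<And>k. separately_poly (\<lambda>x. coeff (f x) k)" "\<And>k. separately_poly (\<lambda>x. coeff (g x) k)"
  shows "separately_poly (\<lambda>x. coeff (f x * g x) k)"
  unfolding coeff_mult by (intro separately_poly_sum separately_poly_mult assms)

lemma separately_poly_coeff_power:
  assumes "\<And>k. separately_poly (\<lambda>x. coeff (f x) k)" shows "separately_poly (\<lambda>x. coeff (f x ^ n) k)"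
proof (induction n arbitrary: k)
  case 0 show ?case by (simp add: separately_poly_const)
next
  case (Suc n) then show ?case unfolding power_Suc by (intro separately_poly_coeff_mult assms)
qed

lemma separately_poly_coeff_linear:
  assumes "separately_poly f" "separately_poly g" shows "separately_poly (\<lambda>x. coeff [:f x, g x:] k)"
proof -
  consider "k = 0" | "k = 1" | "k \<ge> 2" by linarith
  then show ?thesis
  proof cases
    case 3
    then have "coeff [:f x, g x:] k = 0" for x by (intro coeff_eq_0) (auto split: if_splits)
    then show ?thesis by (simp add: separately_poly_const)
  qed (use assms in auto)
qed

lemma separately_poly_poly_fun:
  assumes "p \<in> poly_fun" "\<And>i. separately_poly (\<lambda>x. \<Psi> x $ i)" shows "separately_poly (\<lambda>x. p (\<Psi> x))"
  using assms(1) by induction (auto intro: separately_poly_const separately_poly_add separately_poly_mult assms(2))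

text \<open>The variables are released from their sets one after another: in each variable the
  function is a polynomial with infinitely many zeros.\<close>

lemma separately_poly_vanish:
  assumes \<Phi>: "separately_poly \<Phi>" and S: "\<And>i. i < N \<Longrightarrow> infinite (S i)"
    and z: "\<And>x. (\<forall>i<N. x i \<in> S i) \<Longrightarrow> \<Phi> x = 0"
  shows "\<Phi> x = 0"
proof -
  have "\<forall>x. (\<forall>i<N. k \<le> i \<longrightarrow> x i \<in> S i) \<longrightarrow> \<Phi> x = 0" if "k \<le> N" for k
    using that
  proof (induction k)
    case 0 then show ?case using z by auto
  next
    case (Suc k)
    show ?case
    proof (intro allI impI)
      fix x assume x: "\<forall>i<N. Suc k \<le> i \<longrightarrow> x i \<in> S i"
      obtain P where P: "\<And>t. \<Phi> (x(k := t)) = poly P t" using \<Phi> unfolding separately_poly_def by metis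
      have "poly P t = 0" if "t \<in> S k" for t
      proof -
        have "\<forall>i<N. k \<le> i \<longrightarrow> (x(k := t)) i \<in> S i" using x that by (auto simp: Suc_le_eq order.order_iff_strict)
        then show ?thesis using Suc unfolding P[symmetric] by auto
      qed
      then have "S k \<subseteq> {t. poly P t = 0}" by blast
      then have "P = 0" using S[of k] Suc.prems poly_roots_finite[of P] by (meson Suc_le_lessD finite_subset)
      then show "\<Phi> x = 0" using P[of "x k"] by simp
    qed
  qed
  from this[of N] show ?thesis by auto
qed

lemma dist_vec9_less:
  fixes a b :: "real ^ 9"
  assumes "\<And>i. i \<le> 8 \<Longrightarrow> \<bar>a $ of_nat i - b $ of_nat i\<bar> < e / 9"
  shows "dist a b < e"
proof -
  have "norm (a - b) \<le> (\<Sum>k\<in>UNIV. \<bar>(a - b) $ k\<bar>)" by (rule norm_le_l1_cart)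
  also have "\<dots> < (\<Sum>k\<in>(UNIV::9 set). e / 9)"
  proof (rule sum_strict_mono)
    fix k :: 9
    obtain i where "i \<le> 8" "k = of_nat i" using ex_of_nat_9 by blast
    then show "\<bar>(a - b) $ k\<bar> < e / 9" using assms by simp
  qed auto
  finally show ?thesis by (simp add: dist_norm)
qed

definition complexifies :: "real poly \<Rightarrow> complex poly \<Rightarrow> bool" where
  "complexifies p P \<longleftrightarrow> (\<forall>i. coeff P i = complex_of_real (coeff p i))"

lemma complexifies_mult: "complexifies p P \<Longrightarrow> complexifies q Q \<Longrightarrow> complexifies (p * q) (P * Q)"
  by (simp add: complexifies_def coeff_mult)

lemma complexifies_one: "complexifies 1 1" by (simp add: complexifies_def)

lemma complexifies_power: "complexifies p P \<Longrightarrow> complexifies (p ^ k) (P ^ k)"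
  by (induction k) (auto intro: complexifies_mult complexifies_one)

lemma complexifies_linear: "complexifies [:a, b:] [:complex_of_real a, complex_of_real b:]"
  unfolding complexifies_def
proof
  fix i show "coeff [:complex_of_real a, complex_of_real b:] i = complex_of_real (coeff [:a, b:] i)"
    by (cases i; cases "i - 1") auto
qed

lemma complexifies_monom: "complexifies (monom 1 k) (monom 1 k)" by (simp add: complexifies_def)

lemma pairing_complexify: "complexifies p P \<Longrightarrow> pairing (complexify a) P = complex_of_real (pairing a p)"
  by (simp add: pairing_def complexify_def complexifies_def)

lemma complexify_act:
  "complexify (act [:p, q:] [:s, t:] b) =
      act [:complex_of_real p, complex_of_real q:] [:complex_of_real s, complex_of_real t:] (complexify b)"
  unfolding vec9_eq_iff
proof (intro allI impI)
  fix i :: nat assume i: "i \<le> 8"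
  have "complexifies ([:p, q:] ^ (8 - i) * [:s, t:] ^ i) ([:complex_of_real p, complex_of_real q:] ^ (8 - i) * [:complex_of_real s, complex_of_real t:] ^ i)"
    by (intro complexifies_mult complexifies_power complexifies_linear)
  from pairing_complexify[OF this, of b] show "complexify (act [:p, q:] [:s, t:] b) $ of_nat i =
      act [:complex_of_real p, complex_of_real q:] [:complex_of_real s, complex_of_real t:] (complexify b) $ of_nat i"
    using i by (simp add: act_def) (simp add: complexify_def)
qed

lemma annih_complexify: "complexifies g G \<Longrightarrow> annih a e g \<Longrightarrow> annih (complexify a) e G"
  unfolding annih_def using pairing_complexify[OF complexifies_mult[OF _ complexifies_monom]] by simp

text \<open>The variables 0 to 3 are reserved for the entries of a matrix in GL(2), the variable 4 + i for the
i-th coefficient, and the variable 13 for the common value of the coefficients between m0 and 8 - mi.\<close>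

definition gap_vec :: "nat \<Rightarrow> nat \<Rightarrow> nat \<Rightarrow> (nat \<Rightarrow> 'a::zero) \<Rightarrow> 'a ^ 9" where
  "gap_vec m0 mi m1 x = vec_of (\<lambda>i. if m0 \<le> i \<and> i \<le> 8 - mi then (if m1 = 0 then 0 else x 13) else x (4 + i))"

lemma constant_gap_gap_vec: "constant_gap m0 mi m1 (gap_vec m0 mi m1 x)"
  unfolding constant_gap_def
proof (intro exI[of _ "if m1 = 0 then 0 else x 13"] conjI allI impI)
  fix i assume "m0 \<le> i" "i \<le> 8 - mi"
  moreover from this have "i \<le> 8" by simp
  ultimately show "gap_vec m0 mi m1 x $ of_nat i = (if m1 = 0 then 0 else x 13)" by (simp add: gap_vec_def)
qed simp

text \<open>The composite of p with the action is polynomial in each matrix entry and each free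
  coordinate. It vanishes on a box of real parameters around \<open>b0\<close>, since the boundary
  is stable under real invertible matrices, and hence for all complex parameters.\<close>

lemma family_vanish:
  fixes b0 :: "real ^ 9"
  assumes p: "p \<in> poly_fun" "\<And>b. b \<in> topo_boundary 8 r \<Longrightarrow> p (complexify b) = 0"
    and \<delta>: "\<delta> > 0" "\<And>b. constant_gap m0 mi m1 b \<Longrightarrow> dist b b0 < \<delta> \<Longrightarrow> b \<in> topo_boundary 8 r"
    and b0: "constant_gap m0 mi m1 b0" and m: "m0 + mi \<le> 8" and b: "constant_gap m0 mi m1 b"
  shows "p (act [:k0, k1:] [:k2, k3:] b) = 0"
proof -
  define \<Psi> where "\<Psi> = (\<lambda>x :: nat \<Rightarrow> complex. act [:x 0, x 1:] [:x 2, x 3:] (gap_vec m0 mi m1 x))"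
  have comp: "separately_poly (\<lambda>x. \<Psi> x $ of_nat i)" if "i \<le> 8" for i
  proof -
    have "separately_poly (\<lambda>x. gap_vec m0 mi m1 x $ of_nat k)" if "k \<le> 8" for k
      using that by (simp add: gap_vec_def) (intro separately_poly_if separately_poly_var separately_poly_const)
    then have "separately_poly (\<lambda>x. \<Sum>k\<le>8. coeff ([:x 0, x 1:] ^ (8 - i) * [:x 2, x 3:] ^ i) k * gap_vec m0 mi m1 x $ of_nat k)"
      by (intro separately_poly_sum separately_poly_mult separately_poly_coeff_mult separately_poly_coeff_power separately_poly_coeff_linear separately_poly_var) auto
    then show ?thesis using that by (simp add: \<Psi>_def act_def pairing_def)
  qed
  have sp: "separately_poly (\<lambda>x. p (\<Psi> x))"
    by (rule separately_poly_poly_fun[OF p(1)]) (use comp ex_of_nat_9 in metis)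
  define c where "c = (\<lambda>i. if i = 13 then b0 $ of_nat m0 else b0 $ of_nat (i - 4))"
  \<comment> \<open>The diagonal entries range over (1, 2) and the others over (0, 1/2), so the
    determinant exceeds 3/4 on the box; the coordinates stay within \<delta> / 9 of those of
    \<open>b0\<close>.\<close>
  define lo where "lo = (\<lambda>i. if i = 0 \<or> i = 3 then 1 else if i < 4 then 0 else c i - \<delta> / 9)"
  define hi where "hi = (\<lambda>i. if i = 0 \<or> i = 3 then 2 else if i < 4 then 1 / 2 else c i + \<delta> / 9)"
  define S where "S = (\<lambda>i::nat. complex_of_real ` {lo i<..<hi i})"
  have inf: "infinite (S i)" for i
    using \<delta>(1) unfolding S_def by (subst finite_image_iff) (auto simp: inj_on_def lo_def hi_def)
  have zero: "p (\<Psi> x) = 0" if x: "\<forall>i<14. x i \<in> S i" for x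
  proof -
    have "\<forall>i. \<exists>t. i < 14 \<longrightarrow> x i = complex_of_real t \<and> lo i < t \<and> t < hi i" using x by (auto simp: S_def)
    then obtain y where y: "\<And>i. i < 14 \<Longrightarrow> x i = complex_of_real (y i)" "\<And>i. i < 14 \<Longrightarrow> lo i < y i \<and> y i < hi i"
      by metis
    have bx: "gap_vec m0 mi m1 x = complexify (gap_vec m0 mi m1 y)"
      unfolding vec9_eq_iff by (auto simp: gap_vec_def complexify_def y(1))
    have "dist (gap_vec m0 mi m1 y) b0 < \<delta>"
    proof (rule dist_vec9_less)
      fix i :: nat assume i: "i \<le> 8"
      obtain \<beta> where \<beta>: "m1 = 0 \<Longrightarrow> \<beta> = 0" "\<And>i. m0 \<le> i \<Longrightarrow> i \<le> 8 - mi \<Longrightarrow> b0 $ of_nat i = \<beta>"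
        using b0 by (auto simp: constant_gap_def)
      have m08: "b0 $ of_nat m0 = \<beta>" using \<beta>(2)[of m0] m by simp
      have y13: "\<bar>y 13 - \<beta>\<bar> < \<delta> / 9"
      proof -
        have "lo 13 = \<beta> - \<delta> / 9" "hi 13 = \<beta> + \<delta> / 9" using m08 by (auto simp: lo_def hi_def c_def)
        then show ?thesis using y(2)[of 13] by (simp only: abs_less_iff) linarith
      qed
      have y4: "\<bar>y (4 + i) - b0 $ of_nat i\<bar> < \<delta> / 9"
      proof -
        have "lo (4 + i) = b0 $ of_nat i - \<delta> / 9" "hi (4 + i) = b0 $ of_nat i + \<delta> / 9" using i
          by (auto simp: lo_def hi_def c_def)
        moreover have "lo (4 + i) < y (4 + i) \<and> y (4 + i) < hi (4 + i)" by (rule y(2)) (use i in simp)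
        ultimately show ?thesis by (simp only: abs_less_iff) linarith
      qed
      show "\<bar>gap_vec m0 mi m1 y $ of_nat i - b0 $ of_nat i\<bar> < \<delta> / 9"
        using i y13 y4 \<beta> \<delta>(1) by (auto simp: gap_vec_def)
    qed
    then have "gap_vec m0 mi m1 y \<in> topo_boundary 8 r" using \<delta>(2) constant_gap_gap_vec by blast
    moreover have "y 0 * y 3 - y 1 * y 2 \<noteq> 0"
    proof -
      have yy: "1 < y 0" "1 < y 3" "0 < y 1" "y 1 < 1/2" "0 < y 2" "y 2 < 1/2"
        using y(2)[of 0] y(2)[of 3] y(2)[of 1] y(2)[of 2] by (auto simp: lo_def hi_def)
      have "1 * 1 < y 0 * y 3" using yy by (intro mult_strict_mono) auto
      moreover have "y 1 * y 2 \<le> (1/2) * (1/2)" using yy by (intro mult_mono) auto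
      ultimately show ?thesis by simp
    qed
    ultimately have "p (complexify (act [:y 0, y 1:] [:y 2, y 3:] (gap_vec m0 mi m1 y))) = 0"
      using p(2) act_boundary by blast
    then show ?thesis unfolding \<Psi>_def bx complexify_act by (simp add: y(1))
  qed
  obtain \<beta> where \<beta>: "m1 = 0 \<Longrightarrow> \<beta> = 0" "\<And>i. m0 \<le> i \<Longrightarrow> i \<le> 8 - mi \<Longrightarrow> b $ of_nat i = \<beta>"
    using b by (auto simp: constant_gap_def)
  define x where "x = (\<lambda>i::nat. if i = 0 then k0 else if i = 1 then k1 else if i =
      2 then k2 else if i = 3 then k3
    else if i = 13 then \<beta> else b $ of_nat (i - 4))"
  have "gap_vec m0 mi m1 x = b" unfolding vec9_eq_iff using \<beta> by (auto simp: gap_vec_def x_def)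
  then have "\<Psi> x = act [:k0, k1:] [:k2, k3:] b" by (simp add: \<Psi>_def x_def)
  moreover have "p (\<Psi> x) = 0" by (rule separately_poly_vanish[OF sp, of 14 S]) (use inf zero in auto)
  ultimately show ?thesis by simp
qed

text \<open>Independence of u and w makes the substitution by them invertible. It carries a into the
  gap family, and the inverse substitution is one of the complex matrices to which the vanishing
  extends.\<close>

lemma family_annih_vanish:
  fixes b0 :: "real ^ 9"
  assumes p: "p \<in> poly_fun" "\<And>b. b \<in> topo_boundary 8 k \<Longrightarrow> p (complexify b) = 0"
    and \<delta>: "\<delta> > 0" "\<And>b. constant_gap m0 mi m1 b \<Longrightarrow> dist b b0 < \<delta> \<Longrightarrow> b \<in> topo_boundary 8 k"
    and b0: "constant_gap m0 mi m1 b0" and r: "r = m0 + mi + m1" "m1 \<le> 1" "r \<le> 8"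
    and ann: "annih a r (lform u ^ mi * lform w ^ m0 * (lform w - lform u) ^ m1)" and det: "ndet u w \<noteq> 0"
  shows "p a = 0"
proof -
  have constant_gap: "constant_gap m0 mi m1 (act (lform u) (lform w) a)"
    by (rule annih_act_constant_gap[OF r degree_lform degree_lform ann])
  have "fst u * snd w - snd u * fst w \<noteq> 0" using det by (simp add: ndet_def)
  then obtain p' q' s' t' where "act [:p', q':] [:s', t':] (act (lform u) (lform w) a) = a"
    unfolding lform_def by (rule act_inverse) blast
  moreover have "p (act [:p', q':] [:s', t':] (act (lform u) (lform w) a)) = 0"
    by (rule family_vanish[OF p \<delta> b0 _ constant_gap]) (use r in auto)
  ultimately show ?thesis by simp
qed

lemma lform_scale: "lform (c * fst l, c * snd l) = smult c (lform l)" by (simp add: lform_def)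

lemma poly_fun_tendsto: "p \<in> poly_fun \<Longrightarrow> (f \<longlongrightarrow> l) F \<Longrightarrow> ((\<lambda>t. p (f t)) \<longlongrightarrow> p l) F"
proof (induction rule: poly_fun.induct)
  case (pf_coord i) then show ?case by (intro tendsto_vec_nth)
qed (auto intro: tendsto_add tendsto_mult)

text \<open>Coinciding linear forms cannot be moved to distinct points by GL(2). They are limits of
  pairwise independent ones, the form a can be carried along with them, and p is continuous.\<close>

lemma annihilated_locus_vanish:
  assumes p: "p \<in> poly_fun"
    and indep: "\<And>ls b. (\<forall>i<length lam. ls i \<noteq> (0,0)) \<Longrightarrow> (\<forall>i<length lam. \<forall>j<length lam. i \<noteq> j \<longrightarrow>
        ndet (ls i) (ls j) \<noteq> 0) \<Longrightarrow>
      annih b (8 - length lam) (\<Prod>i<length lam. lform (ls i) ^ (lam ! i - 1)) \<Longrightarrow> p b = 0"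
    and sum: "(\<Sum>i<length lam. lam ! i - 1) = 8 - length lam" and a: "a \<in> annihilated_locus lam"
  shows "p a = 0"
proof -
  let ?n = "length lam"
  obtain ls where ls: "\<forall>i<?n. ls i \<noteq> (0, 0)" "annih a (8 - ?n) (\<Prod>i<?n. lform (ls i) ^ (lam ! i - 1))"
    using a by (auto simp: annihilated_locus_def)
  let ?G = "\<lambda>ls. \<Prod>i<?n. lform (ls i) ^ (lam ! i - 1)"
  have dG: "degree (?G ls') \<le> 8 - ?n" for ls' :: "nat \<Rightarrow> complex \<times> complex"
    using degree_lform_product[of ls' "\<lambda>i. lam ! i - 1" ?n] sum by simp
  have "lform (ls i) \<noteq> 0" if "i < ?n" for i using ls(1) that by (cases "ls i") (auto simp: lform_def)
  then have Gnz: "?G ls \<noteq> 0" by simp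
  have "\<forall>k. \<exists>l'. (\<forall>i<?n. norm (l' i - ls i) < inverse (real (Suc k)) \<and> l' i \<noteq> (0, 0)) \<and>
      (\<forall>i<?n. \<forall>j<?n. i \<noteq> j \<longrightarrow> ndet (l' i) (l' j) \<noteq> 0)"
    by (intro allI independent_nodes_dense) simp
  then obtain l' where l': "\<And>k i. i < ?n \<Longrightarrow> norm (l' k i - ls i) < inverse (real (Suc k))"
    "\<And>k. \<forall>i<?n. l' k i \<noteq> (0, 0)" "\<And>k. \<forall>i<?n. \<forall>j<?n. i \<noteq> j \<longrightarrow> ndet (l' k i) (l' k j) \<noteq> 0" by metis
  have ll: "(\<lambda>k. l' k i) \<longlonglongrightarrow> ls i" if "i < ?n" for i
  proof -
    have "(\<lambda>k. l' k i - ls i) \<longlonglongrightarrow> 0"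
      by (rule tendsto_0_le[OF LIMSEQ_inverse_real_of_nat, of _ 1])
         (use l'(1)[OF that] in \<open>auto intro!: always_eventually less_imp_le simp del: of_nat_Suc\<close>)
    then show ?thesis by (simp add: LIM_zero_iff)
  qed
  have Gl: "ptends (\<lambda>k. ?G (l' k)) (?G ls) sequentially"
    unfolding lform_def by (intro ptends_prod ptends_power ptends_linear tendsto_fst tendsto_snd ll) auto
  have "\<exists>x. (\<forall>i\<le>8. norm (x i - a $ of_nat i) < inverse (real (Suc n))) \<and> p (vec_of x) = 0" for n
  proof -
    have "\<forall>\<^sub>F k in sequentially. \<exists>x. (\<forall>i\<le>8. norm (x i - a $ of_nat i) < inverse (real (Suc n))) \<and>
        annih (vec_of x) (8 - ?n) (?G (l' k))"
      by (rule annih_perturb[OF Gl Gnz ls(2) _ dG dG]) simp_all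
    then obtain k x where "\<forall>i\<le>8. norm (x i - a $ of_nat i) < inverse (real (Suc n))"
      "annih (vec_of x) (8 - ?n) (?G (l' k))"
      by (auto dest!: eventually_happens)
    then show ?thesis using indep[OF l'(2,3)] by blast
  qed
  then obtain x where x: "\<And>n i. i \<le> 8 \<Longrightarrow> norm (x n i - a $ of_nat i) < inverse (real (Suc n))"
    "\<And>n. p (vec_of (x n)) = 0" by metis
  have "(\<lambda>n. vec_of (x n)) \<longlonglongrightarrow> a"
  proof (rule tendsto_vec9)
    fix i :: nat assume i: "i \<le> 8"
    have "(\<lambda>n. x n i - a $ of_nat i) \<longlonglongrightarrow> 0"
      by (rule tendsto_0_le[OF LIMSEQ_inverse_real_of_nat, of _ 1])
         (use x(1)[OF i] in \<open>auto intro!: always_eventually less_imp_le simp del: of_nat_Suc\<close>)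
    then show "(\<lambda>n. vec_of (x n) $ of_nat i) \<longlonglongrightarrow> a $ of_nat i" using i by (simp add: LIM_zero_iff)
  qed
  from poly_fun_tendsto[OF p this] show ?thesis using x(2) by (simp add: LIMSEQ_const_iff)
qed

section \<open>From the gap families to the dual loci\<close>

definition gap_boundary :: "nat \<Rightarrow> nat \<Rightarrow> nat \<Rightarrow> nat \<Rightarrow> bool" where
  "gap_boundary m0 mi m1 k \<longleftrightarrow> (\<exists>b0 \<delta>. \<delta> > 0 \<and> constant_gap m0 mi m1 b0 \<and>
      (\<forall>b. constant_gap m0 mi m1 b \<longrightarrow> dist b b0 < \<delta> \<longrightarrow> b \<in> topo_boundary 8 k))"

lemma alg_boundary_vanish: "a \<in> alg_boundary 8 k \<longleftrightarrow>
    (\<forall>p\<in>poly_fun. (\<forall>b\<in>topo_boundary 8 k. p (complexify b) = 0) \<longrightarrow> p a = 0)"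
  by (simp add: alg_boundary_def zariski_closure_def)

lemma gap_boundary_annih:
  assumes "gap_boundary m0 mi m1 k" "m0 + mi + m1 \<le> 8" "m1 \<le> 1"
    "p \<in> poly_fun" "\<forall>b\<in>topo_boundary 8 k. p (complexify b) = 0"
    "annih a (m0 + mi + m1) (lform u ^ mi * lform w ^ m0 * (lform w - lform u) ^ m1)" "ndet u w \<noteq> 0"
  shows "p a = 0"
  using assms family_annih_vanish[of p k _ m0 mi m1 _ "m0 + mi + m1" a u w] unfolding gap_boundary_def
    by blast

lemma locus2_subset:
  assumes f: "gap_boundary m0 mi 0 k" and m: "m0 + mi = 6" "lam = [Suc m0, Suc mi]"
  shows "annihilated_locus lam \<subseteq> alg_boundary 8 k"
proof
  fix a assume a: "a \<in> annihilated_locus lam"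
  show "a \<in> alg_boundary 8 k" unfolding alg_boundary_vanish
  proof (intro ballI impI)
    fix p :: "complex ^ 9 \<Rightarrow> complex" assume p: "p \<in> poly_fun" "\<forall>b\<in>topo_boundary 8 k. p (complexify b) = 0"
    show "p a = 0"
    proof (rule annihilated_locus_vanish[OF p(1) _ _ a])
      fix ls b assume ls: "\<forall>i<length lam. \<forall>j<length lam. i \<noteq> j \<longrightarrow> ndet (ls i) (ls j) \<noteq> (0::complex)"
        "annih b (8 - length lam) (\<Prod>i<length lam. lform (ls i) ^ (lam ! i - 1))"
      have "(\<Prod>i<length lam. lform (ls i) ^ (lam ! i - 1)) = lform (ls 0) ^ m0 * lform (ls 1) ^ mi"
        by (simp add: m(2) numeral_2_eq_2)
      then have "annih b (m0 + mi + 0) (lform (ls 1) ^ mi * lform (ls 0) ^ m0 * (lform (ls 0) - lform (ls 1)) ^ 0)"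
        using ls(2) m by (simp add: mult.commute)
      moreover have "ndet (ls 1) (ls 0) \<noteq> 0" using ls(1) m(2) by simp
      ultimately show "p b = 0" using gap_boundary_annih[OF f _ _ p, of b "ls 1" "ls 0"] m(1) by simp
    qed (use m in \<open>simp add: numeral_2_eq_2\<close>)
  qed
qed

lemma locus1_subset:
  assumes f: "gap_boundary 7 0 0 k"
  shows "annihilated_locus [8] \<subseteq> alg_boundary 8 k"
proof
  fix a assume a: "a \<in> annihilated_locus [8]"
  show "a \<in> alg_boundary 8 k" unfolding alg_boundary_vanish
  proof (intro ballI impI)
    fix p :: "complex ^ 9 \<Rightarrow> complex" assume p: "p \<in> poly_fun" "\<forall>b\<in>topo_boundary 8 k. p (complexify b) = 0"
    show "p a = 0"
    proof (rule annihilated_locus_vanish[OF p(1) _ _ a])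
      fix ls b assume ls: "\<forall>i<length [8::nat]. ls i \<noteq> (0, 0 :: complex)"
        "annih b (8 - length [8::nat]) (\<Prod>i<length [8::nat]. lform (ls i) ^ ([8] ! i - 1))"
      \<comment> \<open>Only one linear form is given; u is some form independent of it and enters
        with exponent 0.\<close>
      define u where "u = (if snd (ls 0) = 0 then (0, 1) else (1, 0) :: complex \<times> complex)"
      have "ndet u (ls 0) \<noteq> 0" using ls(1) by (cases "ls 0") (auto simp: u_def ndet_def)
      moreover have "annih b (7 + 0 + 0) (lform u ^ 0 * lform (ls 0) ^ 7 * (lform (ls 0) - lform u) ^ 0)"
        using ls(2) by simp
      ultimately show "p b = 0" using gap_boundary_annih[OF f _ _ p, of b u "ls 0"] by simp
    qed simp
  qed
qed

lemma smult_pow: "smult c p ^ k = smult (c ^ k) (p ^ k)" for c :: "'a::comm_semiring_1"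
  by (induction k) (simp_all add: mult_ac)

lemma locus3_subset:
  assumes f: "gap_boundary m0 mi 1 k" and m: "m0 + mi = 4" "lam = [Suc m0, Suc mi, 2]"
  shows "annihilated_locus lam \<subseteq> alg_boundary 8 k"
proof
  fix a assume a: "a \<in> annihilated_locus lam"
  show "a \<in> alg_boundary 8 k" unfolding alg_boundary_vanish
  proof (intro ballI impI)
    fix p :: "complex ^ 9 \<Rightarrow> complex" assume p: "p \<in> poly_fun" "\<forall>b\<in>topo_boundary 8 k. p (complexify b) = 0"
    show "p a = 0"
    proof (rule annihilated_locus_vanish[OF p(1) _ _ a])
      fix ls b assume ls: "\<forall>i<length lam. \<forall>j<length lam. i \<noteq> j \<longrightarrow> ndet (ls i) (ls j) \<noteq> (0::complex)"
        "annih b (8 - length lam) (\<Prod>i<length lam. lform (ls i) ^ (lam ! i - 1))"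
      have G: "(\<Prod>i<length lam. lform (ls i) ^ (lam ! i - 1)) =
          lform (ls 0) ^ m0 * lform (ls 1) ^ mi * lform (ls 2)"
        by (simp add: m(2) numeral_3_eq_3 numeral_2_eq_2)
      have nd: "ndet (ls 0) (ls 1) \<noteq> 0" "ndet (ls 0) (ls 2) \<noteq> 0" "ndet (ls 2) (ls 1) \<noteq> 0" using ls(1) m(2)
        by auto
      \<comment> \<open>Cramer's rule for the relation ls 2 = y ls 0 - x ls 1. Rescaling the first
        two forms by y and x makes the third their difference, so its root corresponds to the point
        1.\<close>
      define D where "D = ndet (ls 0) (ls 1)"
      define y where "y = ndet (ls 2) (ls 1) / D"
      define x where "x = - ndet (ls 0) (ls 2) / D"
      have xy: "x \<noteq> 0" "y \<noteq> 0" "D \<noteq> 0" using nd by (auto simp: x_def y_def D_def)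
      define w where "w = (y * fst (ls 0), y * snd (ls 0))"
      define u where "u = (x * fst (ls 1), x * snd (ls 1))"
      have "D * (y * fst (ls 0) - x * fst (ls 1)) = D * fst (ls 2)"
        "D * (y * snd (ls 0) - x * snd (ls 1)) = D * snd (ls 2)"
        using xy(3) by (simp_all add: x_def y_def field_simps) (simp_all add: D_def ndet_def algebra_simps)
      then have "lform w - lform u = lform (ls 2)" using xy(3) by (simp add: lform_def w_def u_def)
      moreover have "lform w = smult y (lform (ls 0))" "lform u = smult x (lform (ls 1))"
        unfolding w_def u_def by (rule lform_scale)+
      ultimately have "lform u ^ mi * lform w ^ m0 * (lform w - lform u) ^ 1 =
          smult (x ^ mi * y ^ m0) (lform (ls 0) ^ m0 * lform (ls 1) ^ mi * lform (ls 2))"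
        by (simp add: smult_pow mult_ac)
      then have "annih b (m0 + mi + 1) (lform u ^ mi * lform w ^ m0 * (lform w - lform u) ^ 1)"
        using ls(2) m xy unfolding G by (simp add: annih_smult)
      moreover have "ndet u w \<noteq> 0"
      proof -
        have "ndet u w = - (x * y * D)" by (simp add: u_def w_def ndet_def D_def algebra_simps)
        then show ?thesis using xy by simp
      qed
      ultimately show "p b = 0" using gap_boundary_annih[OF f _ _ p, of b u w] m(1) by simp
    qed (use m in \<open>simp add: numeral_3_eq_3\<close>)
  qed
qed

lemma vec_of_nth_less: "i \<le> 8 \<Longrightarrow> j \<le> 8 \<Longrightarrow> f j < f i \<Longrightarrow> vec_of f $ of_nat j < vec_of f $ of_nat i"
  by simp

lemma constant_gap_vec_of:
  assumes "m1 = 0 \<longrightarrow> \<beta> = 0" "\<forall>i\<in>{m0..8 - mi}. f i = \<beta>" shows "constant_gap m0 mi m1 (vec_of f)"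
  unfolding constant_gap_def by (rule exI[of _ \<beta>]) (use assms in auto)

lemma gap_boundary_intro:
  assumes "1 \<le> m0" "m1 \<le> 1" "r = m0 + mi + m1" "8 - r = Suc m1 + (if mi = 0 then 0 else 1)" "5 \<le> r" "r < 8"
    "r = 5 \<or> m1 = 0"
    and "\<And>v. (\<And>j. j < r \<Longrightarrow> norm (v j) = 1) \<Longrightarrow> annih (vec_of f) r (\<Prod>j<r. lin (v j)) \<Longrightarrow>
        \<exists>c. (\<Prod>j<r. lin (v j)) = smult c (gpoly m0 m1)"
    and f: "f m0 < f (m0 - 1)" "mi > 0 \<Longrightarrow> f m0 < f (9 - mi)" "m1 = 0 \<longrightarrow> \<beta> = 0"
      "\<forall>i\<in>{m0..8 - mi}. f i = (\<beta> :: real)"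
  shows "gap_boundary m0 mi m1 r \<and> gap_boundary m0 mi m1 (Suc r)"
proof -
  have "\<exists>\<delta>>0. \<forall>b. constant_gap m0 mi m1 b \<longrightarrow> dist b (vec_of f) < \<delta> \<longrightarrow>
      b \<in> topo_boundary 8 r \<inter> topo_boundary 8 (Suc r)"
  proof (rule boundary_family[OF assms(1-7)])
    show "vec_of f $ of_nat m0 < vec_of f $ of_nat (m0 - 1)" by (rule vec_of_nth_less) (use assms in auto)
    show "vec_of f $ of_nat m0 < vec_of f $ of_nat (9 - mi)" if "mi > 0"
      by (rule vec_of_nth_less) (use assms that in auto)
  qed (rule assms(8))
  moreover have "constant_gap m0 mi m1 (vec_of f)" using f by (intro constant_gap_vec_of) auto
  ultimately show ?thesis unfolding gap_boundary_def by blast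
qed

lemma atLeastAtMost_numerals: "{2..6} = {2,3,4,5,6::nat}" "{3..7} = {3,4,5,6,7::nat}" "{3..5} = {3,4,5::nat}"
  "{4..6} = {4,5,6::nat}" "{5..7} = {5,6,7::nat}" "{7..8} = {7,8::nat}"
  by auto

lemma gap_boundaries:
  "gap_boundary 2 2 1 5 \<and> gap_boundary 2 2 1 6" "gap_boundary 3 1 1 5 \<and> gap_boundary 3 1 1 6"
    "gap_boundary 3 3 0 6 \<and> gap_boundary 3 3 0 7"
  "gap_boundary 4 2 0 6 \<and> gap_boundary 4 2 0 7" "gap_boundary 5 1 0 6 \<and> gap_boundary 5 1 0 7"
    "gap_boundary 7 0 0 7 \<and> gap_boundary 7 0 0 8"
proof -
  show "gap_boundary 2 2 1 5 \<and> gap_boundary 2 2 1 6"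
    using gap_boundary_intro[of 2 1 5 2 "\<lambda>i. [2,2,-1,-1,-1,-1,-1,2,2] ! i" "-1"] unique_annihilator_332
      by (simp add: atLeastAtMost_numerals)
  show "gap_boundary 3 1 1 5 \<and> gap_boundary 3 1 1 6"
    using gap_boundary_intro[of 3 1 5 1 "\<lambda>i. [-1,2,2,-1,-1,-1,-1,-1,2] ! i" "-1"] unique_annihilator_422
      by (simp add: atLeastAtMost_numerals)
  show "gap_boundary 3 3 0 6 \<and> gap_boundary 3 3 0 7"
    using gap_boundary_intro[of 3 0 6 3 "\<lambda>i. [0,0,1,0,0,0,1,0,0] ! i" 0] unique_annihilator_44
      by (simp add: atLeastAtMost_numerals)
  show "gap_boundary 4 2 0 6 \<and> gap_boundary 4 2 0 7"
    using gap_boundary_intro[of 4 0 6 2 "\<lambda>i. [1/16,0,0,1,0,0,0,1,0] ! i" 0] unique_annihilator_53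
      by (simp add: atLeastAtMost_numerals)
  show "gap_boundary 5 1 0 6 \<and> gap_boundary 5 1 0 7"
    using gap_boundary_intro[of 5 0 6 1 "\<lambda>i. [0,0,-1,0,1,0,0,0,1] ! i" 0] unique_annihilator_62
      by (simp add: atLeastAtMost_numerals)
  show "gap_boundary 7 0 0 7 \<and> gap_boundary 7 0 0 8"
    using gap_boundary_intro[of 7 0 7 0 "\<lambda>i. [-4,0,3,0,-2,0,1,0,0] ! i" 0] unique_annihilator_8
      by (simp add: atLeastAtMost_numerals)
qed

section \<open>The real rank boundaries\<close>

text \<open>A root already present is repeated until degree r is reached, which creates no new
  distinct root. If there is none, a single node is used, and 8 - r is at least 1.\<close>

lemma Dset_exact:
  assumes a: "a \<in> Dset r" and r: "1 \<le> r" "r \<le> 7"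
  shows "\<exists>N. size N = r \<and> set_mset N \<subseteq> cnode \<and> card (set_mset N) \<le> 8 - r \<and> annih a r (lprod N)"
proof -
  obtain N where N: "size N \<le> r" "set_mset N \<subseteq> cnode" "card (set_mset N) \<le> 8 - r" "annih a (size N) (lprod N)"
    using a by (auto simp: Dset_def)
  obtain v where v: "v \<in> cnode" "N = {#} \<or> v \<in># N"
  proof (cases "N = {#}")
    case True then show thesis using that[of "(0, 1)"] by (simp add: cnode_def)
  next
    case False
    then obtain v where "v \<in># N" by blast
    then show thesis using that N(2) by blast
  qed
  define M where "M = N + replicate_mset (r - size N) v"
  have "annih a (size N + (r - size N)) (lprod N * lprod (replicate_mset (r - size N) v))"
    using degree_lprod[of "replicate_mset (r - size N) v"] N(1) r by (intro annih_mult[OF N(4)]) auto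
  then have "annih a r (lprod M)" using N(1) by (simp add: M_def lprod_union)
  moreover have "card (set_mset M) \<le> 8 - r"
  proof (cases "N = {#}")
    case True
    have "card (set_mset M) \<le> card {v}" by (rule card_mono) (auto simp: M_def True split: if_splits)
    then show ?thesis using r by simp
  next
    case False
    then have "set_mset M = set_mset N" using v by (auto simp: M_def split: if_splits)
    then show ?thesis using N by simp
  qed
  moreover have "size M = r" "set_mset M \<subseteq> cnode" using N v by (auto simp: M_def split: if_splits)
  ultimately show ?thesis by blast
qed

lemma annihilated_locusI:
  fixes a :: "real ^ 9"
  assumes "set vs \<subseteq> cnode" "length vs = length lam"
    "annih a (8 - length lam) (\<Prod>i<length lam. lin (vs ! i) ^ (lam ! i - 1))"
  shows "complexify a \<in> annihilated_locus lam"
proof -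
  define ls where "ls = (\<lambda>i. (complex_of_real (- snd (vs ! i)), complex_of_real (fst (vs ! i))))"
  have "complexifies (\<Prod>i<n. lin (vs ! i) ^ (lam ! i - 1)) (\<Prod>i<n. lform (ls i) ^ (lam ! i - 1))" for n
  proof (induction n)
    case (Suc n)
    have "complexifies (lin (vs ! n)) (lform (ls n))" unfolding lin_def lform_def ls_def fst_conv snd_conv
      by (rule complexifies_linear)
    then show ?case using Suc by (simp add: complexifies_mult complexifies_power)
  qed (simp add: complexifies_one)
  from annih_complexify[OF this assms(3)]
  have "annih (complexify a) (8 - length lam) (\<Prod>i<length lam. lform (ls i) ^ (lam ! i - 1))" .
  moreover have "ls i \<noteq> (0, 0)" if "i < length lam" for i
  proof -
    have "vs ! i \<in> cnode" using assms(1,2) that by (metis nth_mem subsetD)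
    then show ?thesis using cnode_nz[of "vs ! i"] by (cases "vs ! i") (auto simp: ls_def)
  qed
  ultimately show ?thesis unfolding annihilated_locus_def by blast
qed

lemma Dset_7_annihilated_locus: assumes "a \<in> Dset 7" shows "complexify a \<in> annihilated_locus [8]"
proof -
  obtain N where N: "size N = 7" "set_mset N \<subseteq> cnode" "card (set_mset N) \<le> 1" "annih a 7 (lprod N)"
    using Dset_exact[OF assms] by auto
  obtain v where v: "v \<in># N" using N(1) by (metis multiset_nonemptyE size_empty zero_neq_numeral)
  have "set_mset N = {v}"
    using N(3) v card_le_Suc0_iff_eq[of "set_mset N"] by auto
  then have "N = replicate_mset 7 v" using N(1) by (metis set_mset_subset_singletonD subset_refl)
  then have "lprod N = lin v ^ 7" by (simp add: lprod_def)
  then show ?thesis using N v by (intro annihilated_locusI[of "[v]"]) auto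
qed

lemma Dset_6_annihilated_locus: assumes "a \<in> Dset 6"
  shows "complexify a \<in> annihilated_locus [4,4] \<union> annihilated_locus [5,3] \<union> annihilated_locus [6,2]"
proof -
  obtain N where N: "size N = 6" "set_mset N \<subseteq> cnode" "card (set_mset N) \<le> 2" "annih a 6 (lprod N)"
    using Dset_exact[OF assms] by auto
  obtain v w i j where vw: "v \<in> cnode" "w \<in> cnode" "N = replicate_mset i v + replicate_mset j w" "j \<le> i"
    "1 \<le> j" "i + j = 6"
  proof -
    obtain v where v: "v \<in># N" using N(1) by (metis multiset_nonemptyE size_empty zero_neq_numeral)
    show thesis
    proof (cases "set_mset N = {v}")
      case True
      then have "N = replicate_mset 6 v" using N(1) by (metis set_mset_subset_singletonD subset_refl)
      \<comment> \<open>A sixfold root is read as 5 + 1 with both nodes equal, which puts it into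
        the locus of (6, 2).\<close>
      also have "\<dots> = replicate_mset 5 v + replicate_mset 1 v" by (simp add: eval_nat_numeral)
      finally show thesis using v N by (intro that[of v v 5 1]) auto
    next
      case False
      then obtain w where w: "w \<in># N" "w \<noteq> v" using v by auto
      have "set_mset N = {v, w}"
      proof (rule card_seteq[symmetric])
        show "card (set_mset N) \<le> card {v, w}" using N(3) w by simp
      qed (use v w in auto)
      then have eq: "N = replicate_mset (count N v) v + replicate_mset (count N w) w"
        using w by (intro multiset_eqI) (auto simp: not_in_iff[symmetric])
      have sz: "count N v + count N w = 6" using arg_cong[OF eq, of size] N(1) by simp
      have c: "1 \<le> count N v" "1 \<le> count N w" using v w by (auto simp: Suc_le_eq)
      show thesis
      proof (cases "count N w \<le> count N v")
        case True then show thesis using eq sz c v w N(2) by (intro that[of v w "count N v" "count N w"]) auto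
      next
        case False
        have "N = replicate_mset (count N w) w + replicate_mset (count N v) v" using eq by (metis add.commute)
        then show thesis using False sz c v w N(2) by (intro that[of w v "count N w" "count N v"]) auto
      qed
    qed
  qed
  have l: "lprod N = lin v ^ i * lin w ^ j" unfolding vw(3) lprod_union by (simp add: lprod_def)
  consider "i = 3" "j = 3" | "i = 4" "j = 2" | "i = 5" "j = 1" using vw(4-6) by linarith
  then show ?thesis
  proof cases
    case 1
    then have "complexify a \<in> annihilated_locus [4,4]" using N(4)[unfolded l] vw(1,2)
      by (intro annihilated_locusI[of "[v, w]"]) (auto simp: numeral_2_eq_2)
    then show ?thesis by blast
  next
    case 2
    then have "complexify a \<in> annihilated_locus [5,3]" using N(4)[unfolded l] vw(1,2)
      by (intro annihilated_locusI[of "[v, w]"]) (auto simp: numeral_2_eq_2)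
    then show ?thesis by blast
  next
    case 3
    then have "complexify a \<in> annihilated_locus [6,2]" using N(4)[unfolded l] vw(1,2)
      by (intro annihilated_locusI[of "[v, w]"]) (auto simp: numeral_2_eq_2)
    then show ?thesis by blast
  qed
qed

lemma repeated_element:
  assumes "card (set_mset N) < size N" shows "\<exists>x M. N = add_mset x (add_mset x M)"
proof -
  have "\<not> (\<forall>x. count N x \<le> 1)"
  proof
    assume "\<forall>x. count N x \<le> 1"
    then have "N = mset_set (set_mset N)"
      by (intro multiset_eqI) (metis count_mset_set(1) count_mset_set(3) finite_set_mset le_antisym not_in_iff count_greater_eq_one_iff)
    then have "size N = card (set_mset N)" by (metis size_mset_set)
    then show False using assms by simp
  qed
  then obtain x where x: "count N x \<ge> 2" by (auto simp: not_le Suc_le_eq numeral_2_eq_2)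
  then obtain M where M: "N = add_mset x M" by (metis count_inI insert_DiffM not_numeral_le_zero)
  then have "x \<in># M" using x by (metis Suc_1 Suc_le_mono count_add_mset count_greater_eq_one_iff One_nat_def)
  then show ?thesis using M by (metis insert_DiffM)
qed

text \<open>Five roots on at most three nodes contain a double root x. The other three either
  contain a double root again, which is the pattern 2+2+1, or are distinct and then exhaust the
  nodes, so that x occurs among them and the pattern is 3+1+1.\<close>

lemma Dset_5_annihilated_locus: assumes "a \<in> Dset 5"
  shows "complexify a \<in> annihilated_locus [3,3,2] \<union> annihilated_locus [4,2,2]"
proof -
  obtain N where N: "size N = 5" "set_mset N \<subseteq> cnode" "card (set_mset N) \<le> 3" "annih a 5 (lprod N)"
    using Dset_exact[OF assms] by auto
  obtain x M where M: "N = add_mset x (add_mset x M)" using repeated_element[of N] N by auto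
  have sM: "size M = 3" using M N by simp
  show ?thesis
  proof (cases "card (set_mset M) < size M")
    case True
    then obtain y K where K: "M = add_mset y (add_mset y K)" using repeated_element by blast
    then have "size K = 1" using sM by simp
    then obtain z where z: "K = {#z#}" using size_1_singleton_mset by blast
    have l: "lprod N = lin x ^ 2 * lin y ^ 2 * lin z" unfolding M K z by (simp add: power2_eq_square mult_ac)
    have "x \<in> cnode" "y \<in> cnode" "z \<in> cnode" using N(2) unfolding M K z by auto
    then have "complexify a \<in> annihilated_locus [3,3,2]" using N(4)[unfolded l]
      by (intro annihilated_locusI[of "[x, y, z]"]) (auto simp: numeral_3_eq_3 numeral_2_eq_2)
    then show ?thesis by blast
  next
    case False
    have "card (set_mset M) = card (set_mset N)"
    proof -
      have "card (set_mset M) \<le> card (set_mset N)" by (rule card_mono) (auto simp: M)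
      then show ?thesis using False sM N(3) by simp
    qed
    then have "set_mset M = set_mset N" by (intro card_subset_eq) (auto simp: M)
    then have "x \<in># M" using M by auto
    then obtain K where K: "M = add_mset x K" by (metis insert_DiffM)
    then have "size K = 2" using sM by simp
    then obtain y L where L: "K = add_mset y L" "size L = 1"
      using size_eq_Suc_imp_eq_union[of K 1] by (auto simp: numeral_2_eq_2)
    then obtain z where z: "L = {#z#}" using size_1_singleton_mset by blast
    have l: "lprod N = lin x ^ 3 * lin y * lin z" unfolding M K L z by (simp add: power3_eq_cube mult_ac)
    have "x \<in> cnode" "y \<in> cnode" "z \<in> cnode" using N(2) unfolding M K L z by auto
    then have "complexify a \<in> annihilated_locus [4,2,2]" using N(4)[unfolded l]
      by (intro annihilated_locusI[of "[x, y, z]"]) (auto simp: numeral_3_eq_3 numeral_2_eq_2)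
    then show ?thesis by blast
  qed
qed

lemma zariski_closure_Un: "zariski_closure (S \<union> T) = zariski_closure S \<union> zariski_closure T"
proof
  show "zariski_closure S \<union> zariski_closure T \<subseteq> zariski_closure (S \<union> T)" by (auto simp: zariski_closure_def)
  show "zariski_closure (S \<union> T) \<subseteq> zariski_closure S \<union> zariski_closure T"
  proof (rule ccontr)
    assume "\<not> ?thesis"
    then obtain z p q where z: "z \<in> zariski_closure (S \<union> T)" "p \<in> poly_fun" "\<forall>s\<in>S. p s = 0" "p z \<noteq> 0"
      "q \<in> poly_fun" "\<forall>s\<in>T. q s = 0" "q z \<noteq> 0" by (auto simp: zariski_closure_def)
    have "(\<lambda>z. p z * q z) \<in> poly_fun" using z by (intro pf_mult)
    then have "p z * q z = 0" using z unfolding zariski_closure_def by fastforce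
    then show False using z by simp
  qed
qed

lemma alg_boundary_eqI:
  assumes "complexify ` topo_boundary 8 k \<subseteq> S" "S \<subseteq> alg_boundary 8 k"
  shows "alg_boundary 8 k = zariski_closure S"
  using assms unfolding alg_boundary_def zariski_closure_def by blast

theorem theorem5p1:
  shows "(alg_boundary 8 5 :: (complex ^ 9) set) =
           dual_crl 8 [3,3,2] \<union> dual_crl 8 [4,2,2] \<and>
         (alg_boundary 8 6 :: (complex ^ 9) set) =
           dual_crl 8 [3,3,2] \<union> dual_crl 8 [4,2,2] \<union> dual_crl 8 [4,4]
           \<union> dual_crl 8 [5,3] \<union> dual_crl 8 [6,2] \<and>
         (alg_boundary 8 7 :: (complex ^ 9) set) =
           dual_crl 8 [4,4] \<union> dual_crl 8 [5,3] \<union> dual_crl 8 [6,2] \<union> dual_crl 8 [8] \<and>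
         (alg_boundary 8 8 :: (complex ^ 9) set) = dual_crl 8 [8]"
proof -
  have d: "dual_crl 8 [3,3,2] = zariski_closure (annihilated_locus [3,3,2])"
    "dual_crl 8 [4,2,2] = zariski_closure (annihilated_locus [4,2,2])"
    "dual_crl 8 [4,4] = zariski_closure (annihilated_locus [4,4])"
      "dual_crl 8 [5,3] = zariski_closure (annihilated_locus [5,3])"
    "dual_crl 8 [6,2] = zariski_closure (annihilated_locus [6,2])"
      "dual_crl 8 [8] = zariski_closure (annihilated_locus [8])"
    by (rule dual_crl_annihilated_locus, simp add: numeral_3_eq_3 numeral_2_eq_2)+
  have b: "topo_boundary 8 5 \<subseteq> Dset 5" "topo_boundary 8 6 \<subseteq> Dset 6 \<union> Dset 5"
    "topo_boundary 8 7 \<subseteq> Dset 7 \<union> Dset 6" "topo_boundary 8 8 \<subseteq> Dset 7"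
    using boundary_subset_Dset[of 4] boundary_subset_Dset[of 5] boundary_subset_Dset[of 6] boundary_subset_Dset[of 7] Dset_8 by auto
  have r332: "annihilated_locus [3,3,2] \<subseteq> alg_boundary 8 5" "annihilated_locus [3,3,2] \<subseteq> alg_boundary 8 6"
    using gap_boundaries(1) locus3_subset[of 2 2 5 "[3,3,2]"] locus3_subset[of 2 2 6 "[3,3,2]"] by simp_all
  have r422: "annihilated_locus [4,2,2] \<subseteq> alg_boundary 8 5" "annihilated_locus [4,2,2] \<subseteq> alg_boundary 8 6"
    using gap_boundaries(2) locus3_subset[of 3 1 5 "[4,2,2]"] locus3_subset[of 3 1 6 "[4,2,2]"] by simp_all
  have r44: "annihilated_locus [4,4] \<subseteq> alg_boundary 8 6" "annihilated_locus [4,4] \<subseteq> alg_boundary 8 7"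
    using gap_boundaries(3) locus2_subset[of 3 3 6 "[4,4]"] locus2_subset[of 3 3 7 "[4,4]"] by simp_all
  have r53: "annihilated_locus [5,3] \<subseteq> alg_boundary 8 6" "annihilated_locus [5,3] \<subseteq> alg_boundary 8 7"
    using gap_boundaries(4) locus2_subset[of 4 2 6 "[5,3]"] locus2_subset[of 4 2 7 "[5,3]"] by simp_all
  have r62: "annihilated_locus [6,2] \<subseteq> alg_boundary 8 6" "annihilated_locus [6,2] \<subseteq> alg_boundary 8 7"
    using gap_boundaries(5) locus2_subset[of 5 1 6 "[6,2]"] locus2_subset[of 5 1 7 "[6,2]"] by simp_all
  have r8: "annihilated_locus [8] \<subseteq> alg_boundary 8 7" "annihilated_locus [8] \<subseteq> alg_boundary 8 8"
    using gap_boundaries(6) locus1_subset by auto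
  have "alg_boundary 8 5 = zariski_closure (annihilated_locus [3,3,2] \<union> annihilated_locus [4,2,2])"
    by (rule alg_boundary_eqI) (use b(1) Dset_5_annihilated_locus r332 r422 in blast)+
  moreover have "alg_boundary 8 6 =
      zariski_closure (annihilated_locus [3,3,2] \<union> annihilated_locus [4,2,2] \<union> annihilated_locus [4,4] \<union> annihilated_locus [5,3] \<union> annihilated_locus [6,2])"
    by (rule alg_boundary_eqI) (use b(2) Dset_5_annihilated_locus Dset_6_annihilated_locus r332 r422 r44 r53 r62 in blast)+
  moreover have "alg_boundary 8 7 =
      zariski_closure (annihilated_locus [4,4] \<union> annihilated_locus [5,3] \<union> annihilated_locus [6,2] \<union> annihilated_locus [8])"
    by (rule alg_boundary_eqI) (use b(3) Dset_6_annihilated_locus Dset_7_annihilated_locus r44 r53 r62 r8 in blast)+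
  moreover have "alg_boundary 8 8 = zariski_closure (annihilated_locus [8])"
    by (rule alg_boundary_eqI) (use b(4) Dset_7_annihilated_locus r8 in blast)+
  ultimately show ?thesis by (simp only: d zariski_closure_Un simp_thms)
qed

end
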